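(* Let $V$ be an irreducible integrable module over $\widetilde{LT}$ with $K_1,\dots,K_n$ acting trivially on $V$. Then there exists a non-zero $v\in V$ such that $(\widetilde{LT})_+.v=0$.
   Context: Everything is over $\mathbb C$. **The Lie torus.** $\mathfrak g$ is a finite-dimensional simple Lie algebra with a symmetric non-degenerate invariant bilinear form $(\cdot|\cdot)$, invariant under all automorphisms of $\mathfrak g$. $n\in\mathbb N$, $A=\mathbb C[t_1^{\pm1},\dots,t_n^{\pm1}]$, $t^{\underline k}=t_1^{k_1}\cdots t_n^{k_n}$ and $x(\underline k)=x\otimes t^{\underline k}$ for $\underline k\in\mathbb Z^n$. $\sigma_1,\dots,\sigma_n$ are commuting automorphisms of $\mathfrak g$ of finite orders $m_1,\dots,m_n$; $\xi_i$ is a primitive $m_i$-th root of unity; $\Gamma=m_1\mathbb Z\oplus\cdots\oplus m_n\mathbb Z$; $\overline k$ is the class of $\underline k$ in $\mathbb Z^n/\Gamma$; $\mathfrak g_{\overline k}=\{x\in\mathfrak g:\sigma_ix=\xi_i^{k_i}x,\ 1\le i\le n\}$. $LT=\bigoplus_{\underline k\in\mathbb Z^n}\mathfrak g_{\overline k}\otimes\mathbb Ct^{\underline k}$ with bracket $[x\otimes f,y\otimes g]=[x,y]\otimes fg$. Standing assumption: $LT$ is a Lie torus, i.e. (1) $\mathfrak g_{\overline 0}$ is a finite-dimensional simple Lie algebra (with Cartan subalgebra $\mathfrak h_{\overline0}$); (2) for $\overline k\ne\overline0$ with $\mathfrak g_{\overline k}\neq0$, as $\mathfrak g_{\overline0}$-module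 $\mathfrak g_{\overline k}\cong U_{\overline k}\oplus W_{\overline k}$ with $U_{\overline k}$ trivial and $W_{\overline k}$ either zero or irreducible of dimension $>1$ with all $\mathfrak h_{\overline0}$-weights in $\Delta_{0,\mathrm{en}}$; (3) $|\langle\sigma_1,\dots,\sigma_n\rangle|=\prod_i m_i$. Here $\Delta_0^\times$ is the set of non-zero roots of $(\mathfrak g_{\overline0},\mathfrak h_{\overline0})$, $\Delta_{0,\mathrm{en}}^\times=\Delta_0^\times\cup2\Delta^\times_{0,\mathrm{sh}}$ ($\mathrm{sh}$ = short roots) if $\Delta_0^\times$ is of type $B_l$ ($l\ge1$, $B_1=A_1$), $\Delta_{0,\mathrm{en}}^\times=\Delta_0^\times$ otherwise, and $\Delta_{0,\mathrm{en}}=\Delta_{0,\mathrm{en}}^\times\cup\{0\}$. For $\alpha\in\mathfrak h_{\overline0}^*$, $\mathfrak g_{\overline k}(\alpha)=\{x\in\mathfrak g_{\overline k}:[h,x]=\alpha(h)x\ \forall h\in\mathfrak h_{\overline0}\}$. Fix simple roots of $\mathfrak g_{\overline0}$; $\Delta_{0,\mathrm{en}}^{\times,\pm}$ are the corresponding positive/negative elements of $\Delta_{0,\mathrm{en}}^\times$. **The graded Lie torus.** $\mathcal Z(\underline m)$ is the space spanned by symbols $t^{\underline k}K_i$ ($\underline k\in\Gamma$, $1\le i\le n$) modulo the relations $\sum_ik_it^{\underline k}K_i=0$; $K_i=t^{\underline0}K_i$. $D$ has basis $d_1,\dots,d_n$. $\widetilde{LT}=LT\oplus\mathcal Z(\underline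 m)\oplus D$ with $[x(\underline k),y(\underline l)]=[x,y](\underline k+\underline l)+(x|y)\sum_ik_it^{\underline k+\underline l}K_i$, $\mathcal Z(\underline m)$ central in $LT\oplus\mathcal Z(\underline m)$, $[d_i,x(\underline k)]=k_ix(\underline k)$, $[d_i,t^{\underline k}K_j]=k_it^{\underline k}K_j$, $[d_i,d_j]=0$. $\widetilde{\mathfrak h}=\mathfrak h_{\overline0}\oplus\sum_i\mathbb CK_i\oplus\sum_i\mathbb Cd_i$. Put $(\widetilde{LT})_{+}=\bigoplus_{\alpha\in\Delta_{0,\mathrm{en}}^{\times,+},\,\underline k\in\mathbb Z^n}\mathfrak g_{\overline k}(\alpha)\otimes\mathbb Ct^{\underline k}$. **Integrable.** An $\widetilde{LT}$-module $V$ is integrable if it is the direct sum of its weight spaces $V_\lambda$ ($\lambda\in\widetilde{\mathfrak h}^*$), all $V_\lambda$ are finite-dimensional, and every element of $\mathfrak g_{\overline k}(\alpha)\otimes\mathbb Ct^{\underline k}$ with $\alpha\neq0$ acts locally nilpotently on $V$. *)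

theory Defs
  imports
    "HOL-Analysis.Finite_Cartesian_Product"
    "HOL-Algebra.Bij"
    "HOL-Algebra.Generated_Groups"
    "HOL-Library.Poly_Mapping"
    "HOL-Library.Function_Algebras"
    "HOL-Library.Product_Plus"
begin

section \<open>Complex vector spaces\<close>

class complex_vector = ab_group_add +
  fixes scaleC :: "complex \<Rightarrow> 'a \<Rightarrow> 'a"  (infixr "*\<^sub>C" 75)
  assumes scaleC_add_right: "c *\<^sub>C (x + y) = c *\<^sub>C x + c *\<^sub>C y"
    and scaleC_add_left: "(c + d) *\<^sub>C x = c *\<^sub>C x + d *\<^sub>C x"
    and scaleC_scaleC: "c *\<^sub>C d *\<^sub>C x = (c * d) *\<^sub>C x"
    and scaleC_one: "1 *\<^sub>C x = x"

global_interpretation cv: vector_space "scaleC :: complex \<Rightarrow> 'a \<Rightarrow> 'a::complex_vector"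
  by unfold_locales (auto simp: scaleC_add_right scaleC_add_left scaleC_scaleC scaleC_one)

instantiation complex :: complex_vector
begin
definition scaleC_complex :: "complex \<Rightarrow> complex \<Rightarrow> complex" where
  "scaleC_complex c x = c * x"
instance by standard (auto simp: scaleC_complex_def algebra_simps)
end

instantiation "fun" :: (type, complex_vector) complex_vector
begin
definition scaleC_fun :: "complex \<Rightarrow> ('a \<Rightarrow> 'b) \<Rightarrow> 'a \<Rightarrow> 'b" where
  "scaleC_fun c f = (\<lambda>x. c *\<^sub>C f x)"
instance
  by standard
    (auto simp: scaleC_fun_def fun_eq_iff scaleC_add_right scaleC_add_left scaleC_scaleC scaleC_one)
end

instantiation vec :: (complex_vector, finite) complex_vector
begin
definition scaleC_vec :: "complex \<Rightarrow> 'a ^ 'b \<Rightarrow> 'a ^ 'b" where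
  "scaleC_vec c v = (\<chi> i. c *\<^sub>C v $ i)"
instance
  by standard
    (auto simp: scaleC_vec_def vec_eq_iff scaleC_add_right scaleC_add_left scaleC_scaleC scaleC_one)
end

instantiation prod :: (complex_vector, complex_vector) complex_vector
begin
definition scaleC_prod :: "complex \<Rightarrow> 'a \<times> 'b \<Rightarrow> 'a \<times> 'b" where
  "scaleC_prod c p = (c *\<^sub>C fst p, c *\<^sub>C snd p)"
instance
  by standard
    (auto simp: scaleC_prod_def prod_eq_iff scaleC_add_right scaleC_add_left scaleC_scaleC scaleC_one)
end

instantiation poly_mapping :: (type, complex_vector) complex_vector
begin
definition scaleC_poly_mapping :: "complex \<Rightarrow> ('a \<Rightarrow>\<^sub>0 'b) \<Rightarrow> ('a \<Rightarrow>\<^sub>0 'b)" where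
  "scaleC_poly_mapping c f = Poly_Mapping.map (scaleC c) f"
instance
  by standard
    (auto simp: scaleC_poly_mapping_def poly_mapping_eq_iff fun_eq_iff map.rep_eq when_def
      lookup_add scaleC_add_right scaleC_add_left scaleC_scaleC scaleC_one
      simp flip: scaleC_add_right)
end

lemma lookup_scaleC: "Poly_Mapping.lookup (c *\<^sub>C f) k = c *\<^sub>C Poly_Mapping.lookup f k"
  by (simp add: scaleC_poly_mapping_def map.rep_eq when_def)

definition fin_dim :: "'a::complex_vector set \<Rightarrow> bool" where
  "fin_dim S \<longleftrightarrow> (\<exists>B. finite B \<and> cv.span B = S)"

text \<open>The dual of a subspace \<open>H\<close> of an ambient space; functionals are extended by zero
  outside \<open>H\<close>, so that each of them is represented by exactly one function.\<close>

definition dual :: "'a::complex_vector set \<Rightarrow> ('a \<Rightarrow> complex) set" where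
  "dual H = {f. (\<forall>x\<in>H. \<forall>y\<in>H. f (x + y) = f x + f y) \<and> (\<forall>c. \<forall>x\<in>H. f (c *\<^sub>C x) = c * f x) \<and>
                (\<forall>x. x \<notin> H \<longrightarrow> f x = 0)}"

definition is_direct_sum :: "'i set \<Rightarrow> ('i \<Rightarrow> 'v::complex_vector set) \<Rightarrow> bool" where
  "is_direct_sum I S \<longleftrightarrow>
     (\<forall>v. \<exists>!f. (\<forall>i\<in>I. f i \<in> S i) \<and> (\<forall>i. i \<notin> I \<longrightarrow> f i = 0) \<and>
               finite {i. f i \<noteq> 0} \<and> v = (\<Sum>i | f i \<noteq> 0. f i))"

section \<open>Lie algebras and modules, on a subspace of an ambient type\<close>

locale lie_algebra =
  fixes b :: "'a::complex_vector \<Rightarrow> 'a \<Rightarrow> 'a" and L :: "'a set"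
  assumes subspace: "cv.subspace L"
    and closed: "\<lbrakk>x \<in> L; y \<in> L\<rbrakk> \<Longrightarrow> b x y \<in> L"
    and add_left: "\<lbrakk>x \<in> L; y \<in> L; z \<in> L\<rbrakk> \<Longrightarrow> b (x + y) z = b x z + b y z"
    and add_right: "\<lbrakk>x \<in> L; y \<in> L; z \<in> L\<rbrakk> \<Longrightarrow> b x (y + z) = b x y + b x z"
    and scale_left: "\<lbrakk>x \<in> L; y \<in> L\<rbrakk> \<Longrightarrow> b (c *\<^sub>C x) y = c *\<^sub>C b x y"
    and scale_right: "\<lbrakk>x \<in> L; y \<in> L\<rbrakk> \<Longrightarrow> b x (c *\<^sub>C y) = c *\<^sub>C b x y"
    and alternating: "x \<in> L \<Longrightarrow> b x x = 0"
    and jacobi: "\<lbrakk>x \<in> L; y \<in> L; z \<in> L\<rbrakk> \<Longrightarrow> b x (b y z) + b y (b z x) + b z (b x y) = 0"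

definition lie_ideal :: "('a::complex_vector \<Rightarrow> 'a \<Rightarrow> 'a) \<Rightarrow> 'a set \<Rightarrow> 'a set \<Rightarrow> bool" where
  "lie_ideal b L I \<longleftrightarrow> cv.subspace I \<and> I \<subseteq> L \<and> (\<forall>x\<in>L. \<forall>y\<in>I. b x y \<in> I)"

locale simple_lie_algebra = lie_algebra +
  assumes nonabelian: "\<exists>x\<in>L. \<exists>y\<in>L. b x y \<noteq> 0"
    and ideal_trivial: "lie_ideal b L I \<Longrightarrow> I = {0} \<or> I = L"

definition lie_automorphism ::
  "('a::complex_vector \<Rightarrow> 'a \<Rightarrow> 'a) \<Rightarrow> ('a \<Rightarrow> 'a) \<Rightarrow> bool" where
  "lie_automorphism b \<phi> \<longleftrightarrow>
     Vector_Spaces.linear scaleC scaleC \<phi> \<and> bij \<phi> \<and> (\<forall>x y. \<phi> (b x y) = b (\<phi> x) (\<phi> y))"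

text \<open>Cartan subalgebras, in the definition usual for semisimple complex Lie algebras:
  abelian, self-centralising and acting diagonalisably by \<open>ad\<close>.\<close>

definition cartan_subalgebra ::
  "('a::complex_vector \<Rightarrow> 'a \<Rightarrow> 'a) \<Rightarrow> 'a set \<Rightarrow> 'a set \<Rightarrow> bool" where
  "cartan_subalgebra b L H \<longleftrightarrow>
     cv.subspace H \<and> H \<subseteq> L \<and> (\<forall>x\<in>H. \<forall>y\<in>H. b x y = 0) \<and>
     (\<forall>x\<in>L. (\<forall>h\<in>H. b h x = 0) \<longrightarrow> x \<in> H) \<and>
     (\<forall>h\<in>H. L = cv.span {x\<in>L. \<exists>c. b h x = c *\<^sub>C x})"

locale lie_module =
  fixes b :: "'a::complex_vector \<Rightarrow> 'a \<Rightarrow> 'a" and L :: "'a set"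
    and \<rho> :: "'a \<Rightarrow> 'v::complex_vector \<Rightarrow> 'v" and M :: "'v set"
  assumes subspace: "cv.subspace M"
    and closed: "\<lbrakk>x \<in> L; v \<in> M\<rbrakk> \<Longrightarrow> \<rho> x v \<in> M"
    and add_left: "\<lbrakk>x \<in> L; y \<in> L; v \<in> M\<rbrakk> \<Longrightarrow> \<rho> (x + y) v = \<rho> x v + \<rho> y v"
    and scale_left: "\<lbrakk>x \<in> L; v \<in> M\<rbrakk> \<Longrightarrow> \<rho> (c *\<^sub>C x) v = c *\<^sub>C \<rho> x v"
    and add_right: "\<lbrakk>x \<in> L; v \<in> M; w \<in> M\<rbrakk> \<Longrightarrow> \<rho> x (v + w) = \<rho> x v + \<rho> x w"
    and scale_right: "\<lbrakk>x \<in> L; v \<in> M\<rbrakk> \<Longrightarrow> \<rho> x (c *\<^sub>C v) = c *\<^sub>C \<rho> x v"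
    and bracket: "\<lbrakk>x \<in> L; y \<in> L; v \<in> M\<rbrakk> \<Longrightarrow> \<rho> (b x y) v = \<rho> x (\<rho> y v) - \<rho> y (\<rho> x v)"

definition lie_irreducible ::
  "'a set \<Rightarrow> ('a \<Rightarrow> 'v::complex_vector \<Rightarrow> 'v) \<Rightarrow> 'v set \<Rightarrow> bool" where
  "lie_irreducible L \<rho> M \<longleftrightarrow> M \<noteq> {0} \<and>
     (\<forall>N. cv.subspace N \<and> N \<subseteq> M \<and> (\<forall>x\<in>L. \<forall>v\<in>N. \<rho> x v \<in> N) \<longrightarrow> N = {0} \<or> N = M)"

locale invariant_form =
  fixes b :: "'a::complex_vector \<Rightarrow> 'a \<Rightarrow> 'a" and B :: "'a \<Rightarrow> 'a \<Rightarrow> complex"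
  assumes form_add: "B (x + y) z = B x z + B y z"
    and form_scale: "B (c *\<^sub>C x) y = c * B x y"
    and form_sym: "B x y = B y x"
    and form_nondegenerate: "(\<And>y. B x y = 0) \<Longrightarrow> x = 0"
    and form_invariant: "B (b x y) z = B x (b y z)"
    and form_automorphism: "lie_automorphism b \<phi> \<Longrightarrow> B (\<phi> x) (\<phi> y) = B x y"

section \<open>Root systems\<close>

text \<open>\<open>\<Phi>\<close> is the image, under an injective linear map, of the standard root system
  \<open>{\<plusminus>e\<^sub>i} \<union> {\<plusminus>e\<^sub>i \<plusminus> e\<^sub>j | i \<noteq> j}\<close> of type \<open>B\<^sub>l\<close>; for \<open>l = 1\<close> this is \<open>A\<^sub>1\<close>.\<close>

definition type_B :: "nat \<Rightarrow> 'a::complex_vector set \<Rightarrow> bool" where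
  "type_B l \<Phi> \<longleftrightarrow> (\<exists>e. inj_on e {..<l} \<and> cv.independent (e ` {..<l}) \<and>
     \<Phi> = {s *\<^sub>C e i | s i. i < l \<and> s \<in> {1, -1}} \<union>
         {s *\<^sub>C e i + s' *\<^sub>C e j | s s' i j. i < l \<and> j < l \<and> i \<noteq> j \<and> s \<in> {1, -1} \<and> s' \<in> {1, -1}})"

definition nonneg_combinations :: "'a::complex_vector set \<Rightarrow> 'a set" where
  "nonneg_combinations S = {\<beta>. \<exists>c :: 'a \<Rightarrow> nat. \<beta> = (\<Sum>\<alpha>\<in>S. of_nat (c \<alpha>) *\<^sub>C \<alpha>)}"

definition simple_roots :: "'a::complex_vector set \<Rightarrow> 'a set \<Rightarrow> bool" where
  "simple_roots \<Phi> S \<longleftrightarrow> S \<subseteq> \<Phi> \<and> finite S \<and> cv.independent S \<and>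
     (\<forall>\<beta>\<in>\<Phi>. \<beta> \<in> nonneg_combinations S \<or> - \<beta> \<in> nonneg_combinations S)"

section \<open>Lie tori\<close>

text \<open>The data of a Lie torus: bracket and invariant form on \<open>\<gg>\<close> (the whole type \<open>'g\<close>), the
  automorphisms \<open>\<sigma>\<^sub>i\<close>, their exact orders \<open>m\<^sub>i\<close>, the roots of unity \<open>\<xi>\<^sub>i\<close> and the Cartan subalgebra of
  the degree zero part. The index set \<open>{1, \<dots>, n}\<close> is the finite type \<open>'n\<close>.\<close>

record ('g, 'n) torus_data =
  br :: "'g \<Rightarrow> 'g \<Rightarrow> 'g"
  form :: "'g \<Rightarrow> 'g \<Rightarrow> complex"
  sig :: "'n \<Rightarrow> 'g \<Rightarrow> 'g"
  sig_ord :: "'n \<Rightarrow> nat"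
  xi :: "'n \<Rightarrow> complex"
  csa :: "'g set"

definition Gamma :: "('g, 'n::finite) torus_data \<Rightarrow> (int ^ 'n) set" where
  "Gamma T = {k. \<forall>i. int (sig_ord T i) dvd k $ i}"

definition grade :: "('g::complex_vector, 'n::finite) torus_data \<Rightarrow> int ^ 'n \<Rightarrow> 'g set" where
  "grade T k = {x. \<forall>i. sig T i x = (xi T i powi (k $ i)) *\<^sub>C x}"

definition root_space ::
  "('g::complex_vector, 'n::finite) torus_data \<Rightarrow> int ^ 'n \<Rightarrow> ('g \<Rightarrow> complex) \<Rightarrow> 'g set" where
  "root_space T k \<alpha> = {x \<in> grade T k. \<forall>h\<in>csa T. br T h x = \<alpha> h *\<^sub>C x}"

definition roots0 :: "('g::complex_vector, 'n::finite) torus_data \<Rightarrow> ('g \<Rightarrow> complex) set" where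
  "roots0 T = {\<alpha> \<in> dual (csa T). \<alpha> \<noteq> 0 \<and> root_space T 0 \<alpha> \<noteq> {0}}"

text \<open>\<open>(\<alpha>|\<alpha>)\<close> for the form induced on the dual of the Cartan subalgebra through the
  vector \<open>t\<^sub>\<alpha>\<close> representing \<open>\<alpha>\<close>.\<close>

definition dual_vector ::
  "('g::complex_vector, 'n::finite) torus_data \<Rightarrow> ('g \<Rightarrow> complex) \<Rightarrow> 'g" where
  "dual_vector T \<alpha> = (THE t. t \<in> csa T \<and> (\<forall>h\<in>csa T. form T t h = \<alpha> h))"

definition sq_length ::
  "('g::complex_vector, 'n::finite) torus_data \<Rightarrow> ('g \<Rightarrow> complex) \<Rightarrow> complex" where
  "sq_length T \<alpha> = form T (dual_vector T \<alpha>) (dual_vector T \<alpha>)"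

text \<open>On the degree zero part the form is a non-zero complex multiple of the Killing form, so
  the squared lengths of roots are positive only up to a common complex factor; taking absolute
  values removes it. If all roots have the same length, all of them are short, as is required for
  \<open>B\<^sub>1 = A\<^sub>1\<close>.\<close>

definition short_roots0 :: "('g::complex_vector, 'n::finite) torus_data \<Rightarrow> ('g \<Rightarrow> complex) set" where
  "short_roots0 T = {\<alpha> \<in> roots0 T. \<forall>\<beta>\<in>roots0 T. cmod (sq_length T \<alpha>) \<le> cmod (sq_length T \<beta>)}"

definition roots_en :: "('g::complex_vector, 'n::finite) torus_data \<Rightarrow> ('g \<Rightarrow> complex) set" where
  "roots_en T = (if \<exists>l\<ge>1. type_B l (roots0 T)
                 then roots0 T \<union> {2 *\<^sub>C \<alpha> | \<alpha>. \<alpha> \<in> short_roots0 T} else roots0 T)"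

definition roots_en_pos ::
  "('g::complex_vector, 'n::finite) torus_data \<Rightarrow> ('g \<Rightarrow> complex) set \<Rightarrow> ('g \<Rightarrow> complex) set" where
  "roots_en_pos T S = roots_en T \<inter> nonneg_combinations S"

locale lie_torus =
  fixes T :: "('g::complex_vector, 'n::finite) torus_data"
  assumes simple: "simple_lie_algebra (br T) UNIV"
    and finite_dimensional: "fin_dim (UNIV :: 'g set)"
    and invariant: "invariant_form (br T) (form T)"
    and sig_automorphism: "lie_automorphism (br T) (sig T i)"
    and sig_commute: "sig T i \<circ> sig T j = sig T j \<circ> sig T i"
    and sig_order: "sig_ord T i > 0" "sig T i ^^ sig_ord T i = id"
      "\<lbrakk>0 < q; q < sig_ord T i\<rbrakk> \<Longrightarrow> sig T i ^^ q \<noteq> id"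
    and xi_primitive: "xi T i ^ sig_ord T i = 1" "\<lbrakk>0 < q; q < sig_ord T i\<rbrakk> \<Longrightarrow> xi T i ^ q \<noteq> 1"
    and grade0_simple: "simple_lie_algebra (br T) (grade T 0)"
    and grade0_finite_dimensional: "fin_dim (grade T 0)"
    and cartan: "cartan_subalgebra (br T) (grade T 0) (csa T)"
    and grade_decomposition:
      "\<lbrakk>k \<notin> Gamma T; grade T k \<noteq> {0}\<rbrakk> \<Longrightarrow>
        \<exists>U W. lie_module (br T) (grade T 0) (br T) U \<and> lie_module (br T) (grade T 0) (br T) W \<and>
          grade T k = {u + w | u w. u \<in> U \<and> w \<in> W} \<and> U \<inter> W = {0} \<and>
          (\<forall>x\<in>grade T 0. \<forall>u\<in>U. br T x u = 0) \<and>
          (W = {0} \<or>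
           lie_irreducible (grade T 0) (br T) W \<and> cv.dim W > 1 \<and>
           (\<forall>\<alpha>\<in>dual (csa T). W \<inter> root_space T k \<alpha> \<noteq> {0} \<longrightarrow> \<alpha> \<in> roots_en T \<union> {0}))"
    and group_order: "card (generate (BijGroup UNIV) (range (sig T))) = (\<Prod>i\<in>UNIV. sig_ord T i)"

section \<open>The space of central symbols\<close>

text \<open>The quotient is formed for all exponents \<open>k \<in> \<int>\<^sup>n\<close> at once. As the relations are
  homogeneous in \<open>k\<close>, the subspace spanned by the symbols with \<open>k \<in> \<Gamma>\<close> is the quotient of the
  free space on these symbols by the relations with \<open>k \<in> \<Gamma>\<close>.\<close>

definition symbol_relations :: "((int ^ 'n::finite) \<times> 'n \<Rightarrow>\<^sub>0 complex) set" where
  "symbol_relations = {(\<Sum>i\<in>UNIV. Poly_Mapping.single (k, i) (of_int (k $ i))) | k. True}"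

definition symbol_equiv ::
  "((int ^ 'n::finite) \<times> 'n \<Rightarrow>\<^sub>0 complex) \<Rightarrow> ((int ^ 'n) \<times> 'n \<Rightarrow>\<^sub>0 complex) \<Rightarrow> bool" where
  "symbol_equiv a b \<longleftrightarrow> a - b \<in> cv.span symbol_relations"

lemma equivp_symbol_equiv: "equivp symbol_equiv"
proof (rule equivpI)
  show "reflp symbol_equiv"
    by (simp add: reflp_def symbol_equiv_def cv.span_zero)
  show "symp symbol_equiv"
    unfolding symp_def symbol_equiv_def by (metis cv.span_neg minus_diff_eq)
  show "transp symbol_equiv"
    unfolding transp_def symbol_equiv_def by (auto dest: cv.span_add)
qed

quotient_type (overloaded) 'n symbols =
  "(int ^ 'n::finite) \<times> 'n \<Rightarrow>\<^sub>0 complex" / symbol_equiv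
  by (rule equivp_symbol_equiv)

instantiation symbols :: (finite) complex_vector
begin

lift_definition zero_symbols :: "'a symbols" is 0 .

lift_definition plus_symbols :: "'a symbols \<Rightarrow> 'a symbols \<Rightarrow> 'a symbols" is "(+)"
  unfolding symbol_equiv_def by (auto dest: cv.span_add simp: add_diff_add)

lift_definition uminus_symbols :: "'a symbols \<Rightarrow> 'a symbols" is uminus
  unfolding symbol_equiv_def by (auto dest: cv.span_neg simp: minus_diff_minus)

lift_definition minus_symbols :: "'a symbols \<Rightarrow> 'a symbols \<Rightarrow> 'a symbols" is "(-)"
  unfolding symbol_equiv_def
proof -
  fix a b a' b' :: "(int ^ 'a) \<times> 'a \<Rightarrow>\<^sub>0 complex"
  assume "a - b \<in> cv.span symbol_relations" "a' - b' \<in> cv.span symbol_relations"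
  then have "(a - b) - (a' - b') \<in> cv.span symbol_relations"
    by (rule cv.span_diff)
  then show "(a - a') - (b - b') \<in> cv.span symbol_relations"
    by (simp add: algebra_simps)
qed

lift_definition scaleC_symbols :: "complex \<Rightarrow> 'a symbols \<Rightarrow> 'a symbols" is "scaleC"
  unfolding symbol_equiv_def by (simp add: cv.span_scale flip: cv.scale_right_diff_distrib)

instance
  by standard
    (transfer; simp add: symbol_equiv_def cv.span_zero algebra_simps cv.scale_left_distrib
      cv.scale_right_distrib)+

end

lift_definition symbol :: "int ^ 'n \<Rightarrow> 'n \<Rightarrow> 'n::finite symbols" is
  "\<lambda>k i. Poly_Mapping.single (k, i) 1" .

abbreviation K :: "'n \<Rightarrow> 'n::finite symbols" where
  "K i \<equiv> symbol 0 i"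

definition pairing :: "complex ^ 'n \<Rightarrow> int ^ 'n::finite \<Rightarrow> complex" where
  "pairing d k = (\<Sum>i\<in>UNIV. d $ i * of_int (k $ i))"

definition symbol_degree ::
  "complex ^ 'n \<Rightarrow> ((int ^ 'n::finite) \<times> 'n \<Rightarrow>\<^sub>0 complex) \<Rightarrow> ((int ^ 'n) \<times> 'n \<Rightarrow>\<^sub>0 complex)" where
  "symbol_degree d a = Poly_Mapping.mapp (\<lambda>(k, i) c. pairing d k * c) a"

lemma lookup_symbol_degree:
  "Poly_Mapping.lookup (symbol_degree d a) p = pairing d (fst p) * Poly_Mapping.lookup a p"
  by (cases p) (auto simp: symbol_degree_def mapp.rep_eq when_def in_keys_iff)

lemma symbol_degree_diff: "symbol_degree d (a - b) = symbol_degree d a - symbol_degree d b"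
  by (rule poly_mapping_eqI) (simp add: lookup_symbol_degree lookup_minus algebra_simps)

lemma symbol_degree_span:
  assumes "a \<in> cv.span symbol_relations"
  shows "symbol_degree d a \<in> cv.span symbol_relations"
  using assms
proof (induction rule: cv.span_induct_alt)
  case base
  have "symbol_degree d 0 = 0"
    by (rule poly_mapping_eqI) (simp add: lookup_symbol_degree)
  then show ?case by (simp add: cv.span_zero)
next
  case (step c x y)
  obtain k where x: "x = (\<Sum>i\<in>UNIV. Poly_Mapping.single (k, i) (of_int (k $ i)))"
    using step(1) by (auto simp: symbol_relations_def)
  have "symbol_degree d (c *\<^sub>C x + y) = (c * pairing d k) *\<^sub>C x + symbol_degree d y"
    by (rule poly_mapping_eqI)
      (auto simp: x lookup_symbol_degree lookup_add lookup_scaleC scaleC_complex_def lookup_sum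
        lookup_single when_def algebra_simps sum_distrib_left intro!: sum.cong)
  then show ?case
    using step by (simp add: cv.span_add cv.span_scale cv.span_base)
qed

lift_definition symbols_deriv :: "complex ^ 'n \<Rightarrow> 'n::finite symbols \<Rightarrow> 'n symbols" is symbol_degree
  unfolding symbol_equiv_def by (simp add: symbol_degree_span flip: symbol_degree_diff)

definition central_symbols :: "('g, 'n::finite) torus_data \<Rightarrow> 'n symbols set" where
  "central_symbols T = cv.span {symbol k i | k i. k \<in> Gamma T}"

section \<open>The graded Lie torus\<close>

text \<open>An element of \<open>\<gg> \<otimes> A\<close> is the finitely supported family of its coefficients, an element
  of \<open>D\<close> the vector of its coordinates with respect to \<open>d\<^sub>1, \<dots>, d\<^sub>n\<close>. The graded Lie torus is a
  subspace of \<open>(\<gg> \<otimes> A) \<oplus> \<Z> \<oplus> D\<close>.\<close>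

type_synonym ('g, 'n) glt = "(int ^ 'n \<Rightarrow>\<^sub>0 'g) \<times> 'n symbols \<times> (complex ^ 'n)"

definition monomial :: "'g::complex_vector \<Rightarrow> int ^ 'n \<Rightarrow> ('g, 'n::finite) glt" where
  "monomial x k = (Poly_Mapping.single k x, 0, 0)"

definition central :: "'n symbols \<Rightarrow> ('g::complex_vector, 'n::finite) glt" where
  "central z = (0, z, 0)"

definition derivation :: "complex ^ 'n \<Rightarrow> ('g::complex_vector, 'n::finite) glt" where
  "derivation d = (0, 0, d)"

definition LT :: "('g::complex_vector, 'n::finite) torus_data \<Rightarrow> (int ^ 'n \<Rightarrow>\<^sub>0 'g) set" where
  "LT T = {f. \<forall>k. Poly_Mapping.lookup f k \<in> grade T k}"

definition glt_carrier :: "('g::complex_vector, 'n::finite) torus_data \<Rightarrow> ('g, 'n) glt set" where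
  "glt_carrier T = LT T \<times> central_symbols T \<times> UNIV"

definition loop_bracket ::
  "('g::complex_vector, 'n::finite) torus_data \<Rightarrow>
     (int ^ 'n \<Rightarrow>\<^sub>0 'g) \<Rightarrow> (int ^ 'n \<Rightarrow>\<^sub>0 'g) \<Rightarrow> (int ^ 'n \<Rightarrow>\<^sub>0 'g)" where
  "loop_bracket T f g = (\<Sum>k\<in>Poly_Mapping.keys f. \<Sum>l\<in>Poly_Mapping.keys g.
     Poly_Mapping.single (k + l) (br T (Poly_Mapping.lookup f k) (Poly_Mapping.lookup g l)))"

definition cocycle ::
  "('g::complex_vector, 'n::finite) torus_data \<Rightarrow>
     (int ^ 'n \<Rightarrow>\<^sub>0 'g) \<Rightarrow> (int ^ 'n \<Rightarrow>\<^sub>0 'g) \<Rightarrow> 'n symbols" where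
  "cocycle T f g = (\<Sum>k\<in>Poly_Mapping.keys f. \<Sum>l\<in>Poly_Mapping.keys g.
     form T (Poly_Mapping.lookup f k) (Poly_Mapping.lookup g l) *\<^sub>C
       (\<Sum>i\<in>UNIV. of_int (k $ i) *\<^sub>C symbol (k + l) i))"

definition loop_deriv ::
  "complex ^ 'n \<Rightarrow> (int ^ 'n::finite \<Rightarrow>\<^sub>0 'g) \<Rightarrow> (int ^ 'n \<Rightarrow>\<^sub>0 'g::complex_vector)" where
  "loop_deriv d f = Poly_Mapping.mapp (\<lambda>k x. pairing d k *\<^sub>C x) f"

fun glt_bracket ::
  "('g::complex_vector, 'n::finite) torus_data \<Rightarrow> ('g, 'n) glt \<Rightarrow> ('g, 'n) glt \<Rightarrow> ('g, 'n) glt" where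
  "glt_bracket T (f, z, d) (g, w, e) =
     (loop_bracket T f g + loop_deriv d g - loop_deriv e f,
      cocycle T f g + symbols_deriv d w - symbols_deriv e z,
      0)"

lemma loop_deriv_zero [simp]: "loop_deriv d 0 = 0"
  by (rule poly_mapping_eqI) (simp add: loop_deriv_def lookup_mapp)

lemma loop_deriv_zero_left [simp]: "loop_deriv 0 f = 0"
  by (rule poly_mapping_eqI) (simp add: loop_deriv_def lookup_mapp pairing_def when_def)

lemma loop_deriv_single:
  "loop_deriv d (Poly_Mapping.single k x) = Poly_Mapping.single k (pairing d k *\<^sub>C x)"
  by (rule poly_mapping_eqI)
    (auto simp: loop_deriv_def lookup_mapp lookup_single when_def in_keys_iff)

lemma symbols_deriv_zero [simp]: "symbols_deriv d 0 = 0"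
  by transfer (simp add: symbol_equiv_def symbol_degree_span cv.span_zero)

lemma symbols_deriv_symbol: "symbols_deriv d (symbol k j) = pairing d k *\<^sub>C symbol k j"
proof transfer
  fix d :: "complex ^ 'n::finite" and k :: "int ^ 'n" and j
  have "symbol_degree d (Poly_Mapping.single (k, j) 1) =
        pairing d k *\<^sub>C Poly_Mapping.single (k, j) 1"
    by (rule poly_mapping_eqI)
      (auto simp: lookup_symbol_degree lookup_scaleC scaleC_complex_def lookup_single when_def)
  then show "symbol_equiv (symbol_degree d (Poly_Mapping.single (k, j) 1))
               (pairing d k *\<^sub>C Poly_Mapping.single (k, j) 1)"
    by (simp add: symbol_equiv_def cv.span_zero)
qed

lemma glt_bracket_monomial:
  fixes T :: "('g::complex_vector, 'n::finite) torus_data"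
  assumes "lie_algebra (br T) UNIV" "invariant_form (br T) (form T)"
  shows "glt_bracket T (monomial x k) (monomial y l) = monomial (br T x y) (k + l) +
           central (form T x y *\<^sub>C (\<Sum>i\<in>UNIV. of_int (k $ i) *\<^sub>C symbol (k + l) i))"
proof -
  interpret A: lie_algebra "br T" UNIV by fact
  interpret B: invariant_form "br T" "form T" by fact
  have zero: "br T 0 u = 0" "br T u 0 = 0" "form T 0 u = 0" "form T u 0 = 0" for u
    using A.scale_left[of u u 0] A.scale_right[of u u 0] B.form_scale[of 0 0 u] B.form_sym[of u 0]
    by simp_all
  show ?thesis
    by (cases "x = 0"; cases "y = 0")
      (simp_all add: monomial_def central_def loop_bracket_def cocycle_def zero)
qed

lemma glt_bracket_derivation_monomial:
  "glt_bracket T (derivation d) (monomial x k) = monomial (pairing d k *\<^sub>C x) k"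
  by (simp add: derivation_def monomial_def loop_bracket_def cocycle_def loop_deriv_single)

lemma glt_bracket_derivation_symbol:
  "glt_bracket T (derivation d) (central (symbol k j)) = central (pairing d k *\<^sub>C symbol k j)"
  by (simp add: derivation_def central_def loop_bracket_def cocycle_def symbols_deriv_symbol)

definition glt_cartan :: "('g::complex_vector, 'n::finite) torus_data \<Rightarrow> ('g, 'n) glt set" where
  "glt_cartan T =
     {monomial h 0 + central (\<Sum>i\<in>UNIV. c i *\<^sub>C K i) + derivation d | h c d. h \<in> csa T}"

definition glt_plus ::
  "('g::complex_vector, 'n::finite) torus_data \<Rightarrow> ('g \<Rightarrow> complex) set \<Rightarrow> ('g, 'n) glt set" where
  "glt_plus T S = cv.span {monomial x k | x k \<alpha>. \<alpha> \<in> roots_en_pos T S \<and> x \<in> root_space T k \<alpha>}"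

section \<open>Integrable modules\<close>

definition weight_space ::
  "('g::complex_vector, 'n::finite) torus_data \<Rightarrow>
     (('g, 'n) glt \<Rightarrow> 'v::complex_vector \<Rightarrow> 'v) \<Rightarrow> (('g, 'n) glt \<Rightarrow> complex) \<Rightarrow> 'v set" where
  "weight_space T \<rho> \<mu> = {v. \<forall>h\<in>glt_cartan T. \<rho> h v = \<mu> h *\<^sub>C v}"

definition integrable ::
  "('g::complex_vector, 'n::finite) torus_data \<Rightarrow>
     (('g, 'n) glt \<Rightarrow> 'v::complex_vector \<Rightarrow> 'v) \<Rightarrow> bool" where
  "integrable T \<rho> \<longleftrightarrow>
     is_direct_sum (dual (glt_cartan T)) (weight_space T \<rho>) \<and>
     (\<forall>\<mu>\<in>dual (glt_cartan T). fin_dim (weight_space T \<rho> \<mu>)) \<and>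
     (\<forall>\<alpha>\<in>dual (csa T). \<alpha> \<noteq> 0 \<longrightarrow>
        (\<forall>k. \<forall>x\<in>root_space T k \<alpha>. \<forall>v. \<exists>N. (\<rho> (monomial x k) ^^ N) v = 0))"

end

theory Submission
  imports Defs
begin

text \<open>Only the part of the Lie torus with degrees in \<open>\<Gamma>\<close> is needed to bound the weights. Fix a coset
  of weights of \<open>V\<close>. In one fixed degree \<open>k\<close>, \<open>V\<close> is a locally finite module over the simple Lie
  algebra \<open>\<gg>\<^sub>0\<close> that is generated by its weight spaces of weights \<open>\<mu>\<close> with \<open>|\<mu>(\<alpha>\<^sup>\<or>)| \<le> 1\<close> for all roots
  \<open>\<alpha>\<close>: if \<open>\<mu>(\<alpha>\<^sup>\<or>) \<ge> 2\<close>, then \<open>e\<^sub>\<alpha>\<close> maps \<open>V\<^bsub>\<mu>-\<alpha>\<^esub>\<close> onto \<open>V\<^sub>\<mu>\<close>, and \<open>\<mu> - \<alpha>\<close> is shorter than \<open>\<mu>\<close>. As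
  there are finitely many such \<open>\<mu>\<close>, each component of fixed degree is finite-dimensional. Since the
  \<open>K\<^sub>i\<close> act by zero, the elements \<open>e\<^sub>\<alpha> \<otimes> t\<^sup>l\<close> and \<open>f\<^sub>\<alpha> \<otimes> t\<^bsup>-l\<^esup>\<close> with \<open>l \<in> \<Gamma>\<close> generate a copy of \<open>\<ss>\<ll>\<^sub>2\<close> with the
  same coroot \<open>\<alpha>\<^sup>\<or>\<close> for all \<open>l\<close>; composing two of its reflections shifts the degree of a weight by
  \<open>\<mu>(\<alpha>\<^sup>\<or>) l\<close> without changing \<open>\<mu>\<close>. So, one root below any weight, the degrees are periodic modulo
  \<open>2\<Gamma>\<close>. Hence the restriction of a weight to the Cartan subalgebra of \<open>\<gg>\<^sub>0\<close> vanishes on all coroots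
  or is the sum of a root and of a restriction that occurs in one of finitely many fixed degrees.
  So there are finitely many restrictions, and a weight vector whose restriction is maximal with
  respect to the simple roots is killed by the positive part.\<close>

section \<open>Linear algebra\<close>

lemma finite_independent_span:
  assumes "finite G" and "inj_on f P" and "cv.independent (f ` P)" and "f ` P \<subseteq> cv.span G"
  shows "finite P"
  using assms cv.independent_span_bound finite_imageD by blast

text \<open>Induction on the number of summands: applying \<open>op i - ev q i\<close> to the
  vanishing sum removes the summand at \<open>q\<close> and multiplies the others by scalars;
  \<open>i\<close> is chosen so that the scalar at the summand in question is non-zero. The
  \<open>f p\<close> may themselves vanish, so the lemma also compares eigencomponents of a
  vector.\<close>

lemma common_eigenvectors_zero:
  fixes op :: "'i \<Rightarrow> 'v::complex_vector \<Rightarrow> 'v" and ev :: "'p \<Rightarrow> 'i \<Rightarrow> complex"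
  assumes "finite P"
    and lin: "\<And>i. i \<in> I \<Longrightarrow> Vector_Spaces.linear scaleC scaleC (op i)"
    and distinct: "\<And>p q. \<lbrakk>p \<in> P; q \<in> P; p \<noteq> q\<rbrakk> \<Longrightarrow> \<exists>i\<in>I. ev p i \<noteq> ev q i"
    and eigen: "\<And>p i. \<lbrakk>p \<in> P; i \<in> I\<rbrakk> \<Longrightarrow> op i (f p) = ev p i *\<^sub>C f p"
    and "(\<Sum>p\<in>P. f p) = 0" and "p \<in> P"
  shows "f p = 0"
  using assms(1,3-)
proof (induction P arbitrary: f p rule: finite_induct)
  case empty
  then show ?case by simp
next
  case (insert q P)
  have zero: "f p = 0" if "p \<in> P" for p
  proof -
    from insert.prems(1)[of p q] that insert.hyps(2) obtain i
      where i: "i \<in> I" "ev p i \<noteq> ev q i"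
      by auto
    interpret L: Vector_Spaces.linear scaleC scaleC "op i" by (rule lin) fact
    have "0 = op i (\<Sum>p\<in>insert q P. f p) - ev q i *\<^sub>C (\<Sum>p\<in>insert q P. f p)"
      by (simp add: insert.prems(3) L.zero)
    also have "\<dots> = (\<Sum>p\<in>P. (ev p i - ev q i) *\<^sub>C f p)"
      using insert.hyps insert.prems(2) i(1)
      by (simp add: L.add L.sum cv.scale_sum_right cv.scale_right_distrib
        cv.scale_left_diff_distrib sum_subtractf)
    finally have "(\<Sum>p\<in>P. (ev p i - ev q i) *\<^sub>C f p) = 0" by simp
    moreover have "op j ((ev p i - ev q i) *\<^sub>C f p) = ev p j *\<^sub>C (ev p i - ev q i) *\<^sub>C f p"
      if "p \<in> P" "j \<in> I" for p j
    proof -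
      interpret L: Vector_Spaces.linear scaleC scaleC "op j" by (rule lin) fact
      show ?thesis using insert.prems(2) that by (simp add: L.scale mult.commute)
    qed
    ultimately have "(ev p i - ev q i) *\<^sub>C f p = 0"
      using insert.IH[of "\<lambda>p. (ev p i - ev q i) *\<^sub>C f p" p] insert.prems(1) that by blast
    then show ?thesis using i by simp
  qed
  then have "(\<Sum>p\<in>P. f p) = 0" by simp
  then have "f q = 0" using insert.prems(3) insert.hyps by simp
  then show ?case using zero insert.prems(4) by auto
qed

text \<open>One common eigenvector per index gives an independent family inside a finite-dimensional
  space. This bounds the weights of the algebra under \<open>csa T\<close> and later the restricted
  weights of the module in one degree.\<close>

lemma finite_eigenvalues:
  fixes op :: "'i \<Rightarrow> 'v::complex_vector \<Rightarrow> 'v" and ev :: "'p \<Rightarrow> 'i \<Rightarrow> complex"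
  assumes "finite G"
    and lin: "\<And>i. i \<in> I \<Longrightarrow> Vector_Spaces.linear scaleC scaleC (op i)"
    and distinct: "\<And>p q. \<lbrakk>p \<in> P; q \<in> P; p \<noteq> q\<rbrakk> \<Longrightarrow> \<exists>i\<in>I. ev p i \<noteq> ev q i"
    and eigen: "\<And>p. p \<in> P \<Longrightarrow> \<exists>v\<in>cv.span G. v \<noteq> 0 \<and> (\<forall>i\<in>I. op i v = ev p i *\<^sub>C v)"
  shows "finite P"
proof -
  obtain f where f: "\<And>p. p \<in> P \<Longrightarrow> f p \<in> cv.span G" "\<And>p. p \<in> P \<Longrightarrow> f p \<noteq> 0"
    "\<And>p i. p \<in> P \<Longrightarrow> i \<in> I \<Longrightarrow> op i (f p) = ev p i *\<^sub>C f p"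
    using eigen by metis
  have inj: "inj_on f P"
  proof (rule inj_onI, rule ccontr)
    fix p q assume *: "p \<in> P" "q \<in> P" "f p = f q" "p \<noteq> q"
    then obtain i where "i \<in> I" "ev p i \<noteq> ev q i" using distinct by blast
    then show False using f * by (metis cv.scale_right_imp_eq)
  qed
  have "cv.independent (f ` P)"
  proof
    assume "cv.dependent (f ` P)"
    then obtain S u where S: "finite S" "S \<subseteq> f ` P" "(\<Sum>v\<in>S. u v *\<^sub>C v) = 0"
      and "\<exists>v\<in>S. u v \<noteq> 0"
      by (auto simp: cv.dependent_explicit)
    then obtain v where v: "v \<in> S" "u v \<noteq> 0" by auto
    obtain Q where Q: "Q \<subseteq> P" "finite Q" "S = f ` Q"
      using S by (meson finite_subset_image)
    obtain q where q: "q \<in> Q" "v = f q" using Q v by auto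
    have "(\<Sum>p\<in>Q. u (f p) *\<^sub>C f p) = 0"
      using S(3) Q inj by (simp add: sum.reindex inj_on_subset)
    then have "u (f q) *\<^sub>C f q = 0"
    proof (rule common_eigenvectors_zero[OF \<open>finite Q\<close> lin, rotated 3])
      fix p i assume "p \<in> Q" "i \<in> I"
      interpret L: Vector_Spaces.linear scaleC scaleC "op i" by (rule lin) fact
      show "op i (u (f p) *\<^sub>C f p) = ev p i *\<^sub>C u (f p) *\<^sub>C f p"
        using f(3) \<open>p \<in> Q\<close> \<open>i \<in> I\<close> Q by (simp add: L.scale mult.commute subset_iff)
    qed (use distinct Q q in auto)
    then show False using v q f(2) Q by auto
  qed
  then show ?thesis using finite_independent_span[OF \<open>finite G\<close> inj] f(1) by blast
qed

lemma span_Union_subspaces: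
  assumes "\<And>i. cv.subspace (S i)" and "x \<in> cv.span (\<Union>i. S i)"
  shows "\<exists>C f. finite C \<and> (\<forall>i. f i \<in> S i) \<and> x = (\<Sum>i\<in>C. f i)"
  using assms(2)
proof (induction rule: cv.span_induct_alt)
  case base
  show ?case
    by (rule exI[of _ "{}"], rule exI[of _ "\<lambda>_. 0"]) (simp add: assms(1) cv.subspace_0)
next
  case (step c y z)
  then obtain C f i where *: "finite C" "\<forall>i. f i \<in> S i" "z = (\<Sum>i\<in>C. f i)" "y \<in> S i" by blast
  \<comment> \<open>Resetting \<open>f\<close> to zero outside \<open>C\<close> lets the new vector
    be added at \<open>i\<close> in the same way whether or not \<open>i\<close> already belongs to
    \<open>C\<close>.\<close>
  define g where "g = (\<lambda>j. if j \<in> C then f j else 0)"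
  have g: "z = (\<Sum>j\<in>insert i C. g j)" "g j \<in> S j" for j
    using * assms(1) by (auto simp: g_def sum.insert_if cv.subspace_0 insert_absorb)
  have "c *\<^sub>C y + z = (\<Sum>j\<in>insert i C. (g(i := c *\<^sub>C y + g i)) j)"
    unfolding g(1) using *(1) by (simp add: sum.insert_remove add.assoc)
  then show ?case
    using *(1,4) g(2) assms(1)
    by (intro exI[of _ "insert i C"] exI[of _ "g(i := c *\<^sub>C y + g i)"])
      (auto intro: cv.subspace_add cv.subspace_scale)
qed

section \<open>Operators with a commutator acting diagonally\<close>

text \<open>For \<open>s = 2\<close> these are the relations of sl2, for \<open>s = 0\<close> those
  of a Heisenberg algebra with central \<open>H\<close>. The second case serves to exclude isotropic
  roots.\<close>

locale commutator_triple =
  E: Vector_Spaces.linear scaleC scaleC E +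
  F: Vector_Spaces.linear scaleC scaleC F +
  H: Vector_Spaces.linear scaleC scaleC H
  for E F H :: "'v::complex_vector \<Rightarrow> 'v" +
  fixes s :: complex
  assumes EF: "E (F v) = F (E v) + H v"
    and HE: "H (E v) = E (H v) + s *\<^sub>C E v"
    and HF: "H (F v) = F (H v) - s *\<^sub>C F v"
begin

text \<open>Exchanging raising and lowering operators only changes the sign of \<open>H\<close>, so
  every statement about powers of \<open>E\<close> can be reused for \<open>F\<close>.\<close>

lemma swap: "commutator_triple F E (\<lambda>v. - H v) s"
proof -
  interpret P: vector_space_pair "scaleC :: complex \<Rightarrow> 'v \<Rightarrow> 'v" "scaleC :: complex \<Rightarrow> 'v \<Rightarrow> 'v"
    by unfold_locales
  interpret M: Vector_Spaces.linear scaleC scaleC "\<lambda>v. - H v"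
    by (rule P.linear_compose_neg) (rule H.linear_axioms)
  show ?thesis
    by unfold_locales (auto simp: EF HE HF E.neg F.neg)
qed

lemma H_power_E: "H w = c *\<^sub>C w \<Longrightarrow> H ((E ^^ j) w) = (c + s * of_nat j) *\<^sub>C (E ^^ j) w"
  by (induction j)
    (simp_all add: HE E.scale distrib_left add_ac flip: cv.scale_left_distrib)

lemma H_power_F: "H w = c *\<^sub>C w \<Longrightarrow> H ((F ^^ j) w) = (c - s * of_nat j) *\<^sub>C (F ^^ j) w"
  by (induction j)
    (simp_all add: HF F.scale distrib_left diff_diff_eq add_ac flip: cv.scale_left_diff_distrib)

text \<open>Moving \<open>E\<close> through the \<open>j + 1\<close> factors \<open>F\<close> leaves
  one \<open>H\<close> per factor, acting by the eigenvalues c, c - s, ..., c - j s; the coefficient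
  is their sum.\<close>

lemma E_power_F:
  assumes "H w = c *\<^sub>C w"
  shows "E ((F ^^ Suc j) w) =
    (F ^^ Suc j) (E w) + (of_nat (Suc j) * (c - s * of_nat j / 2)) *\<^sub>C (F ^^ j) w"
proof (induction j)
  case 0
  then show ?case by (simp add: EF assms)
next
  case (Suc j)
  have "E ((F ^^ Suc (Suc j)) w) = F (E ((F ^^ Suc j) w)) + H ((F ^^ Suc j) w)"
    by (simp add: EF)
  also have "\<dots> = (F ^^ Suc (Suc j)) (E w) +
      (of_nat (Suc j) * (c - s * of_nat j / 2) + (c - s * of_nat (Suc j))) *\<^sub>C (F ^^ Suc j) w"
    unfolding Suc.IH H_power_F[OF assms]
    by (simp add: F.add F.scale cv.scale_left_distrib)
  also have "of_nat (Suc j) * (c - s * of_nat j / 2) + (c - s * of_nat (Suc j)) =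
      of_nat (Suc (Suc j)) * (c - s * of_nat (Suc j) / 2)"
    by (simp add: field_simps)
  finally show ?case .
qed

lemma highest_vector:
  assumes "v \<noteq> 0" "(E ^^ N) v = 0"
  obtains n where "(E ^^ n) v \<noteq> 0" "E ((E ^^ n) v) = 0"
proof -
  define m where "m = (LEAST m. (E ^^ m) v = 0)"
  have m: "(E ^^ m) v = 0" unfolding m_def by (rule LeastI) (rule assms)
  then obtain n where n: "m = Suc n" using assms(1) by (cases m) auto
  have "(E ^^ n) v \<noteq> 0" using not_less_Least[of n "\<lambda>m. (E ^^ m) v = 0"] n m_def by auto
  then show thesis using m n that by auto
qed

end

locale sl2_action = commutator_triple E F H 2
  for E F H :: "'v::complex_vector \<Rightarrow> 'v"
begin

text \<open>Climb to a highest vector \<open>w\<close>, with eigenvalue \<open>d\<close>, then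
  descend to the last non-zero \<open>(F ^^ q) w\<close>. Applying \<open>E\<close> to the vanishing
  vector one step further gives \<open>d = q\<close>. Thus integrality and the length of the string
  come out together.\<close>

lemma string:
  assumes "v \<noteq> 0" "H v = c *\<^sub>C v" and E: "\<exists>N. (E ^^ N) v = 0"
    and F: "\<And>n. \<exists>N. (F ^^ N) ((E ^^ n) v) = 0"
  obtains n q where "c + 2 * of_nat n = of_nat q" "\<And>j. j \<le> q \<Longrightarrow> (F ^^ j) ((E ^^ n) v) \<noteq> 0"
proof -
  obtain n where n: "(E ^^ n) v \<noteq> 0" "E ((E ^^ n) v) = 0"
    using highest_vector assms(1) E by blast
  define w d where "w = (E ^^ n) v" and "d = c + 2 * of_nat n"
  have d: "H w = d *\<^sub>C w" unfolding w_def d_def by (rule H_power_E) fact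
  obtain N where "(F ^^ N) w = 0" using F w_def by blast
  then obtain q where q: "(F ^^ q) w \<noteq> 0" "F ((F ^^ q) w) = 0"
    using commutator_triple.highest_vector[OF commutator_triple.swap[OF commutator_triple_axioms]]
      n(1) w_def by metis
  have "0 = E ((F ^^ Suc q) w)" using q(2) by (simp add: E.zero)
  also have "\<dots> = (of_nat (Suc q) * (d - of_nat q)) *\<^sub>C (F ^^ q) w"
  proof -
    have "(F ^^ Suc q) 0 = 0" by (induction q) (auto simp: F.zero)
    then show ?thesis unfolding E_power_F[OF d] using n(2) w_def by simp
  qed
  finally have "d = of_nat q" using q(1) by (simp del: of_nat_Suc)
  moreover have "(F ^^ j) w \<noteq> 0" if "j \<le> q" for j
  proof
    assume "(F ^^ j) w = 0"
    moreover have "(F ^^ q) w = (F ^^ (q - j)) ((F ^^ j) w)"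
      using that by (metis comp_apply funpow_add le_add_diff_inverse2)
    moreover have "(F ^^ i) 0 = 0" for i by (induction i) (auto simp: F.zero)
    ultimately show False using q(1) by simp
  qed
  ultimately show thesis using that w_def d_def by metis
qed

text \<open>The operator \<open>F E\<close> acts on \<open>{v. H v = p v \<and> E\<^bsup>n+1\<^esup> v = 0}\<close> with eigenvalues among
  \<open>j (p + j + 1)\<close>, \<open>j \<le> n\<close>, so that \<open>E F = F E + p\<close> is invertible there; the induction splits off
  one eigenvalue at a time. The subspace \<open>S\<close> records the remaining weight.\<close>

lemma raising_surjective:
  assumes "H v = of_nat p *\<^sub>C v" "p > 0" "(E ^^ n) v = 0" "v \<in> S"
    and "cv.subspace S" "cv.subspace S'" and "\<And>x. x \<in> S \<Longrightarrow> F x \<in> S'"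
    and "\<And>x. x \<in> S' \<Longrightarrow> E x \<in> S"
  shows "v \<in> E ` S'"
proof -
  have sub: "cv.subspace (E ` S')" by (rule E.subspace_image) fact
  have "(E ^^ n) v = 0 \<Longrightarrow> v \<in> S \<Longrightarrow> H v = of_nat p *\<^sub>C v \<Longrightarrow> v \<in> E ` S'"
  proof (induction n arbitrary: v)
    case 0
    then show ?case using cv.subspace_0[OF sub] by simp
  next
    case (Suc n)
    \<comment> \<open>The eigenvalue at \<open>j = n\<close>, which belongs to the part of
      \<open>v\<close> surviving \<open>n\<close> applications of \<open>E\<close>. Subtracting
      \<open>c\<close> from \<open>F E\<close> kills this part, so the induction hypothesis applies
      to \<open>w\<close>.\<close>
    define c :: complex where "c = of_nat (n * (p + n + 1))"
    define w where "w = F (E v) - c *\<^sub>C v"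
    have EF_v: "E (F v) = F (E v) + of_nat p *\<^sub>C v" by (simp add: EF Suc.prems)
    then have w: "w = E (F v) - (of_nat p + c) *\<^sub>C v"
      by (simp add: w_def cv.scale_left_distrib)
    have "w \<in> S"
      unfolding w using assms Suc.prems by (meson cv.subspace_diff cv.subspace_scale)
    have H_Ev: "H (E v) = of_nat (p + 2) *\<^sub>C E v"
      using HE[of v] Suc.prems(3) by (simp add: E.scale cv.scale_left_distrib add.commute)
    have "H w = of_nat p *\<^sub>C w"
      by (simp add: w_def H.diff H.scale HF H_Ev F.scale F.add Suc.prems(3) cv.scale_right_diff_distrib
        cv.scale_left_distrib mult.commute)
    moreover have "(E ^^ n) w = 0"
    proof (cases n)
      case 0
      then show ?thesis using Suc.prems(1) by (simp add: w_def c_def F.zero)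
    next
      case [simp]: (Suc m)
      interpret S: commutator_triple F E "\<lambda>v. - H v" 2
        by (rule commutator_triple.swap[OF commutator_triple_axioms])
      have Ediff: "(E ^^ j) (x - a *\<^sub>C y) = (E ^^ j) x - a *\<^sub>C (E ^^ j) y" for j x y a
        by (induction j) (auto simp: E.diff E.scale)
      have "F ((E ^^ Suc m) (E v)) = (E ^^ Suc m) (F (E v)) +
        (of_nat (Suc m) * (- of_nat (p + 2) - 2 * of_nat m / 2)) *\<^sub>C (E ^^ m) (E v)"
        by (rule S.E_power_F) (simp only: H_Ev cv.scale_minus_left)
      moreover have "(E ^^ Suc m) (E v) = 0"
        using Suc.prems(1) by (metis Suc comp_apply funpow_Suc_right)
      moreover have "(E ^^ m) (E v) = (E ^^ n) v"
        by (simp add: funpow_swap1)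
      moreover have "of_nat (Suc m) * (- of_nat (p + 2) - 2 * of_nat m / 2) = - c"
        by (simp add: c_def algebra_simps)
      ultimately have "(E ^^ n) (F (E v)) - c *\<^sub>C (E ^^ n) v = 0"
        by (simp only: F.zero Suc cv.scale_minus_left add_uminus_conv_diff)
      then show ?thesis by (simp only: w_def Ediff)
    qed
    ultimately have "w \<in> E ` S'" using Suc.IH \<open>w \<in> S\<close> by blast
    moreover have "E (F v) \<in> E ` S'" using assms Suc.prems by blast
    ultimately have "E (F v) - w \<in> E ` S'" by (meson cv.subspace_diff sub)
    then have "(of_nat p + c) *\<^sub>C v \<in> E ` S'" by (simp add: w)
    then have "inverse (of_nat p + c) *\<^sub>C (of_nat p + c) *\<^sub>C v \<in> E ` S'"
      by (rule cv.subspace_scale[OF sub])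
    \<comment> \<open>Both summands are natural numbers and \<open>p\<close> is positive; this is
      where a positive weight is required.\<close>
    moreover have "of_nat p + c \<noteq> 0" 
      unfolding c_def using \<open>p > 0\<close> by (metis add_is_0 neq0_conv of_nat_add of_nat_eq_0_iff)
    ultimately show ?case by simp
  qed
  then show ?thesis using assms by blast
qed

end

section \<open>Local finiteness\<close>

text \<open>The spanning half of the Poincare-Birkhoff-Witt theorem: words are sorted modulo shorter words,
  and the sorted words applied to a vector span a finite-dimensional space.\<close>

locale operator_family =
  fixes X :: "nat \<Rightarrow> 'v::complex_vector \<Rightarrow> 'v" and m :: nat
  assumes linear: "i < m \<Longrightarrow> Vector_Spaces.linear scaleC scaleC (X i)"
    and commutator: "\<lbrakk>i < m; j < m\<rbrakk> \<Longrightarrow>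
      \<exists>c. \<forall>v. X i (X j v) = X j (X i v) + (\<Sum>l<m. c l *\<^sub>C X l v)"
    and locally_finite: "i < m \<Longrightarrow> \<exists>G. finite G \<and> (\<forall>a. (X i ^^ a) v \<in> cv.span G)"
begin

definition act :: "nat list \<Rightarrow> 'v \<Rightarrow> 'v" where
  "act w = foldr X w"

text \<open>The filtration by word length; reordering the letters of a word changes its action only
  by elements of an earlier step.\<close>

definition words :: "'v set \<Rightarrow> nat \<Rightarrow> 'v set" where
  "words F r = cv.span {act w f | w f. set w \<subseteq> {..<m} \<and> length w \<le> r \<and> f \<in> F}"

lemma act_simps [simp]: "act [] v = v" "act (i # w) v = X i (act w v)"
  by (auto simp: act_def)

lemma act_in_words: "\<lbrakk>set w \<subseteq> {..<m}; length w \<le> r; f \<in> F\<rbrakk> \<Longrightarrow> act w f \<in> words F r"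
  unfolding words_def by (rule cv.span_base) auto

lemma words_closed:
  assumes "i < m" "v \<in> words F r"
  shows "X i v \<in> words F (Suc r)"
proof -
  interpret L: Vector_Spaces.linear scaleC scaleC "X i" by (rule linear) fact
  let ?A = "\<lambda>r. {act w f | w f. set w \<subseteq> {..<m} \<and> length w \<le> r \<and> f \<in> F}"
  have "X i v \<in> cv.span (X i ` ?A r)"
    using assms by (simp add: words_def L.span_image)
  moreover have "X i ` ?A r \<subseteq> ?A (Suc r)"
  proof clarify
    fix w f assume "set w \<subseteq> {..<m}" "length w \<le> r" "f \<in> F"
    then show "\<exists>w' f'. X i (act w f) = act w' f' \<and> set w' \<subseteq> {..<m} \<and> length w' \<le> Suc r \<and> f' \<in> F"
      using assms(1) by (intro exI[of _ "i # w"] exI[of _ f]) auto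
  qed
  ultimately show ?thesis unfolding words_def by (meson cv.span_mono subsetD)
qed

text \<open>Each time \<open>i\<close> passes a smaller letter, the commutator replaces two letters
  by one, so the error is shorter by one letter.\<close>

lemma act_insort:
  assumes "f \<in> F" "i < m" "set w \<subseteq> {..<m}"
  shows "act (i # w) f - act (insort i w) f \<in> words F (length w)"
  using assms(3)
proof (induction w)
  case Nil
  then show ?case by (simp add: words_def cv.span_zero)
next
  case (Cons j w)
  show ?case
  proof (cases "i \<le> j")
    case True
    then show ?thesis by (simp add: words_def cv.span_zero)
  next
    case False
    interpret L: Vector_Spaces.linear scaleC scaleC "X j" by (rule linear) (use Cons in auto)
    obtain c where c: "\<And>v. X i (X j v) = X j (X i v) + (\<Sum>l<m. c l *\<^sub>C X l v)"
      using commutator[of i j] assms(2) Cons.prems by auto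
    have "X l (act w f) \<in> words F (Suc (length w))" if "l < m" for l
      using words_closed[OF that act_in_words] Cons.prems assms(1) by simp
    then have "(\<Sum>l<m. c l *\<^sub>C X l (act w f)) \<in> words F (Suc (length w))"
      unfolding words_def by (intro cv.span_sum cv.span_scale) auto
    moreover have "X j (act (i # w) f - act (insort i w) f) \<in> words F (Suc (length w))"
      using Cons by (intro words_closed) auto
    moreover have "act (i # j # w) f - act (insort i (j # w)) f =
      X j (act (i # w) f - act (insort i w) f) + (\<Sum>l<m. c l *\<^sub>C X l (act w f))"
      using False by (simp add: c L.diff)
    ultimately show ?thesis unfolding words_def by (simp add: cv.span_add)
  qed
qed

text \<open>Sort the tail first, then insert the head. The truncated subtraction is harmless, since
  the empty word is already sorted and the difference is zero.\<close>

lemma act_sort: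
  assumes "f \<in> F" "set w \<subseteq> {..<m}"
  shows "act w f - act (sort w) f \<in> words F (length w - 1)"
  using assms(2)
proof (induction w)
  case Nil
  then show ?case by (simp add: words_def cv.span_zero)
next
  case (Cons i w)
  interpret L: Vector_Spaces.linear scaleC scaleC "X i" by (rule linear) (use Cons in auto)
  have "X i (act w f - act (sort w) f) \<in> words F (length w)"
  proof (cases w)
    case Nil
    then show ?thesis by (simp add: L.zero words_def cv.span_zero)
  next
    case (Cons j w')
    then show ?thesis using Cons.IH Cons.prems words_closed[of i _ F "length w - 1"] by auto
  qed
  moreover have "act (i # sort w) f - act (insort i (sort w)) f \<in> words F (length w)"
    using act_insort[of f F i "sort w"] assms(1) Cons.prems by simp
  ultimately have "X i (act w f - act (sort w) f) +
      (act (i # sort w) f - act (insort i (sort w)) f) \<in> words F (length w)"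
    unfolding words_def by (rule cv.span_add)
  then show ?case by (simp add: L.diff)
qed

text \<open>Downward induction on the least letter allowed: a sorted word is a power of
  \<open>X j\<close> applied to a sorted word in larger letters. Those larger words act into the
  span of a finite set, and local finiteness is applied to each of its elements.\<close>

lemma sorted_words_finite_dimensional:
  assumes "finite F" "j \<le> m"
  shows "\<exists>G. finite G \<and>
    (\<forall>w f. sorted w \<and> set w \<subseteq> {j..<m} \<and> f \<in> F \<longrightarrow> act w f \<in> cv.span G)"
  using assms(2)
proof (induction j rule: inc_induct)
  case base
  show ?case by (rule exI[of _ F]) (auto simp: assms cv.span_base)
next
  case (step j)
  then obtain G where G: "finite G"
    "\<And>w f. \<lbrakk>sorted w; set w \<subseteq> {Suc j..<m}; f \<in> F\<rbrakk> \<Longrightarrow> act w f \<in> cv.span G"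
    by blast
  interpret L: Vector_Spaces.linear scaleC scaleC "X j" by (rule linear) (use step in auto)
  obtain h where h: "\<And>v. finite (h v)" "\<And>v a. (X j ^^ a) v \<in> cv.span (h v)"
    using locally_finite[OF \<open>j < m\<close>] by metis
  define G' where "G' = (\<Union>g\<in>G. h g)"
  have power: "(X j ^^ a) v \<in> cv.span G'" if "v \<in> cv.span G" for v a
    using that
  proof (induction rule: cv.span_induct_alt)
    case base
    have "(X j ^^ a) 0 = 0" by (induction a) (auto simp: L.zero)
    then show ?case by (simp add: cv.span_zero)
  next
    case (step c x y)
    have "(X j ^^ a) (c *\<^sub>C x + y) = c *\<^sub>C (X j ^^ a) x + (X j ^^ a) y"
      by (induction a) (auto simp: L.add L.scale)
    moreover have "(X j ^^ a) x \<in> cv.span G'"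
      using h(2)[where v=x and a=a] step(1) cv.span_mono[of "h x" G'] by (auto simp: G'_def)
    ultimately show ?case using step by (simp add: cv.span_add cv.span_scale)
  qed
  have "\<exists>a w'. act w f = (X j ^^ a) (act w' f) \<and> sorted w' \<and> set w' \<subseteq> {Suc j..<m}"
    if "sorted w" "set w \<subseteq> {j..<m}" for w f
    using that
  proof (induction w)
    case Nil
    show ?case by (rule exI[of _ 0], rule exI[of _ "[]"]) auto
  next
    case (Cons i w)
    show ?case
    proof (cases "i = j")
      case True
      obtain a w' where "act w f = (X j ^^ a) (act w' f)" "sorted w'" "set w' \<subseteq> {Suc j..<m}"
        using Cons by auto
      then show ?thesis using True
        by (intro exI[of _ "Suc a"] exI[of _ w']) auto
    next
      case False
      then show ?thesis using Cons.prems
        by (intro exI[of _ 0] exI[of _ "i # w"]) (force simp: Suc_le_eq)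
    qed
  qed
  then show ?case
    using G power h(1) by (intro exI[of _ G']) (metis G'_def finite_UN)
qed

text \<open>By induction on the length, every word differs from its sorted form by shorter words, so
  the span that contains the sorted words contains all words. The union of the filtration is stable
  under all \<open>X i\<close>.\<close>

lemma finite_dimensional_closure:
  assumes "finite F"
  obtains M G where "cv.subspace M" "F \<subseteq> M" "\<And>i v. \<lbrakk>i < m; v \<in> M\<rbrakk> \<Longrightarrow> X i v \<in> M"
    "finite G" "M \<subseteq> cv.span G"
proof -
  obtain G where G: "finite G"
    "\<And>w f. \<lbrakk>sorted w; set w \<subseteq> {..<m}; f \<in> F\<rbrakk> \<Longrightarrow> act w f \<in> cv.span G"
    using sorted_words_finite_dimensional[OF assms, of 0] by (auto simp: atLeast0LessThan)
  have words_G: "words F r \<subseteq> cv.span G" for r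
  proof (induction r)
    case 0
    show ?case unfolding words_def
      by (rule cv.span_minimal) (use G(2)[of "[]"] in \<open>auto simp: cv.span_base\<close>)
  next
    case (Suc r)
    show ?case unfolding words_def
    proof (rule cv.span_minimal, clarify)
      fix w f assume w: "set w \<subseteq> {..<m}" "length w \<le> Suc r" "f \<in> F"
      have "words F (length w - 1) \<subseteq> words F r"
        unfolding words_def using w(2) by (intro cv.span_mono) force
      then have "act w f - act (sort w) f \<in> cv.span G"
        using act_sort[of f F w] w Suc by auto
      moreover have "act (sort w) f \<in> cv.span G" using G(2) w by simp
      ultimately show "act w f \<in> cv.span G" using cv.span_add by fastforce
    qed simp
  qed
  define M where "M = (\<Union>r. words F r)"
  have mono: "words F r \<subseteq> words F r'" if "r \<le> r'" for r r'
    unfolding words_def using that by (intro cv.span_mono) force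
  show thesis
  proof
    show "cv.subspace M"
    proof (rule cv.subspaceI)
      show "0 \<in> M" by (auto simp: M_def words_def cv.span_zero)
    next
      fix x y assume "x \<in> M" "y \<in> M"
      then obtain r r' where "x \<in> words F r" "y \<in> words F r'" by (auto simp: M_def)
      then have "x \<in> words F (max r r')" "y \<in> words F (max r r')"
        using mono[of r "max r r'"] mono[of r' "max r r'"] by auto
      then show "x + y \<in> M" unfolding M_def words_def using cv.span_add by blast
    next
      fix c x assume "x \<in> M"
      then show "c *\<^sub>C x \<in> M" unfolding M_def words_def using cv.span_scale by blast
    qed
    show "F \<subseteq> M" using act_in_words[of "[]" _ _ F] by (auto simp: M_def)
    show "X i v \<in> M" if "i < m" "v \<in> M" for i v
      using words_closed that unfolding M_def by blast
    show "M \<subseteq> cv.span G" using words_G by (auto simp: M_def)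
    show "finite G" by fact
  qed
qed

end

section \<open>The degree zero part of a Lie torus\<close>

lemma subspace_dual: "cv.subspace (dual H)"
  by (rule cv.subspaceI) (auto simp: dual_def scaleC_fun_def scaleC_complex_def algebra_simps)

context lie_torus
begin

sublocale A: simple_lie_algebra "br T" UNIV by (rule simple)
sublocale B: invariant_form "br T" "form T" by (rule invariant)
sublocale G: simple_lie_algebra "br T" "grade T 0" by (rule grade0_simple)

lemma linear_br: "Vector_Spaces.linear scaleC scaleC (br T x)"
  by unfold_locales (simp_all add: A.add_right A.scale_right)

sublocale br: Vector_Spaces.linear scaleC scaleC "br T x" for x by (rule linear_br)

lemma br_antisym: "br T x y = - br T y x"
proof -
  have "0 = br T (x + y) (x + y)" by (simp add: A.alternating)
  also have "\<dots> = br T x y + br T y x"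
    by (simp only: A.add_left A.add_right UNIV_I) (simp add: A.alternating)
  finally show ?thesis by (simp add: eq_neg_iff_add_eq_0)
qed

lemma br_zero_left: "br T 0 y = 0"
  using br_antisym[of 0 y] by (simp add: br.zero)

lemma br_minus_left: "br T (- x) y = - br T x y"
  by (metis br_antisym br.neg)

lemma br_derivation: "br T x (br T y z) = br T (br T x y) z + br T y (br T x z)"
proof -
  have "br T x (br T y z) = - br T y (br T z x) - br T z (br T x y)"
    using A.jacobi[of x y z] by (simp add: eq_neg_iff_add_eq_0 algebra_simps)
  moreover have "- br T y (br T z x) = br T y (br T x z)"
    by (metis br_antisym br.neg)
  moreover have "- br T z (br T x y) = br T (br T x y) z"
    by (metis br_antisym)
  ultimately show ?thesis by simp
qed

lemma form_add_right: "form T x (y + z) = form T x y + form T x z"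
  by (metis B.form_add B.form_sym)

lemma form_scale_right: "form T x (c *\<^sub>C y) = c * form T x y"
  by (metis B.form_scale B.form_sym)

lemma form_zero: "form T 0 x = 0" "form T x 0 = 0"
  using B.form_scale[of 0 0 x] B.form_sym[of x 0] by simp_all

lemma form_minus: "form T (- x) y = - form T x y" "form T y (- x) = - form T y x"
  using B.form_scale[of "-1" x y] B.form_sym[of y] by simp_all

lemma form_diff: "form T (x - y) z = form T x z - form T y z"
  using B.form_add[of x "- y" z] by (simp add: form_minus)

lemma form_sum_right: "form T x (\<Sum>i\<in>I. f i) = (\<Sum>i\<in>I. form T x (f i))"
  by (induction I rule: infinite_finite_induct) (auto simp: form_zero form_add_right)

section \<open>The grading and the form in degree zero\<close>

lemma sig_linear: "Vector_Spaces.linear scaleC scaleC (sig T i)"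
  using sig_automorphism by (auto simp: lie_automorphism_def)

sublocale sig: Vector_Spaces.linear scaleC scaleC "sig T i" for i by (rule sig_linear)

lemma sig_br: "sig T i (br T x y) = br T (sig T i x) (sig T i y)"
  using sig_automorphism by (auto simp: lie_automorphism_def)

lemma grade_zero_iff: "x \<in> grade T 0 \<longleftrightarrow> (\<forall>i. sig T i x = x)"
  by (simp add: grade_def)

lemma xi_nonzero: "xi T i \<noteq> 0"
  using xi_primitive(1)[of i] sig_order(1)[of i] by (metis power_0_left neq0_conv zero_neq_one)

lemma grade_br: "\<lbrakk>x \<in> grade T k; y \<in> grade T l\<rbrakk> \<Longrightarrow> br T x y \<in> grade T (k + l)"
  by (auto simp: grade_def sig_br A.scale_left A.scale_right power_int_add xi_nonzero mult.commute)

lemma grade_Gamma: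
  assumes "l \<in> Gamma T"
  shows "grade T (k + l) = grade T k"
proof -
  have "xi T i powi ((k + l) $ i) = xi T i powi (k $ i)" for i
  proof -
    obtain j where "l $ i = int (sig_ord T i) * j" using assms by (auto simp: Gamma_def)
    then have "xi T i powi (l $ i) = 1"
      by (simp add: power_int_mult xi_primitive)
    then show ?thesis by (simp add: power_int_add xi_nonzero)
  qed
  then show ?thesis by (simp add: grade_def)
qed

lemma subspace_grade: "cv.subspace (grade T k)"
  by (rule cv.subspaceI)
    (auto simp: grade_def sig.zero sig.add sig.scale cv.scale_right_distrib mult.commute)

text \<open>Averaging over the finite orders of the \<open>\<sigma>\<^sub>i\<close> projects \<open>\<gg>\<close> onto its degree zero part, and
  the invariance of the form under automorphisms makes this projection self-adjoint.\<close>

lemma form_average: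
  assumes "finite I"
  shows "\<exists>y'. (\<forall>i\<in>I. sig T i y' = y') \<and> (\<forall>x\<in>grade T 0. form T x y' = form T x y)"
  using assms
proof (induction I)
  case empty
  show ?case by auto
next
  case (insert i I)
  then obtain z where z: "\<And>i. i \<in> I \<Longrightarrow> sig T i z = z"
    "\<And>x. x \<in> grade T 0 \<Longrightarrow> form T x z = form T x y"
    by blast
  define m where "m = sig_ord T i"
  \<comment> \<open>The sum over the orbit of \<open>sig T i\<close>. Since the automorphisms
    commute, it stays fixed by those already treated.\<close>
  define w where "w = (\<Sum>j<m. (sig T i ^^ j) z)"
  have fix_i: "sig T i w = w"
  proof -
    have "sig T i w = (\<Sum>j<m. (sig T i ^^ Suc j) z)" by (simp add: w_def sig.sum)
    \<comment> \<open>Applying \<open>sig T i\<close> shifts the summands cyclically; the term of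
      exponent 0 is added on both sides to compare the two sums, and the order \<open>m\<close>
      makes the two end terms agree.\<close>
    also have "\<dots> + (sig T i ^^ 0) z = (\<Sum>j<Suc m. (sig T i ^^ j) z)"
      by (subst sum.lessThan_Suc_shift) (simp add: add.commute)
    also have "\<dots> = w + (sig T i ^^ m) z" by (simp add: w_def)
    also have "(sig T i ^^ m) z = (sig T i ^^ 0) z" by (simp add: m_def sig_order)
    finally show ?thesis by simp
  qed
  have comm: "sig T i' ((sig T i ^^ j) z) = (sig T i ^^ j) (sig T i' z)" for i' j
  proof (induction j)
    case (Suc j)
    have "sig T i' (sig T i u) = sig T i (sig T i' u)" for u
      using sig_commute[of i' i] by (metis comp_apply)
    then show ?case using Suc by simp
  qed simp
  have form_w: "form T x w = of_nat m * form T x y" if "x \<in> grade T 0" for x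
  proof -
    have "form T x ((sig T i ^^ j) z) = form T x z" for j
    proof (induction j)
      case (Suc j)
      have "form T x ((sig T i ^^ Suc j) z) = form T (sig T i x) (sig T i ((sig T i ^^ j) z))"
        using that by (simp add: grade_zero_iff)
      then show ?case using B.form_automorphism[OF sig_automorphism] Suc by simp
    qed simp
    then show ?thesis by (simp add: w_def form_sum_right z(2) that)
  qed
  have "m > 0" by (simp add: m_def sig_order)
  then show ?case
    using fix_i form_w z(1)
    by (intro exI[of _ "inverse (of_nat m) *\<^sub>C w"])
      (auto simp: sig.scale sig.sum comm w_def form_scale_right)
qed

text \<open>An arbitrary \<open>y\<close> may be replaced by its average in degree zero without
  changing its pairing with \<open>x\<close>, so nondegeneracy on the whole algebra passes to the
  degree zero part.\<close>

lemma form_nondegenerate_zero: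
  assumes "x \<in> grade T 0" and "\<And>y. y \<in> grade T 0 \<Longrightarrow> form T x y = 0"
  shows "x = 0"
proof (rule B.form_nondegenerate)
  fix y
  obtain y' where "y' \<in> grade T 0" "form T x y' = form T x y"
    using form_average[of UNIV y] assms(1) by (auto simp: grade_zero_iff)
  then show "form T x y = 0" using assms(2) by simp
qed

section \<open>Root spaces and the root space decomposition\<close>

lemma csa_subspace: "cv.subspace (csa T)"
  and csa_grade: "csa T \<subseteq> grade T 0"
  and csa_abelian: "\<lbrakk>h \<in> csa T; h' \<in> csa T\<rbrakk> \<Longrightarrow> br T h h' = 0"
  and csa_centraliser: "\<lbrakk>x \<in> grade T 0; \<And>h. h \<in> csa T \<Longrightarrow> br T h x = 0\<rbrakk> \<Longrightarrow> x \<in> csa T"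
  and csa_diagonalisable:
    "h \<in> csa T \<Longrightarrow> grade T 0 = cv.span {x \<in> grade T 0. \<exists>c. br T h x = c *\<^sub>C x}"
  using cartan by (auto simp: cartan_subalgebra_def)

lemma dual_csa:
  assumes "\<alpha> \<in> dual (csa T)" "h \<in> csa T" "h' \<in> csa T"
  shows "\<alpha> (h + h') = \<alpha> h + \<alpha> h'" "\<alpha> (c *\<^sub>C h) = c * \<alpha> h" "\<alpha> 0 = 0"
    "\<alpha> (h - h') = \<alpha> h - \<alpha> h'" "\<alpha> (- h) = - \<alpha> h"
proof -
  have "\<alpha> (a *\<^sub>C x) = a * \<alpha> x" "\<alpha> (x + y) = \<alpha> x + \<alpha> y" if "x \<in> csa T" "y \<in> csa T" for a x y
    using assms(1) that by (auto simp: dual_def)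
  note * = this
  show "\<alpha> (h + h') = \<alpha> h + \<alpha> h'" "\<alpha> (c *\<^sub>C h) = c * \<alpha> h"
    using * assms by blast+
  show "\<alpha> 0 = 0" using *(1)[of h h 0] assms by simp
  show "\<alpha> (- h) = - \<alpha> h" using *(1)[of h h "-1"] assms by simp
  then show "\<alpha> (h - h') = \<alpha> h - \<alpha> h'"
    using *(2)[of h "- h'"] *(1)[of h' h' "-1"] assms cv.subspace_neg[OF csa_subspace]
    by simp
qed

lemma dual_scale:
  assumes "\<alpha> \<in> dual (csa T)" "h \<in> csa T"
  shows "\<alpha> (c *\<^sub>C h) = c * \<alpha> h" "\<alpha> (- h) = - \<alpha> h"
  using dual_csa(2,5)[OF assms assms(2)] by auto

lemma dual_eqI:
  assumes "\<alpha> \<in> dual H" "\<beta> \<in> dual H" "\<And>h. h \<in> H \<Longrightarrow> \<alpha> h = \<beta> h"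
  shows "\<alpha> = \<beta>"
  using assms unfolding dual_def fun_eq_iff by (metis (mono_tags, lifting) mem_Collect_eq)

lemma subspace_root_space: "cv.subspace (root_space T k \<alpha>)"
  using subspace_grade[of k]
  by (auto simp: root_space_def cv.subspace_def br.zero br.add br.scale cv.scale_right_distrib
    mult.commute)

lemma root_space_br:
  assumes "x \<in> root_space T k \<alpha>" "y \<in> root_space T l \<beta>"
  shows "br T x y \<in> root_space T (k + l) (\<alpha> + \<beta>)"
proof -
  have "br T h (br T x y) = (\<alpha> + \<beta>) h *\<^sub>C br T x y" if "h \<in> csa T" for h
  proof -
    have "br T h x = \<alpha> h *\<^sub>C x" "br T h y = \<beta> h *\<^sub>C y"
      using assms that by (auto simp: root_space_def)
    then show ?thesis
      unfolding br_derivation[of h x y] by (simp add: A.scale_left br.scale cv.scale_left_distrib)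
  qed
  then show ?thesis using assms grade_br by (simp add: root_space_def)
qed

lemma root_space_zero: "root_space T 0 0 = csa T"
  using csa_grade csa_abelian csa_centraliser by (auto simp: root_space_def)

text \<open>Moving \<open>h\<close> across the form by invariance shows that root spaces are
  orthogonal unless their weights are opposite.\<close>

lemma root_space_form:
  assumes "x \<in> root_space T k \<alpha>" "y \<in> root_space T l \<beta>" "form T x y \<noteq> 0" "h \<in> csa T"
  shows "\<beta> h = - \<alpha> h"
proof -
  have "\<alpha> h * form T x y = form T (br T h x) y"
    using assms by (simp add: root_space_def B.form_scale)
  also have "\<dots> = - form T (br T x h) y"
    by (subst br_antisym) (simp add: form_minus)
  also have "\<dots> = - form T x (br T h y)" by (simp add: B.form_invariant)
  also have "\<dots> = - \<beta> h * form T x y"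
    using assms by (simp add: root_space_def form_scale_right)
  finally have "\<alpha> h = - \<beta> h" using assms(3) mult_right_cancel by blast
  then show ?thesis by simp
qed

text \<open>Commuting diagonalisable operators are simultaneously diagonalisable: the components of
  a common eigenvector of \<open>C\<close> with respect to the eigenspaces of a further
  \<open>h\<close> remain eigenvectors of \<open>C\<close>.\<close>

lemma simultaneous_eigenvectors:
  assumes "finite C" "C \<subseteq> csa T"
  shows "grade T 0 \<subseteq> cv.span {x \<in> grade T 0. \<forall>h\<in>C. \<exists>c. br T h x = c *\<^sub>C x}"
  using assms
proof (induction C)
  case empty
  show ?case by (auto simp: cv.span_base)
next
  case (insert h C)
  let ?E = "\<lambda>C. {x \<in> grade T 0. \<forall>h\<in>C. \<exists>c. br T h x = c *\<^sub>C x}"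
  have h: "h \<in> csa T" using insert by simp
  define S where "S c = {y \<in> grade T 0. br T h y = c *\<^sub>C y}" for c
  have S_subspace: "cv.subspace (S c)" for c
    using subspace_grade[of 0]
    by (auto simp: S_def cv.subspace_def br.zero br.add br.scale cv.scale_right_distrib
      mult.commute)
  have "?E C \<subseteq> cv.span (?E (insert h C))"
  proof
    fix x assume x: "x \<in> ?E C"
    have eq: "{x \<in> grade T 0. \<exists>c. br T h x = c *\<^sub>C x} = (\<Union>c. S c)"
      by (auto simp: S_def)
    have "x \<in> grade T 0" using x by simp
    then have "x \<in> cv.span (\<Union>c. S c)"
      using equalityD1[OF csa_diagonalisable[OF h]] unfolding eq by (rule subsetD[rotated])
    then have "\<exists>P f. finite P \<and> (\<forall>c. f c \<in> S c) \<and> x = (\<Sum>c\<in>P. f c)"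
      by (rule span_Union_subspaces[OF S_subspace])
    then obtain P f where P: "finite P" "\<forall>c. f c \<in> S c" "x = (\<Sum>c\<in>P. f c)"
      by (elim exE conjE) (rule that)
    have "br T b (f c) = e *\<^sub>C f c"
      if b: "b \<in> C" and e: "br T b x = e *\<^sub>C x" and "c \<in> P" for b e c
    proof -
      \<comment> \<open>Each summand again lies in the eigenspace of \<open>h\<close> for
        \<open>c\<close>, because \<open>b\<close> and \<open>h\<close> commute. The sum vanishes,
        hence so does every summand.\<close>
      have "(\<Sum>c\<in>P. br T b (f c) - e *\<^sub>C f c) = 0"
        using e by (simp add: P(3) br.sum cv.scale_sum_right sum_subtractf)
      then have "br T b (f c) - e *\<^sub>C f c = 0"
      proof (rule common_eigenvectors_zero[where I = "{h}" and op = "br T" and ev = "\<lambda>c _. c",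
            rotated 4])
        fix c i assume "i \<in> {h}"
        moreover have "br T h (br T b (f c)) = br T b (br T h (f c))"
          using csa_abelian[of h b] h b insert.prems
          by (simp add: br_derivation[of h b] br_zero_left subset_iff)
        moreover have "br T h (f c) = c *\<^sub>C f c" using P(2) by (simp add: S_def)
        ultimately show "br T i (br T b (f c) - e *\<^sub>C f c) = c *\<^sub>C (br T b (f c) - e *\<^sub>C f c)"
          by (simp add: br.diff br.scale cv.scale_right_diff_distrib mult.commute)
      qed (use P linear_br \<open>c \<in> P\<close> in auto)
      then show ?thesis by simp
    qed
    then have "f c \<in> ?E (insert h C)" if "c \<in> P" for c
      using x P(2) that by (auto simp: S_def) metis
    then show "x \<in> cv.span (?E (insert h C))"
      unfolding P(3) by (intro cv.span_sum cv.span_base)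
  qed
  then have "cv.span (?E C) \<subseteq> cv.span (?E (insert h C))"
    by (intro cv.span_minimal cv.subspace_span)
  then show ?case using insert by auto
qed

lemma finite_spanning:
  obtains G :: "'g set" where "finite G" "cv.span G = UNIV"
  using finite_dimensional by (auto simp: fin_dim_def)

text \<open>Diagonalising a finite basis \<open>C\<close> of \<open>csa T\<close> suffices, since a
  common eigenvector of \<open>C\<close> is an eigenvector of the whole span; its eigenvalues depend
  linearly on the element.\<close>

lemma root_space_decomposition:
  assumes "x \<in> grade T 0"
  obtains C f where "C \<subseteq> dual (csa T)" "\<And>\<alpha>. f \<alpha> \<in> root_space T 0 \<alpha>"
    "x = (\<Sum>\<alpha>\<in>C. f \<alpha>)"
proof -
  obtain G :: "'g set" where G: "finite G" "cv.span G = UNIV" by (rule finite_spanning)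
  obtain C where C: "C \<subseteq> csa T" "cv.independent C" "csa T \<subseteq> cv.span C"
    using cv.basis_exists[of "csa T"] by metis
  have "finite C"
    using finite_independent_span[OF G(1), of id C] C G by auto
  have root_vector: "\<exists>\<alpha>\<in>dual (csa T). x \<in> root_space T 0 \<alpha>"
    if x: "x \<in> grade T 0" "\<forall>h\<in>C. \<exists>c. br T h x = c *\<^sub>C x" for x
  proof (cases "x = 0")
    case True
    then show ?thesis
      using cv.subspace_0[OF subspace_dual] cv.subspace_0[OF subspace_root_space] by blast
  next
    case False
    have "\<exists>c. br T h x = c *\<^sub>C x" if "h \<in> cv.span C" for h
      using that
    proof (induction rule: cv.span_induct_alt)
      case base
      show ?case by (rule exI[of _ 0]) (simp add: br_zero_left)
    next
      case (step c y z)
      then obtain a b where "br T y x = a *\<^sub>C x" "br T z x = b *\<^sub>C x" using x(2) by blast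
      then show ?case
        by (intro exI[of _ "c * a + b"]) (simp add: A.add_left A.scale_left cv.scale_left_distrib)
    qed
    then obtain a where a: "\<And>h. h \<in> csa T \<Longrightarrow> br T h x = a h *\<^sub>C x"
      using C(3) by (metis subsetD)
    define \<alpha> where "\<alpha> h = (if h \<in> csa T then a h else 0)" for h
    have \<alpha>: "br T h x = \<alpha> h *\<^sub>C x" if "h \<in> csa T" for h using a that by (simp add: \<alpha>_def)
    have "\<alpha> (h + h') = \<alpha> h + \<alpha> h'" if "h \<in> csa T" "h' \<in> csa T" for h h'
    proof -
      have "\<alpha> (h + h') *\<^sub>C x = br T (h + h') x"
        using \<alpha>[of "h + h'"] that cv.subspace_add[OF csa_subspace] by simp
      also have "\<dots> = (\<alpha> h + \<alpha> h') *\<^sub>C x"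
        using \<alpha> that by (simp add: A.add_left cv.scale_left_distrib)
      finally show ?thesis using False by simp
    qed
    moreover have "\<alpha> (c *\<^sub>C h) = c * \<alpha> h" if "h \<in> csa T" for h c
    proof -
      have "\<alpha> (c *\<^sub>C h) *\<^sub>C x = br T (c *\<^sub>C h) x"
        using \<alpha>[of "c *\<^sub>C h"] that cv.subspace_scale[OF csa_subspace] by simp
      also have "\<dots> = (c * \<alpha> h) *\<^sub>C x"
        using \<alpha> that by (simp add: A.scale_left)
      finally show ?thesis using False by simp
    qed
    ultimately have "\<alpha> \<in> dual (csa T)" by (auto simp: dual_def \<alpha>_def)
    then show ?thesis using \<alpha> x by (auto simp: root_space_def)
  qed
  define S where "S \<alpha> = (if \<alpha> \<in> dual (csa T) then root_space T 0 \<alpha> else {0})" for \<alpha>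
  have S: "cv.subspace (S \<alpha>)" for \<alpha> by (simp add: S_def subspace_root_space)
  have "x \<in> cv.span {x \<in> grade T 0. \<forall>h\<in>C. \<exists>c. br T h x = c *\<^sub>C x}"
    using simultaneous_eigenvectors[OF \<open>finite C\<close> C(1)] assms by blast
  moreover have "{x \<in> grade T 0. \<forall>h\<in>C. \<exists>c. br T h x = c *\<^sub>C x} \<subseteq> (\<Union>\<alpha>. S \<alpha>)"
    using root_vector by (fastforce simp: S_def)
  ultimately have "x \<in> cv.span (\<Union>\<alpha>. S \<alpha>)" using cv.span_mono by blast
  then have "\<exists>P f. finite P \<and> (\<forall>c. f c \<in> S c) \<and> x = (\<Sum>c\<in>P. f c)"
    by (rule span_Union_subspaces[OF S])
  then obtain P f where P: "finite P" "\<forall>c. f c \<in> S c" "x = (\<Sum>c\<in>P. f c)"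
    by (elim exE conjE) (rule that)
  have "x = (\<Sum>\<alpha>\<in>P \<inter> dual (csa T). f \<alpha>)"
    unfolding P(3) using P(1,2) by (intro sum.mono_neutral_right) (auto simp: S_def split: if_splits)
  moreover have "f \<alpha> \<in> root_space T 0 \<alpha>" for \<alpha>
    using spec[OF P(2), of \<alpha>] cv.subspace_0[OF subspace_root_space] by (auto simp: S_def split: if_splits)
  ultimately show thesis using that[of "P \<inter> dual (csa T)" f] by blast
qed

lemma weights_finite: "finite {\<beta> \<in> dual (csa T). root_space T k \<beta> \<noteq> {0}}"
proof -
  obtain G :: "'g set" where G: "finite G" "cv.span G = UNIV" by (rule finite_spanning)
  show ?thesis
  proof (rule finite_eigenvalues[where I = "csa T" and op = "br T" and ev = "\<lambda>\<beta>. \<beta>", OF G(1)])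
    show "\<exists>h\<in>csa T. \<beta> h \<noteq> \<gamma> h" if "\<beta> \<in> {\<beta> \<in> dual (csa T). root_space T k \<beta> \<noteq> {0}}"
      "\<gamma> \<in> {\<beta> \<in> dual (csa T). root_space T k \<beta> \<noteq> {0}}" "\<beta> \<noteq> \<gamma>" for \<beta> \<gamma>
      using that dual_eqI by blast
    show "\<exists>v\<in>cv.span G. v \<noteq> 0 \<and> (\<forall>h\<in>csa T. br T h v = \<beta> h *\<^sub>C v)"
      if "\<beta> \<in> {\<beta> \<in> dual (csa T). root_space T k \<beta> \<noteq> {0}}" for \<beta>
      using that cv.subspace_0[OF subspace_root_space, of k \<beta>] G by (auto simp: root_space_def)
  qed (rule linear_br)
qed

lemma roots_finite: "finite (roots0 T)"
  by (rule finite_subset[OF _ weights_finite[of 0]]) (auto simp: roots0_def)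

lemma root_space_br_power:
  assumes "x \<in> root_space T 0 \<alpha>" "u \<in> root_space T k \<beta>"
  shows "(br T x ^^ n) u \<in> root_space T k (\<beta> + of_nat n *\<^sub>C \<alpha>)"
proof (induction n)
  case 0
  show ?case using assms by (simp add: zero_fun_def[symmetric])
next
  case (Suc n)
  have "br T x ((br T x ^^ n) u) \<in> root_space T (0 + k) (\<alpha> + (\<beta> + of_nat n *\<^sub>C \<alpha>))"
    by (rule root_space_br) (fact assms, fact Suc)
  moreover have "\<alpha> + (\<beta> + of_nat n *\<^sub>C \<alpha>) = \<beta> + of_nat (Suc n) *\<^sub>C \<alpha>"
    by (simp add: cv.scale_left_distrib fun_eq_iff)
  ultimately have "br T x ((br T x ^^ n) u) \<in> root_space T k (\<beta> + of_nat (Suc n) *\<^sub>C \<alpha>)"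
    by (metis add_0_left)
  then show ?case by (simp only: funpow.simps comp_apply)
qed

text \<open>Otherwise the weights \<open>\<beta> + n \<alpha>\<close> would all occur. They are
  pairwise distinct, but only finitely many weights occur in one degree.\<close>

lemma ad_nilpotent:
  assumes "x \<in> root_space T 0 \<alpha>" "u \<in> root_space T k \<beta>" "\<alpha> \<in> dual (csa T)" "\<beta> \<in> dual (csa T)"
    and "\<alpha> \<noteq> 0"
  shows "\<exists>n. (br T x ^^ n) u = 0"
proof (rule ccontr)
  assume "\<not> ?thesis"
  then have "root_space T k (\<beta> + of_nat n *\<^sub>C \<alpha>) \<noteq> {0}" for n
    using root_space_br_power[OF assms(1,2), of n] by auto
  moreover have "\<beta> + of_nat n *\<^sub>C \<alpha> \<in> dual (csa T)" for n
    using assms by (intro cv.subspace_add[OF subspace_dual] cv.subspace_scale[OF subspace_dual])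
  ultimately have "range (\<lambda>n. \<beta> + of_nat n *\<^sub>C \<alpha>) \<subseteq> {\<beta> \<in> dual (csa T). root_space T k \<beta> \<noteq> {0}}"
    by auto
  moreover have "inj (\<lambda>n. \<beta> + of_nat n *\<^sub>C \<alpha>)" using assms(5) by (auto intro!: injI)
  ultimately show False using weights_finite[of k] finite_subset range_inj_infinite by blast
qed

section \<open>Dual vectors and coroots\<close>

definition representable :: "('g \<Rightarrow> complex) set" where
  "representable = {\<alpha> \<in> dual (csa T). \<exists>t\<in>csa T. \<forall>h\<in>csa T. form T t h = \<alpha> h}"

abbreviation dv :: "('g \<Rightarrow> complex) \<Rightarrow> 'g" where
  "dv \<equiv> dual_vector T"

text \<open>The usual 2 t / (\<alpha>|\<alpha>) with t the vector representing \<alpha>, since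
  \<open>\<alpha> (dv \<alpha>)\<close> is the squared length of \<alpha>. For a root it is non-zero
  by \<open>root_nonisotropic\<close>.\<close>

definition coroot :: "('g \<Rightarrow> complex) \<Rightarrow> 'g" where
  "coroot \<alpha> = (2 / \<alpha> (dv \<alpha>)) *\<^sub>C dv \<alpha>"

text \<open>\<open>csa T\<close> is the weight space of 0, hence orthogonal to all root spaces of
  non-zero weight. An element orthogonal to \<open>csa T\<close> is then orthogonal to the whole
  degree zero part.\<close>

lemma csa_form_nondegenerate:
  assumes t: "t \<in> csa T" and zero: "\<And>h. h \<in> csa T \<Longrightarrow> form T t h = 0"
  shows "t = 0"
proof (rule form_nondegenerate_zero)
  show "t \<in> grade T 0" using t csa_grade by blast
  fix y assume "y \<in> grade T 0"
  then obtain C f where C: "C \<subseteq> dual (csa T)" "\<And>\<alpha>. f \<alpha> \<in> root_space T 0 \<alpha>"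
    and y: "y = (\<Sum>\<alpha>\<in>C. f \<alpha>)"
    by (rule root_space_decomposition) (rule that)
  have "form T t (f \<alpha>) = 0" if "\<alpha> \<in> C" for \<alpha>
  proof (rule ccontr)
    assume nz: "form T t (f \<alpha>) \<noteq> 0"
    have "t \<in> root_space T 0 0" using t root_space_zero by simp
    from root_space_form[OF this C(2) nz] have "\<alpha> h = 0" if "h \<in> csa T" for h
      using that by simp
    then have "\<alpha> = 0"
      using C(1) \<open>\<alpha> \<in> C\<close> by (intro dual_eqI[of _ "csa T"]) (auto simp: cv.subspace_0[OF subspace_dual])
    then show False using C(2)[of \<alpha>] root_space_zero zero nz by auto
  qed
  then show "form T t y = 0" by (simp add: y form_sum_right)
qed

lemma dual_vector:
  assumes "\<alpha> \<in> representable"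
  shows "dv \<alpha> \<in> csa T" "h \<in> csa T \<Longrightarrow> form T (dv \<alpha>) h = \<alpha> h"
proof -
  have "\<exists>!t. t \<in> csa T \<and> (\<forall>h\<in>csa T. form T t h = \<alpha> h)"
  proof (rule ex_ex1I)
    show "\<exists>t. t \<in> csa T \<and> (\<forall>h\<in>csa T. form T t h = \<alpha> h)"
      using assms by (auto simp: representable_def)
    fix t t' assume "t \<in> csa T \<and> (\<forall>h\<in>csa T. form T t h = \<alpha> h)"
      "t' \<in> csa T \<and> (\<forall>h\<in>csa T. form T t' h = \<alpha> h)"
    then have "t - t' = 0"
      using cv.subspace_diff[OF csa_subspace]
      by (intro csa_form_nondegenerate) (auto simp: form_diff)
    then show "t = t'" by simp
  qed
  then have "dv \<alpha> \<in> csa T \<and> (\<forall>h\<in>csa T. form T (dv \<alpha>) h = \<alpha> h)"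
    unfolding dual_vector_def by (rule theI')
  then show "dv \<alpha> \<in> csa T" "h \<in> csa T \<Longrightarrow> form T (dv \<alpha>) h = \<alpha> h" by auto
qed

lemma dual_vector_eqI:
  assumes "\<alpha> \<in> representable" "t \<in> csa T" "\<And>h. h \<in> csa T \<Longrightarrow> form T t h = \<alpha> h"
  shows "t = dv \<alpha>"
proof -
  have "t - dv \<alpha> = 0"
    using cv.subspace_diff[OF csa_subspace] assms dual_vector
    by (intro csa_form_nondegenerate) (auto simp: form_diff)
  then show ?thesis by simp
qed

lemma representable_dual: "\<alpha> \<in> representable \<Longrightarrow> \<alpha> \<in> dual (csa T)"
  by (simp add: representable_def)

lemma subspace_representable: "cv.subspace representable"
proof (rule cv.subspaceI)
  show "0 \<in> representable"
    using cv.subspace_0[OF subspace_dual] cv.subspace_0[OF csa_subspace]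
    by (auto simp: representable_def form_zero intro!: bexI[of _ 0])
next
  fix \<alpha> \<beta> assume "\<alpha> \<in> representable" "\<beta> \<in> representable"
  then show "\<alpha> + \<beta> \<in> representable"
    using cv.subspace_add[OF subspace_dual] cv.subspace_add[OF csa_subspace] dual_vector[of \<alpha>]
      dual_vector[of \<beta>]
    by (auto simp: representable_def B.form_add intro!: bexI[of _ "dv \<alpha> + dv \<beta>"])
next
  fix c \<alpha> assume "\<alpha> \<in> representable"
  then show "c *\<^sub>C \<alpha> \<in> representable"
    using cv.subspace_scale[OF subspace_dual] cv.subspace_scale[OF csa_subspace] dual_vector[of \<alpha>]
    by (auto simp: representable_def B.form_scale scaleC_fun_def scaleC_complex_def
      intro!: bexI[of _ "c *\<^sub>C dv \<alpha>"])
qed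

lemma dual_vector_reflect:
  assumes "\<alpha> \<in> representable" "\<beta> \<in> representable"
  shows "dv (\<beta> - c *\<^sub>C \<alpha>) = dv \<beta> - c *\<^sub>C dv \<alpha>"
proof (rule dual_vector_eqI[symmetric])
  show "\<beta> - c *\<^sub>C \<alpha> \<in> representable"
    using assms subspace_representable by (intro cv.subspace_diff cv.subspace_scale)
  show "dv \<beta> - c *\<^sub>C dv \<alpha> \<in> csa T"
    using assms dual_vector csa_subspace by (intro cv.subspace_diff cv.subspace_scale) auto
  fix h assume "h \<in> csa T"
  then show "form T (dv \<beta> - c *\<^sub>C dv \<alpha>) h = (\<beta> - c *\<^sub>C \<alpha>) h"
    using assms dual_vector by (simp add: form_diff B.form_scale scaleC_fun_def scaleC_complex_def)
qed

lemma dual_vector_swap: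
  assumes "\<alpha> \<in> representable" "\<beta> \<in> representable"
  shows "\<alpha> (dv \<beta>) = \<beta> (dv \<alpha>)"
  using assms dual_vector by (metis B.form_sym)

text \<open>A central \<open>z\<close> spans an ideal, which is zero or everything by simplicity;
  the second case would make the algebra abelian.\<close>

lemma center_trivial:
  assumes "z \<in> grade T 0" "\<And>x. x \<in> grade T 0 \<Longrightarrow> br T z x = 0"
  shows "z = 0"
proof -
  have zero: "br T x y = 0" if "x \<in> grade T 0" "y \<in> cv.span {z}" for x y
    using that assms(2) br_antisym[of x z] by (auto simp: cv.span_singleton br.scale)
  have "cv.span {z} \<subseteq> grade T 0"
    using assms(1) subspace_grade by (intro cv.span_minimal) auto
  then have "lie_ideal (br T) (grade T 0) (cv.span {z})"
    using zero by (auto simp: lie_ideal_def cv.span_zero)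
  then have "cv.span {z} = {0} \<or> cv.span {z} = grade T 0" by (rule G.ideal_trivial)
  then show ?thesis
  proof
    assume "cv.span {z} = {0}"
    then show ?thesis using cv.span_base[of z "{z}"] by auto
  next
    assume "cv.span {z} = grade T 0"
    then show ?thesis using G.nonabelian zero by auto
  qed
qed

text \<open>If all weights vanish at \<open>t\<close>, then \<open>t\<close> kills every root space
  and is therefore central.\<close>

lemma csa_faithful:
  assumes "t \<in> csa T" "\<And>\<beta>. \<lbrakk>\<beta> \<in> dual (csa T); root_space T 0 \<beta> \<noteq> {0}\<rbrakk> \<Longrightarrow> \<beta> t = 0"
  shows "t = 0"
proof (rule center_trivial)
  show "t \<in> grade T 0" using assms csa_grade by blast
  fix y assume "y \<in> grade T 0"
  then obtain C f where C: "C \<subseteq> dual (csa T)" "\<And>\<alpha>. f \<alpha> \<in> root_space T 0 \<alpha>"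
    and y: "y = (\<Sum>\<alpha>\<in>C. f \<alpha>)"
    by (rule root_space_decomposition) (rule that)
  have "br T t (f \<beta>) = 0" if "\<beta> \<in> C" for \<beta>
  proof (cases "f \<beta> = 0")
    case False
    then have "\<beta> t = 0" using C that assms(2)[of \<beta>] by blast
    then show ?thesis using C(2)[of \<beta>] assms(1) by (simp add: root_space_def)
  qed (simp add: br.zero)
  then show "br T t y = 0" by (simp add: y br.sum)
qed

text \<open>Nondegeneracy provides a vector pairing with \<open>x\<close> to a non-zero value. One
  of its root components does so too; its weight must be \<open>- \<alpha>\<close>, and rescaling it
  gives \<open>y\<close>. By invariance the bracket then represents \<alpha>.\<close>

lemma root_pairing:
  assumes "\<alpha> \<in> roots0 T" "x \<in> root_space T 0 \<alpha>" "x \<noteq> 0"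
  obtains y where "y \<in> root_space T 0 (- \<alpha>)" "form T x y = 1" "br T x y = dv \<alpha>"
    "\<alpha> \<in> representable"
proof -
  have \<alpha>: "\<alpha> \<in> dual (csa T)" using assms by (simp add: roots0_def)
  have x0: "x \<in> grade T 0" using assms by (simp add: root_space_def)
  then obtain z where z: "z \<in> grade T 0" "form T x z \<noteq> 0"
    using form_nondegenerate_zero assms(3) by blast
  obtain C f where C: "C \<subseteq> dual (csa T)" "\<And>\<alpha>. f \<alpha> \<in> root_space T 0 \<alpha>"
    and "z = (\<Sum>\<alpha>\<in>C. f \<alpha>)"
    by (rule root_space_decomposition[OF z(1)]) (rule that)
  then have "form T x z = (\<Sum>\<alpha>\<in>C. form T x (f \<alpha>))" by (simp only: form_sum_right)
  then have "(\<Sum>\<alpha>\<in>C. form T x (f \<alpha>)) \<noteq> 0" using z(2) by (simp only: not_False_eq_True)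
  then obtain \<beta> where \<beta>: "\<beta> \<in> C" "form T x (f \<beta>) \<noteq> 0"
    by (rule sum.not_neutral_contains_not_neutral)
  have "\<beta> = - \<alpha>"
    using root_space_form[OF assms(2) C(2) \<beta>(2)] \<beta>(1) C(1) \<alpha> cv.subspace_neg[OF subspace_dual]
    by (intro dual_eqI[of _ "csa T"]) auto
  define y where "y = inverse (form T x (f \<beta>)) *\<^sub>C f \<beta>"
  have y: "y \<in> root_space T 0 (- \<alpha>)"
    using C(2)[of \<beta>] \<open>\<beta> = - \<alpha>\<close> subspace_root_space by (simp add: y_def cv.subspace_scale)
  have xy: "form T x y = 1" using \<beta>(2) by (simp add: y_def form_scale_right)
  have t: "br T x y \<in> csa T"
    using root_space_br[OF assms(2) y] root_space_zero by simp
  have form_t: "form T (br T x y) h = \<alpha> h" if "h \<in> csa T" for h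
  proof -
    have "form T (br T x y) h = - form T x (br T h y)"
      by (metis B.form_invariant br_antisym form_minus(2))
    moreover have "br T h y = (- \<alpha> h) *\<^sub>C y" using y that by (simp add: root_space_def)
    ultimately show ?thesis using xy by (simp only: form_scale_right) simp
  qed
  have rep: "\<alpha> \<in> representable" using t form_t \<alpha> by (auto simp: representable_def)
  then have "br T x y = dv \<alpha>" using t form_t by (intro dual_vector_eqI) auto
  then show thesis using that y xy rep by blast
qed

lemma roots_representable: "\<alpha> \<in> roots0 T \<Longrightarrow> \<alpha> \<in> representable"
proof -
  assume \<alpha>: "\<alpha> \<in> roots0 T"
  then obtain x where "x \<in> root_space T 0 \<alpha>" "x \<noteq> 0"
    using cv.subspace_0[OF subspace_root_space, of 0 \<alpha>] by (auto simp: roots0_def)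
  then show ?thesis using root_pairing[OF \<alpha>] by metis
qed

text \<open>If \<open>(\<alpha>|\<alpha>) = 0\<close>, then \<open>x\<close>, \<open>y\<close> and \<open>t = [x, y]\<close> span a Heisenberg algebra acting by
  locally nilpotent \<open>x\<close> and \<open>y\<close>; this forces the scalars by which \<open>t\<close> acts to vanish.\<close>

lemma root_nonisotropic:
  assumes "\<alpha> \<in> roots0 T"
  shows "\<alpha> (dv \<alpha>) \<noteq> 0"
proof
  assume iso: "\<alpha> (dv \<alpha>) = 0"
  obtain x where x: "x \<in> root_space T 0 \<alpha>" "x \<noteq> 0"
    using assms cv.subspace_0[OF subspace_root_space, of 0 \<alpha>] by (auto simp: roots0_def)
  obtain y where y: "y \<in> root_space T 0 (- \<alpha>)" "br T x y = dv \<alpha>"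
    using root_pairing[OF assms x] by metis
  have \<alpha>: "\<alpha> \<in> dual (csa T)" "\<alpha> \<noteq> 0" "- \<alpha> \<in> dual (csa T)" "- \<alpha> \<noteq> 0"
    using assms cv.subspace_neg[OF subspace_dual] by (auto simp: roots0_def)
  have t: "dv \<alpha> \<in> csa T" using roots_representable assms dual_vector by blast
  have comm: "br T (dv \<alpha>) x = 0" "br T (dv \<alpha>) y = 0"
    using x y t iso by (auto simp: root_space_def)
  interpret C: commutator_triple "br T x" "br T y" "br T (dv \<alpha>)" 0
  proof
    fix v
    show "br T x (br T y v) = br T y (br T x v) + br T (dv \<alpha>) v"
      by (simp add: br_derivation[of x y] y(2))
    show "br T (dv \<alpha>) (br T x v) = br T x (br T (dv \<alpha>) v) + 0 *\<^sub>C br T x v"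
      "br T (dv \<alpha>) (br T y v) = br T y (br T (dv \<alpha>) v) - 0 *\<^sub>C br T y v"
      by (simp_all add: br_derivation[of "dv \<alpha>"] comm br_zero_left)
  qed
  interpret C': commutator_triple "br T y" "br T x" "\<lambda>v. - br T (dv \<alpha>) v" 0
    by (rule C.swap)
  have "\<beta> (dv \<alpha>) = 0" if \<beta>: "\<beta> \<in> dual (csa T)" "root_space T 0 \<beta> \<noteq> {0}" for \<beta>
  proof -
    obtain u where u: "u \<in> root_space T 0 \<beta>" "u \<noteq> 0"
      using \<beta>(2) cv.subspace_0[OF subspace_root_space, of 0 \<beta>] by auto
    obtain n where n: "(br T x ^^ n) u \<noteq> 0" "br T x ((br T x ^^ n) u) = 0"
      using C.highest_vector[OF u(2)] ad_nilpotent[OF x(1) u(1) \<alpha>(1) \<beta>(1) \<alpha>(2)] by metis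
    define w where "w = (br T x ^^ n) u"
    have w: "w \<in> root_space T 0 (\<beta> + of_nat n *\<^sub>C \<alpha>)"
      unfolding w_def by (rule root_space_br_power) fact+
    have dual: "\<beta> + of_nat n *\<^sub>C \<alpha> \<in> dual (csa T)"
      using \<alpha> \<beta> by (intro cv.subspace_add[OF subspace_dual] cv.subspace_scale[OF subspace_dual])
    obtain q where q: "(br T y ^^ q) w \<noteq> 0" "br T y ((br T y ^^ q) w) = 0"
      using C'.highest_vector n(1) ad_nilpotent[OF y(1) w \<alpha>(3) dual \<alpha>(4)] w_def by metis
    have power_zero: "(br T y ^^ k) 0 = 0" for k by (induction k) (auto simp: br.zero)
    have "br T (dv \<alpha>) w = \<beta> (dv \<alpha>) *\<^sub>C w"
      using w t iso by (simp add: root_space_def scaleC_fun_def scaleC_complex_def)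
    \<comment> \<open>With \<open>s = 0\<close> the coefficient is
      \<open>(q + 1) \<beta> (dv \<alpha>)\<close>. Both other terms vanish, as \<open>w\<close> is
      killed by \<open>x\<close> and \<open>(br T y ^^ q) w\<close> by \<open>y\<close>.\<close>
    from C.E_power_F[OF this, of q]
    have "(of_nat (Suc q) * \<beta> (dv \<alpha>)) *\<^sub>C (br T y ^^ q) w = 0"
      using q(2) n(2) power_zero by (simp add: w_def br.zero del: of_nat_Suc)
    then show ?thesis using q(1) by (simp del: of_nat_Suc)
  qed
  then have "dv \<alpha> = 0" using csa_faithful t by blast
  then have "\<alpha> h = 0" if "h \<in> csa T" for h
    using that dual_vector(2) roots_representable assms by (metis form_zero(1))
  then show False
    using \<alpha> dual_eqI[OF \<alpha>(1) cv.subspace_0[OF subspace_dual]] by simp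
qed

lemma coroot_csa: "\<alpha> \<in> roots0 T \<Longrightarrow> coroot \<alpha> \<in> csa T"
  by (simp add: coroot_def dual_vector roots_representable cv.subspace_scale csa_subspace)

lemma dual_coroot:
  assumes "\<alpha> \<in> roots0 T" "\<mu> \<in> dual (csa T)"
  shows "\<mu> (coroot \<alpha>) = 2 / \<alpha> (dv \<alpha>) * \<mu> (dv \<alpha>)"
  unfolding coroot_def using dual_scale(1) assms dual_vector roots_representable by blast

lemma root_dual: "\<alpha> \<in> roots0 T \<Longrightarrow> \<alpha> \<in> dual (csa T)"
  by (simp add: roots0_def)

lemma coroot_self: "\<alpha> \<in> roots0 T \<Longrightarrow> \<alpha> (coroot \<alpha>) = 2"
  by (simp add: dual_coroot root_dual root_nonisotropic)

section \<open>The sl2-triples of roots and their reflections\<close>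

lemma sl2_triple:
  assumes "\<alpha> \<in> roots0 T"
  obtains e f where "e \<in> root_space T 0 \<alpha>" "f \<in> root_space T 0 (- \<alpha>)" "br T e f = coroot \<alpha>"
proof -
  obtain x where x: "x \<in> root_space T 0 \<alpha>" "x \<noteq> 0"
    using assms cv.subspace_0[OF subspace_root_space, of 0 \<alpha>] by (auto simp: roots0_def)
  obtain y where y: "y \<in> root_space T 0 (- \<alpha>)" "br T x y = dv \<alpha>"
    using root_pairing[OF assms x] by metis
  have "(2 / \<alpha> (dv \<alpha>)) *\<^sub>C y \<in> root_space T 0 (- \<alpha>)"
    using y subspace_root_space by (simp add: cv.subspace_scale)
  moreover have "br T x ((2 / \<alpha> (dv \<alpha>)) *\<^sub>C y) = coroot \<alpha>"
    by (simp add: br.scale y coroot_def)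
  ultimately show thesis using that x by blast
qed

lemma root_minus:
  assumes "\<alpha> \<in> roots0 T"
  shows "- \<alpha> \<in> roots0 T" "coroot (- \<alpha>) = - coroot \<alpha>"
proof -
  obtain e f where "e \<in> root_space T 0 \<alpha>" "f \<in> root_space T 0 (- \<alpha>)" "br T e f = coroot \<alpha>"
    by (rule sl2_triple[OF assms])
  moreover have "coroot \<alpha> \<noteq> 0"
    using coroot_self[OF assms] dual_csa(3)[OF root_dual[OF assms] coroot_csa[OF assms]
      coroot_csa[OF assms]] by auto
  ultimately have "root_space T 0 (- \<alpha>) \<noteq> {0}" using br.zero by (metis singletonD)
  then show "- \<alpha> \<in> roots0 T"
    using assms cv.subspace_neg[OF subspace_dual] by (auto simp: roots0_def)
  have "0 \<in> representable" using cv.subspace_0 subspace_representable by blast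
  then have "dv (- \<alpha>) = - dv \<alpha>" 
    using dual_vector_reflect[of \<alpha> 0 1] dual_vector_reflect[of 0 0 1] roots_representable[OF assms]
    by simp
  then show "coroot (- \<alpha>) = - coroot \<alpha>"
    using dual_scale(2)[OF root_dual[OF assms] dual_vector(1)[OF roots_representable[OF assms]]]
    by (simp add: coroot_def)
qed

lemma sl2_action_ad:
  assumes "\<alpha> \<in> roots0 T" "e \<in> root_space T 0 \<alpha>" "f \<in> root_space T 0 (- \<alpha>)"
    "br T e f = coroot \<alpha>"
  shows "sl2_action (br T e) (br T f) (br T (coroot \<alpha>))"
proof
  fix v
  have comm: "br T (coroot \<alpha>) e = 2 *\<^sub>C e" "br T (coroot \<alpha>) f = - (2 *\<^sub>C f)"
    using assms coroot_csa coroot_self by (auto simp: root_space_def)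
  show "br T e (br T f v) = br T f (br T e v) + br T (coroot \<alpha>) v"
    by (simp add: br_derivation[of e f] assms)
  show "br T (coroot \<alpha>) (br T e v) = br T e (br T (coroot \<alpha>) v) + 2 *\<^sub>C br T e v"
    "br T (coroot \<alpha>) (br T f v) = br T f (br T (coroot \<alpha>) v) - 2 *\<^sub>C br T f v"
    by (simp_all add: br_derivation[of "coroot \<alpha>"] comm A.scale_left br_minus_left)
qed

text \<open>The string through a root vector of \<beta> contains the reflected weight when the value
  \<open>p\<close> at the coroot is nonnegative; for negative \<open>p\<close> the same argument is
  applied to \<open>- \<alpha>\<close>.\<close>

lemma root_reflection:
  assumes "\<alpha> \<in> roots0 T" "\<beta> \<in> roots0 T"
  shows "\<beta> - \<beta> (coroot \<alpha>) *\<^sub>C \<alpha> \<in> roots0 T"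
proof -
  have *: "(\<exists>p::int. \<beta> (coroot \<alpha>) = of_int p \<and> (p \<ge> 0 \<longrightarrow> \<beta> - of_int p *\<^sub>C \<alpha> \<in> roots0 T))"
    if \<alpha>: "\<alpha> \<in> roots0 T" for \<alpha>
  proof -
    obtain e f where ef: "e \<in> root_space T 0 \<alpha>" "f \<in> root_space T 0 (- \<alpha>)" "br T e f = coroot \<alpha>"
      by (rule sl2_triple[OF \<alpha>])
    interpret S: sl2_action "br T e" "br T f" "br T (coroot \<alpha>)"
      by (rule sl2_action_ad) fact+
    have \<alpha>': "\<alpha> \<in> dual (csa T)" "\<alpha> \<noteq> 0" "- \<alpha> \<in> dual (csa T)" "- \<alpha> \<noteq> 0"
      using \<alpha> root_minus(1) by (auto simp: roots0_def)
    have \<beta>: "\<beta> \<in> dual (csa T)" "\<beta> \<noteq> 0" using assms(2) by (auto simp: roots0_def)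
    obtain u where u: "u \<in> root_space T 0 \<beta>" "u \<noteq> 0"
      using assms(2) cv.subspace_0[OF subspace_root_space, of 0 \<beta>] by (auto simp: roots0_def)
    have raise: "(br T e ^^ n) u \<in> root_space T 0 (\<beta> + of_nat n *\<^sub>C \<alpha>)" for n
      by (rule root_space_br_power) fact+
    have dual: "\<beta> + of_nat n *\<^sub>C \<alpha> \<in> dual (csa T)" for n
      using \<alpha>' \<beta> by (intro cv.subspace_add[OF subspace_dual] cv.subspace_scale[OF subspace_dual])
    obtain n q where nq: "\<beta> (coroot \<alpha>) + 2 * of_nat n = of_nat q"
      "\<And>j. j \<le> q \<Longrightarrow> (br T f ^^ j) ((br T e ^^ n) u) \<noteq> 0"
    proof (rule S.string)
      show "br T (coroot \<alpha>) u = \<beta> (coroot \<alpha>) *\<^sub>C u"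
        using u coroot_csa[OF \<alpha>] by (simp add: root_space_def)
      show "\<exists>N. (br T e ^^ N) u = 0" using ad_nilpotent ef u \<alpha>' \<beta> by blast
      show "\<exists>N. (br T f ^^ N) ((br T e ^^ n) u) = 0" for n
        using ad_nilpotent[OF ef(2) raise \<alpha>'(3) dual \<alpha>'(4)] .
    qed (rule u(2), rule that)
    \<comment> \<open>As \<open>q = p + 2 n\<close>, the exponent \<open>n + p\<close> used below is
      at most \<open>q\<close> and leads from \<open>\<beta> + n \<alpha>\<close> down to
      \<open>\<beta> - p \<alpha>\<close>.\<close>
    define p where "p = int q - 2 * int n"
    have p: "\<beta> (coroot \<alpha>) = of_int p" using nq(1) by (simp add: p_def eq_diff_eq)
    have "\<beta> - of_int p *\<^sub>C \<alpha> \<in> roots0 T" if "p \<ge> 0"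
    proof -
      have "(br T f ^^ (n + nat p)) ((br T e ^^ n) u) \<noteq> 0"
        using that by (intro nq(2)) (simp add: p_def nat_le_iff)
      moreover have "(br T f ^^ (n + nat p)) ((br T e ^^ n) u) \<in>
          root_space T 0 (\<beta> + of_nat n *\<^sub>C \<alpha> + of_nat (n + nat p) *\<^sub>C (- \<alpha>))"
        by (rule root_space_br_power) (fact ef, rule raise)
      moreover have "\<beta> + of_nat n *\<^sub>C \<alpha> + of_nat (n + nat p) *\<^sub>C (- \<alpha>) = \<beta> - of_int p *\<^sub>C \<alpha>"
        using that by (simp add: cv.scale_left_distrib fun_eq_iff)
      ultimately have "root_space T 0 (\<beta> - of_int p *\<^sub>C \<alpha>) \<noteq> {0}" by (metis singletonD)
      moreover have "\<beta> - of_int p *\<^sub>C \<alpha> \<in> dual (csa T)"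
        using \<alpha>' \<beta> by (intro cv.subspace_diff[OF subspace_dual] cv.subspace_scale[OF subspace_dual])
      \<comment> \<open>If \<beta> were \<open>p \<alpha>\<close>, evaluation at the coroot would
        give \<open>p = 2 p\<close>, so \<beta> would be zero.\<close>
      moreover have "\<beta> - of_int p *\<^sub>C \<alpha> \<noteq> 0"
      proof
        assume "\<beta> - of_int p *\<^sub>C \<alpha> = 0"
        then have \<beta>_eq: "\<beta> = of_int p *\<^sub>C \<alpha>" by simp
        then have "\<beta> (coroot \<alpha>) = of_int p * 2"
          by (simp add: scaleC_fun_def scaleC_complex_def coroot_self[OF \<alpha>])
        then have "p = 0" using p by simp
        then show False using \<beta>_eq \<beta>(2) by simp
      qed
      ultimately show ?thesis by (simp add: roots0_def)
    qed
    then show ?thesis using p by blast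
  qed
  obtain p where p: "\<beta> (coroot \<alpha>) = of_int p" "p \<ge> 0 \<longrightarrow> \<beta> - of_int p *\<^sub>C \<alpha> \<in> roots0 T"
    using *[OF assms(1)] by blast
  obtain p' where p': "\<beta> (coroot (- \<alpha>)) = of_int p'"
    "p' \<ge> 0 \<longrightarrow> \<beta> - of_int p' *\<^sub>C (- \<alpha>) \<in> roots0 T"
    using *[OF root_minus(1)[OF assms(1)]] by blast
  have "\<beta> (coroot (- \<alpha>)) = - of_int p"
    using root_minus(2)[OF assms(1)] dual_scale(2)[OF root_dual[OF assms(2)]] coroot_csa[OF assms(1)] p
    by simp
  then have "p' = - p" using p'(1) by (metis of_int_eq_iff of_int_minus)
  then show ?thesis using p p'(2) by (cases "p \<ge> 0") auto
qed

text \<open>The reflected root \<gamma> has the same squared length as \<beta>, so its coroot is the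
  reflected coroot. Evaluating a weight there amounts to reflecting the weight.\<close>

lemma coroot_reflection:
  assumes "\<alpha> \<in> roots0 T" "\<beta> \<in> roots0 T" "\<mu> \<in> dual (csa T)"
  shows "\<mu> (coroot (\<beta> - \<beta> (coroot \<alpha>) *\<^sub>C \<alpha>)) = (\<mu> - \<mu> (coroot \<alpha>) *\<^sub>C \<alpha>) (coroot \<beta>)"
proof -
  define A B g c where "A = \<alpha> (dv \<alpha>)" and "B = \<beta> (dv \<beta>)" and "g = \<alpha> (dv \<beta>)"
    and "c = \<beta> (coroot \<alpha>)"
  note rep = assms(1,2)[THEN roots_representable]
  note d = assms(1,2)[THEN root_dual]
  have nz: "A \<noteq> 0" "B \<noteq> 0" using assms root_nonisotropic by (auto simp: A_def B_def)
  have g: "\<beta> (dv \<alpha>) = g" using dual_vector_swap rep by (simp add: g_def)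
  have c: "c = 2 * g / A" using dual_coroot[OF assms(1) d(2)] by (simp add: c_def A_def g)
  define \<gamma> where "\<gamma> = \<beta> - c *\<^sub>C \<alpha>"
  have \<gamma>: "\<gamma> \<in> roots0 T" using root_reflection assms by (simp add: \<gamma>_def c_def)
  have dv_\<gamma>: "dv \<gamma> = dv \<beta> - c *\<^sub>C dv \<alpha>" unfolding \<gamma>_def by (rule dual_vector_reflect) fact+
  have ev: "\<nu> (dv \<gamma>) = \<nu> (dv \<beta>) - c * \<nu> (dv \<alpha>)" if "\<nu> \<in> dual (csa T)" for \<nu>
    unfolding dv_\<gamma>
    using dual_csa(4)[OF that] dual_scale[OF that] dual_vector(1) rep csa_subspace
    by (simp add: cv.subspace_scale)
  have "\<gamma> (dv \<gamma>) = \<gamma> (dv \<beta>) - c * \<gamma> (dv \<alpha>)" by (rule ev) (rule root_dual[OF \<gamma>])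
  also have "\<dots> = B"
    using nz by (simp add: \<gamma>_def scaleC_fun_def scaleC_complex_def g c flip: A_def B_def g_def)
  finally have \<gamma>_B: "\<gamma> (dv \<gamma>) = B" .
  have "\<mu> (coroot \<gamma>) = 2 / B * (\<mu> (dv \<beta>) - c * \<mu> (dv \<alpha>))"
    using dual_coroot[OF \<gamma> assms(3)] \<gamma>_B ev[OF assms(3)] by simp
  also have "\<dots> = \<mu> (coroot \<beta>) - \<mu> (coroot \<alpha>) * \<alpha> (coroot \<beta>)"
    unfolding dual_coroot[OF assms(2,3)] dual_coroot[OF assms(1,3)] dual_coroot[OF assms(2) d(1)]
    using nz by (simp add: c flip: A_def B_def g_def) (simp add: field_simps)
  finally show ?thesis by (simp add: \<gamma>_def c_def scaleC_fun_def scaleC_complex_def)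
qed

section \<open>A reflection-invariant norm on weights\<close>

definition weight_norm :: "('g \<Rightarrow> complex) \<Rightarrow> real" where
  "weight_norm \<mu> = (\<Sum>\<beta>\<in>roots0 T. (Re (\<mu> (coroot \<beta>)))\<^sup>2)"

text \<open>Reflecting \<mu> permutes the summands. Summing squares of real parts over all roots
  gives a nonnegative invariant without a positive normalisation of the complex form.\<close>

lemma weight_norm_reflection:
  assumes "\<alpha> \<in> roots0 T" "\<mu> \<in> dual (csa T)"
  shows "weight_norm (\<mu> - \<mu> (coroot \<alpha>) *\<^sub>C \<alpha>) = weight_norm \<mu>"
proof -
  define s where "s \<beta> = \<beta> - \<beta> (coroot \<alpha>) *\<^sub>C \<alpha>" for \<beta>
  have ss: "s (s \<beta>) = \<beta>" for \<beta>
    by (auto simp: s_def fun_eq_iff scaleC_fun_def scaleC_complex_def coroot_self[OF assms(1)]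
      algebra_simps)
  have s: "s \<beta> \<in> roots0 T" if "\<beta> \<in> roots0 T" for \<beta>
    using root_reflection[OF assms(1) that] by (simp add: s_def)
  have "bij_betw s (roots0 T) (roots0 T)"
    by (rule bij_betw_byWitness[where f' = s]) (auto simp: ss s)
  then have "weight_norm \<mu> = (\<Sum>\<beta>\<in>roots0 T. (Re (\<mu> (coroot (s \<beta>))))\<^sup>2)"
    unfolding weight_norm_def by (rule sum.reindex_bij_betw[symmetric])
  also have "\<dots> = weight_norm (\<mu> - \<mu> (coroot \<alpha>) *\<^sub>C \<alpha>)"
    unfolding weight_norm_def s_def using coroot_reflection[OF assms(1) _ assms(2)]
    by (intro sum.cong) auto
  finally show ?thesis by simp
qed

text \<open>Along \<open>\<mu> - c \<alpha>\<close> the norm is a quadratic polynomial in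
  \<open>c\<close> with leading coefficient \<open>A > 0\<close>. It agrees at 0 and at the
  reflected point \<open>c = p\<close>, so convexity makes it smaller at \<open>c = 1\<close>,
  strictly between them.\<close>

lemma weight_norm_decreases:
  assumes "\<alpha> \<in> roots0 T" "\<mu> \<in> dual (csa T)" "\<mu> (coroot \<alpha>) = of_nat p" "p \<ge> 2"
  shows "weight_norm (\<mu> - \<alpha>) < weight_norm \<mu>"
proof -
  define a u where "a \<beta> = Re (\<alpha> (coroot \<beta>))" and "u \<beta> = Re (\<mu> (coroot \<beta>))" for \<beta>
  define A U where "A = (\<Sum>\<beta>\<in>roots0 T. (a \<beta>)\<^sup>2)" and "U = (\<Sum>\<beta>\<in>roots0 T. u \<beta> * a \<beta>)"
  have expand: "weight_norm (\<mu> - of_nat c *\<^sub>C \<alpha>) = weight_norm \<mu> - 2 * real c * U + (real c)\<^sup>2 * A" for c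
    by (simp add: weight_norm_def A_def U_def sum_distrib_left flip: sum_subtractf sum.distrib)
      (auto intro!: sum.cong simp: a_def u_def scaleC_fun_def scaleC_complex_def power2_eq_square
        algebra_simps)
  have "weight_norm (\<mu> - of_nat p *\<^sub>C \<alpha>) = weight_norm \<mu>"
    using weight_norm_reflection[OF assms(1,2)] assms(3) by simp
  then have "real p * (real p * A) = real p * (2 * U)"
    using expand[of p] by (simp add: power2_eq_square algebra_simps)
  then have "2 * U = real p * A" using assms(4) by simp
  moreover have "A > 0"
  proof -
    have "(a \<alpha>)\<^sup>2 \<le> A"
      unfolding A_def using roots_finite assms(1) by (intro member_le_sum) auto
    then show ?thesis using coroot_self[OF assms(1)] by (simp add: a_def)
  qed
  moreover have "2 * A \<le> real p * A" using assms(4) \<open>A > 0\<close> by simp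
  ultimately show ?thesis using expand[of 1] by simp
qed

text \<open>By the symmetry of the form, every root vanishes at the vector representing \<eta>,
  which is therefore zero by \<open>csa_faithful\<close>.\<close>

lemma coroots_separate:
  assumes "\<eta> \<in> representable" "\<And>\<alpha>. \<alpha> \<in> roots0 T \<Longrightarrow> \<eta> (coroot \<alpha>) = 0"
  shows "\<eta> = 0"
proof -
  have "\<beta> (dv \<eta>) = 0" if \<beta>: "\<beta> \<in> dual (csa T)" "root_space T 0 \<beta> \<noteq> {0}" for \<beta>
  proof (cases "\<beta> = 0")
    case False
    then have "\<beta> \<in> roots0 T" using \<beta> by (simp add: roots0_def)
    then have "\<eta> (dv \<beta>) = 0"
      using assms(2) dual_coroot[OF _ representable_dual[OF assms(1)]] root_nonisotropic by force
    then show ?thesis using dual_vector_swap roots_representable assms(1) \<open>\<beta> \<in> roots0 T\<close> by metis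
  qed simp
  then have "dv \<eta> = 0" using csa_faithful dual_vector assms(1) by blast
  then have "\<eta> h = 0" if "h \<in> csa T" for h
    using that dual_vector(2)[OF assms(1)] by (metis form_zero(1))
  then show ?thesis
    using dual_eqI[OF representable_dual[OF assms(1)] cv.subspace_0[OF subspace_dual]] by simp
qed

text \<open>Two weights of one coset differ by a representable functional, so their values at the
  coroots distinguish them. There are finitely many roots and finitely many values in
  \<open>I\<close>.\<close>

lemma finite_bounded_weights:
  assumes "finite I"
  shows "finite {a. a - a\<^sub>0 \<in> representable \<and> (\<forall>\<alpha>\<in>roots0 T. a (coroot \<alpha>) \<in> I)}" (is "finite ?A")
proof (rule finite_imageD)
  let ?f = "\<lambda>a. restrict (\<lambda>\<alpha>. a (coroot \<alpha>)) (roots0 T)"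
  have "?f ` ?A \<subseteq> (\<Pi>\<^sub>E \<alpha>\<in>roots0 T. I)" by auto
  then show "finite (?f ` ?A)"
    using finite_PiE[OF roots_finite, of "\<lambda>_. I"] assms finite_subset by blast
  show "inj_on ?f ?A"
  proof (rule inj_onI)
    fix a b assume a: "a \<in> ?A" and b: "b \<in> ?A" and eq: "?f a = ?f b"
    have "a - b = (a - a\<^sub>0) - (b - a\<^sub>0)" by simp
    then have "a - b \<in> representable"
      using a b cv.subspace_diff[OF subspace_representable] by (metis (mono_tags, lifting) mem_Collect_eq)
    moreover have "(a - b) (coroot \<alpha>) = 0" if "\<alpha> \<in> roots0 T" for \<alpha>
      using fun_cong[OF eq, of \<alpha>] that by simp
    ultimately have "a - b = 0" by (rule coroots_separate)
    then show "a = b" by simp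
  qed
qed

end

section \<open>Weights of integrable modules of level zero\<close>

lemma monomial_add: "monomial (x + y) k = monomial x k + monomial y k"
  and monomial_scale: "monomial (c *\<^sub>C x) k = c *\<^sub>C monomial x k"
  by (simp_all add: monomial_def single_add scaleC_prod_def)
    (auto intro!: poly_mapping_eqI simp: lookup_scaleC lookup_single when_def)

lemma central_add: "central (x + y) = central x + central y"
  and central_scale: "central (c *\<^sub>C x) = c *\<^sub>C central x"
  and central_zero: "central 0 = 0"
  by (simp_all add: central_def scaleC_prod_def zero_prod_def)

lemma derivation_add: "derivation (x + y) = derivation x + derivation y"
  and derivation_scale: "derivation (c *\<^sub>C x) = c *\<^sub>C derivation x"
  by (simp_all add: derivation_def scaleC_prod_def)

lemma pairing_add: "pairing (d + e) k = pairing d k + pairing e k"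
  "pairing d (k + l) = pairing d k + pairing d l"
  and pairing_scale: "pairing (c *\<^sub>C d) k = c * pairing d k"
  and pairing_zero: "pairing d 0 = 0"
  by (simp_all add: pairing_def scaleC_vec_def scaleC_complex_def distrib_left distrib_right
    sum.distrib sum_distrib_left mult.assoc)

locale level_zero_module = lie_torus T + M: lie_module "glt_bracket T" "glt_carrier T" \<rho> UNIV
  for T :: "('g::complex_vector, 'n::finite) torus_data"
    and \<rho> :: "('g, 'n) glt \<Rightarrow> 'v::complex_vector \<Rightarrow> 'v" +
  assumes integrable: "integrable T \<rho>"
    and level_zero: "\<rho> (central (K i)) v = 0"
begin

section \<open>The action of homogeneous elements\<close>

definition act :: "'g \<Rightarrow> int ^ 'n \<Rightarrow> 'v \<Rightarrow> 'v" where
  "act x k = \<rho> (monomial x k)"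

lemma monomial_carrier: "x \<in> grade T k \<Longrightarrow> monomial x k \<in> glt_carrier T"
  using cv.subspace_0[OF subspace_grade]
  by (auto simp: monomial_def glt_carrier_def LT_def lookup_single when_def central_symbols_def
    cv.span_zero)

lemma derivation_carrier: "derivation d \<in> glt_carrier T"
  using cv.subspace_0[OF subspace_grade]
  by (auto simp: derivation_def glt_carrier_def LT_def central_symbols_def cv.span_zero)

lemma central_carrier: "z \<in> central_symbols T \<Longrightarrow> central z \<in> glt_carrier T"
  using cv.subspace_0[OF subspace_grade]
  by (auto simp: central_def glt_carrier_def LT_def)

lemma carrier_add: "\<lbrakk>x \<in> glt_carrier T; y \<in> glt_carrier T\<rbrakk> \<Longrightarrow> x + y \<in> glt_carrier T"
  using cv.subspace_add[OF subspace_grade] cv.span_add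
  by (fastforce simp: glt_carrier_def LT_def central_symbols_def lookup_add)

lemma zero_Gamma: "0 \<in> Gamma T"
  by (simp add: Gamma_def)

lemma monomial_cartan: "h \<in> csa T \<Longrightarrow> monomial h 0 \<in> glt_cartan T"
  unfolding glt_cartan_def
  by (intro CollectI exI[of _ h] exI[of _ "\<lambda>_. 0"] exI[of _ 0])
    (simp add: central_def derivation_def flip: zero_prod_def)

lemma derivation_cartan: "derivation d \<in> glt_cartan T"
  unfolding glt_cartan_def using cv.subspace_0[OF csa_subspace]
  by (intro CollectI exI[of _ 0] exI[of _ "\<lambda>_. 0"] exI[of _ d])
    (simp add: central_def monomial_def flip: zero_prod_def)

lemma linear_rho:
  assumes "y \<in> glt_carrier T"
  shows "Vector_Spaces.linear scaleC scaleC (\<rho> y)"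
  by unfold_locales (simp_all add: M.add_right M.scale_right assms)

lemma linear_act: "x \<in> grade T k \<Longrightarrow> Vector_Spaces.linear scaleC scaleC (act x k)"
  unfolding act_def by (intro linear_rho monomial_carrier)

lemma rho_zero: "\<rho> 0 v = 0"
  using M.scale_left[of "derivation 0" v 0] derivation_carrier by simp

lemma K_symbols: "(\<Sum>i\<in>I. c i *\<^sub>C K i) \<in> central_symbols T"
  unfolding central_symbols_def using zero_Gamma
  by (intro cv.span_sum cv.span_scale cv.span_base) auto

lemma rho_central: "finite I \<Longrightarrow> \<rho> (central (\<Sum>i\<in>I. c i *\<^sub>C K i)) v = 0"
proof (induction I rule: finite_induct)
  case empty
  then show ?case by (simp add: central_zero rho_zero)
next
  case (insert i I)
  have "central (c i *\<^sub>C K i) \<in> glt_carrier T" "central (K i) \<in> glt_carrier T"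
    using K_symbols[of c "{i}"] K_symbols[of "\<lambda>_. 1" "{i}"] central_carrier by auto
  then show ?case
    using insert central_carrier[OF K_symbols[of c I]]
    by (simp add: central_add M.add_left central_scale M.scale_left level_zero)
qed

lemma act_add: "\<lbrakk>x \<in> grade T k; y \<in> grade T k\<rbrakk> \<Longrightarrow> act (x + y) k v = act x k v + act y k v"
  by (simp add: act_def monomial_add M.add_left monomial_carrier)

lemma act_scale: "x \<in> grade T k \<Longrightarrow> act (c *\<^sub>C x) k v = c *\<^sub>C act x k v"
  by (simp add: act_def monomial_scale M.scale_left monomial_carrier)

lemma act_zero: "act 0 k v = 0"
  using act_scale[of 0 k 0 v] cv.subspace_0[OF subspace_grade] by simp

lemma act_sum:
  assumes "\<And>i. i \<in> I \<Longrightarrow> f i \<in> grade T k"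
  shows "act (\<Sum>i\<in>I. f i) k v = (\<Sum>i\<in>I. act (f i) k v)"
  using assms
proof (induction I rule: infinite_finite_induct)
  case (insert i I)
  then show ?case by (simp add: act_add cv.subspace_sum[OF subspace_grade])
qed (auto simp: act_zero)

text \<open>The condition on the degrees controls the cocycle: it vanishes for \<open>k = 0\<close>,
  and for \<open>k + l = 0\<close> it is a combination of the \<open>K i\<close>, which act by zero.
  In other degrees it could involve symbols about which nothing is assumed.\<close>

lemma act_commutator:
  assumes "x \<in> grade T k" "y \<in> grade T l" "k = 0 \<or> k + l = 0"
  shows "act x k (act y l v) = act (br T x y) (k + l) v + act y l (act x k v)"
proof -
  define z :: "'n symbols" where
    "z = form T x y *\<^sub>C (\<Sum>i\<in>UNIV. of_int (k $ i) *\<^sub>C symbol (k + l) i)"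
  have "\<exists>c. z = (\<Sum>i\<in>UNIV. c i *\<^sub>C K i)"
  proof (cases "k = 0")
    case True
    then show ?thesis by (intro exI[of _ "\<lambda>_. 0"]) (simp add: z_def)
  next
    case False
    then have "k + l = 0" using assms(3) by simp
    then show ?thesis
      by (intro exI[of _ "\<lambda>i. form T x y * of_int (k $ i)"])
        (simp add: z_def cv.scale_sum_right)
  qed
  then have z: "\<rho> (central z) v = 0" "central z \<in> glt_carrier T"
    using rho_central K_symbols central_carrier by auto
  have "\<rho> (glt_bracket T (monomial x k) (monomial y l)) v = act (br T x y) (k + l) v"
    unfolding glt_bracket_monomial[OF A.lie_algebra_axioms B.invariant_form_axioms]
    using z grade_br[OF assms(1,2)]
    by (simp add: M.add_left monomial_carrier act_def flip: z_def)
  then show ?thesis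
    using M.bracket[of "monomial x k" "monomial y l" v] assms(1,2) monomial_carrier
    by (simp add: act_def algebra_simps)
qed

lemma derivation_act:
  assumes "x \<in> grade T k"
  shows "\<rho> (derivation d) (act x k v) = pairing d k *\<^sub>C act x k v + act x k (\<rho> (derivation d) v)"
  using M.bracket[of "derivation d" "monomial x k" v] assms monomial_carrier derivation_carrier
  by (simp add: act_def glt_bracket_derivation_monomial monomial_scale M.scale_left algebra_simps)

lemma act_nilpotent:
  assumes "\<alpha> \<in> dual (csa T)" "\<alpha> \<noteq> 0" "x \<in> root_space T k \<alpha>"
  shows "\<exists>N. (act x k ^^ N) v = 0"
  using integrable assms unfolding integrable_def act_def by blast

text \<open>A weight is split into its restriction \<open>a\<close> to \<open>csa T\<close> and its
  values on derivations, written as a fixed base \<open>b\<close> shifted by the degree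
  \<open>k\<close>. The \<open>K i\<close> impose no condition because they act by zero.\<close>

definition wt ::
  "(complex ^ 'n \<Rightarrow> complex) \<Rightarrow> ('g \<Rightarrow> complex) \<Rightarrow> int ^ 'n \<Rightarrow> 'v set" where
  "wt b a k = {v. (\<forall>h\<in>csa T. act h 0 v = a h *\<^sub>C v) \<and>
                  (\<forall>d. \<rho> (derivation d) v = (b d + pairing d k) *\<^sub>C v)}"

lemma subspace_wt: "cv.subspace (wt b a k)"
proof -
  have "act h 0 0 = 0" "act h 0 (v + w) = act h 0 v + act h 0 w" "act h 0 (c *\<^sub>C v) = c *\<^sub>C act h 0 v"
    if "h \<in> csa T" for h c v w
  proof -
    interpret L: Vector_Spaces.linear scaleC scaleC "act h 0"
      using linear_act[of h 0] that csa_grade by blast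
    show "act h 0 0 = 0" "act h 0 (v + w) = act h 0 v + act h 0 w" "act h 0 (c *\<^sub>C v) = c *\<^sub>C act h 0 v"
      by (rule L.zero, rule L.add, rule L.scale)
  qed
  moreover have "\<rho> (derivation d) 0 = 0" for d
    using M.scale_right[of "derivation d" 0 0] derivation_carrier by simp
  ultimately show ?thesis
    using derivation_carrier
    by (auto simp: wt_def cv.subspace_def M.add_right M.scale_right cv.scale_right_distrib
      mult.commute)
qed

lemma act_wt:
  assumes "x \<in> root_space T l \<alpha>" "v \<in> wt b a k"
  shows "act x l v \<in> wt b (a + \<alpha>) (k + l)"
proof -
  have x: "x \<in> grade T l" using assms by (simp add: root_space_def)
  interpret L: Vector_Spaces.linear scaleC scaleC "act x l" by (rule linear_act[OF x])
  have "act h 0 (act x l v) = (a + \<alpha>) h *\<^sub>C act x l v" if h: "h \<in> csa T" for h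
  proof -
    have "br T h x = \<alpha> h *\<^sub>C x" "act h 0 v = a h *\<^sub>C v"
      using assms h by (auto simp: root_space_def wt_def)
    then show ?thesis
      using act_commutator[of h 0 x l v] h x csa_grade
      by (simp add: subset_iff act_scale L.scale cv.scale_left_distrib)
  qed
  moreover have "\<rho> (derivation d) (act x l v) = (b d + pairing d (k + l)) *\<^sub>C act x l v" for d
  proof -
    have "\<rho> (derivation d) v = (b d + pairing d k) *\<^sub>C v" using assms by (auto simp: wt_def)
    then show ?thesis
      by (simp add: derivation_act[OF x] L.scale L.add cv.scale_left_distrib pairing_add)
  qed
  ultimately show ?thesis by (simp add: wt_def)
qed

lemma act_wt_power:
  assumes "x \<in> root_space T l \<alpha>" "v \<in> wt b a k"
  shows "(act x l ^^ j) v \<in> wt b (a + of_nat j *\<^sub>C \<alpha>) (k + int j *s l)"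
proof (induction j)
  case 0
  have "k + int 0 *s l = k" by (simp add: vec_eq_iff)
  then show ?case using assms by simp
next
  case (Suc j)
  have "act x l ((act x l ^^ j) v) \<in> wt b ((a + of_nat j *\<^sub>C \<alpha>) + \<alpha>) ((k + int j *s l) + l)"
    by (rule act_wt) (fact assms, fact Suc)
  moreover have "(a + of_nat j *\<^sub>C \<alpha>) + \<alpha> = a + of_nat (Suc j) *\<^sub>C \<alpha>"
    by (simp add: cv.scale_left_distrib fun_eq_iff)
  moreover have "(k + int j *s l) + l = k + int (Suc j) *s l"
    by (simp add: vec_eq_iff algebra_simps)
  ultimately have "act x l ((act x l ^^ j) v) \<in> wt b (a + of_nat (Suc j) *\<^sub>C \<alpha>) (k + int (Suc j) *s l)"
    by metis
  then show ?case by (simp only: funpow.simps comp_apply)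
qed

section \<open>Strings and translations of weights\<close>

lemma Gamma_minus: "l \<in> Gamma T \<Longrightarrow> - l \<in> Gamma T"
  by (simp add: Gamma_def)

lemma root_space_Gamma: "l \<in> Gamma T \<Longrightarrow> root_space T l \<alpha> = root_space T 0 \<alpha>"
  using grade_Gamma[of l 0] by (simp add: root_space_def)

lemma sl2_action_act:
  assumes \<alpha>: "\<alpha> \<in> roots0 T" and ef: "e \<in> root_space T 0 \<alpha>" "f \<in> root_space T 0 (- \<alpha>)"
    "br T e f = coroot \<alpha>" and l: "l \<in> Gamma T"
  shows "sl2_action (act e l) (act f (- l)) (act (coroot \<alpha>) 0)"
proof -
  have h: "coroot \<alpha> \<in> csa T" by (rule coroot_csa[OF \<alpha>])
  have "e \<in> root_space T l \<alpha>" "f \<in> root_space T (- l) (- \<alpha>)"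
    using ef root_space_Gamma l Gamma_minus by auto
  then have gr: "e \<in> grade T l" "f \<in> grade T (- l)" "coroot \<alpha> \<in> grade T 0"
    using csa_grade h by (auto simp: root_space_def)
  have comm: "br T (coroot \<alpha>) e = 2 *\<^sub>C e" "br T (coroot \<alpha>) f = - 2 *\<^sub>C f"
    using ef h coroot_self[OF \<alpha>] by (auto simp: root_space_def)
  interpret E: Vector_Spaces.linear scaleC scaleC "act e l" by (rule linear_act) fact
  interpret F: Vector_Spaces.linear scaleC scaleC "act f (- l)" by (rule linear_act) fact
  interpret H: Vector_Spaces.linear scaleC scaleC "act (coroot \<alpha>) 0" by (rule linear_act) fact
  show ?thesis
  proof
    fix v
    show "act e l (act f (- l) v) = act f (- l) (act e l v) + act (coroot \<alpha>) 0 v"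
      using act_commutator[OF gr(1,2)] by (simp add: ef add.commute)
    show "act (coroot \<alpha>) 0 (act e l v) = act e l (act (coroot \<alpha>) 0 v) + 2 *\<^sub>C act e l v"
      using act_commutator[OF gr(3,1)] by (simp add: comm act_scale gr add.commute)
    have "act (coroot \<alpha>) 0 (act f (- l) v) = act (- 2 *\<^sub>C f) (- l) v + act f (- l) (act (coroot \<alpha>) 0 v)"
      using act_commutator[OF gr(3,2)] unfolding comm by simp
    also have "act (- 2 *\<^sub>C f) (- l) v = - 2 *\<^sub>C act f (- l) v" by (rule act_scale) fact
    finally show "act (coroot \<alpha>) 0 (act f (- l) v) = act f (- l) (act (coroot \<alpha>) 0 v) - 2 *\<^sub>C act f (- l) v"
      by simp
  qed
qed

text \<open>Each \<open>l\<close> in \<open>Gamma T\<close> has its own copy of sl2, but all copies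
  share the coroot. Hence one integer \<open>p\<close> serves every \<open>l\<close>, while each
  downward step along the copy of \<open>l\<close> lowers the degree by \<open>l\<close>.\<close>

lemma wt_string:
  assumes \<alpha>: "\<alpha> \<in> roots0 T" and v: "wt b a k \<noteq> {0}"
  obtains p :: int where "a (coroot \<alpha>) = of_int p"
    "\<And>i l. \<lbrakk>int i \<le> p; l \<in> Gamma T\<rbrakk> \<Longrightarrow> wt b (a - of_nat i *\<^sub>C \<alpha>) (k - int i *s l) \<noteq> {0}"
proof -
  obtain v where v: "v \<in> wt b a k" "v \<noteq> 0"
    using v cv.subspace_0[OF subspace_wt, of b a k] by auto
  obtain e f where ef: "e \<in> root_space T 0 \<alpha>" "f \<in> root_space T 0 (- \<alpha>)" "br T e f = coroot \<alpha>"
    by (rule sl2_triple[OF \<alpha>])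
  have \<alpha>': "\<alpha> \<in> dual (csa T)" "\<alpha> \<noteq> 0" "- \<alpha> \<in> dual (csa T)" "- \<alpha> \<noteq> 0"
    using \<alpha> root_minus(1)[OF \<alpha>] by (auto simp: roots0_def)
  have *: "\<exists>p::int. a (coroot \<alpha>) = of_int p \<and>
      (\<forall>i. int i \<le> p \<longrightarrow> wt b (a - of_nat i *\<^sub>C \<alpha>) (k - int i *s l) \<noteq> {0})"
    if l: "l \<in> Gamma T" for l
  proof -
    interpret S: sl2_action "act e l" "act f (- l)" "act (coroot \<alpha>) 0"
      by (rule sl2_action_act) fact+
    have ef': "e \<in> root_space T l \<alpha>" "f \<in> root_space T (- l) (- \<alpha>)"
      using ef root_space_Gamma l Gamma_minus by auto
    obtain n q where nq: "a (coroot \<alpha>) + 2 * of_nat n = of_nat q"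
      "\<And>j. j \<le> q \<Longrightarrow> (act f (- l) ^^ j) ((act e l ^^ n) v) \<noteq> 0"
    proof (rule S.string)
      show "act (coroot \<alpha>) 0 v = a (coroot \<alpha>) *\<^sub>C v"
        using v coroot_csa[OF \<alpha>] by (simp add: wt_def)
      show "\<exists>N. (act e l ^^ N) v = 0" using act_nilpotent \<alpha>' ef' by blast
      show "\<exists>N. (act f (- l) ^^ N) ((act e l ^^ n) v) = 0" for n
        using act_nilpotent \<alpha>' ef' by blast
    qed (rule v(2), rule that)
    define p where "p = int q - 2 * int n"
    have p: "a (coroot \<alpha>) = of_int p" using nq(1) by (simp add: p_def eq_diff_eq)
    have "wt b (a - of_nat i *\<^sub>C \<alpha>) (k - int i *s l) \<noteq> {0}" if i: "int i \<le> p" for i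
    proof -
      define w where "w = (act f (- l) ^^ (n + i)) ((act e l ^^ n) v)"
      have "w \<noteq> 0" unfolding w_def using i by (intro nq(2)) (simp add: p_def)
      have "w \<in> wt b (a + of_nat n *\<^sub>C \<alpha> + of_nat (n + i) *\<^sub>C (- \<alpha>))
          (k + int n *s l + int (n + i) *s (- l))"
        unfolding w_def using act_wt_power ef' v(1) by blast
      moreover have "a + of_nat n *\<^sub>C \<alpha> + of_nat (n + i) *\<^sub>C (- \<alpha>) = a - of_nat i *\<^sub>C \<alpha>"
        by (simp add: cv.scale_left_distrib fun_eq_iff)
      moreover have "k + int n *s l + int (n + i) *s (- l) = k - int i *s l"
        by (simp add: vec_eq_iff algebra_simps)
      ultimately have "w \<in> wt b (a - of_nat i *\<^sub>C \<alpha>) (k - int i *s l)" by metis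
      then show ?thesis using \<open>w \<noteq> 0\<close> by (metis singletonD)
    qed
    then show ?thesis using p by blast
  qed
  obtain p :: int where p: "a (coroot \<alpha>) = of_int p" using *[OF zero_Gamma] by blast
  show thesis
  proof (rule that[OF p])
    fix i l assume "int i \<le> p" "l \<in> Gamma T"
    then show "wt b (a - of_nat i *\<^sub>C \<alpha>) (k - int i *s l) \<noteq> {0}"
      using *[OF \<open>l \<in> Gamma T\<close>] p by auto
  qed
qed

lemma wt_integral: "\<lbrakk>\<alpha> \<in> roots0 T; wt b a k \<noteq> {0}\<rbrakk> \<Longrightarrow> a (coroot \<alpha>) \<in> \<int>"
  by (metis wt_string Ints_of_int)

text \<open>For \<open>p \<ge> 0\<close>, reflect \<open>a\<close> to \<open>a - p \<alpha>\<close>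
  inside degree \<open>k\<close> with the copy for 0, then reflect back with a copy for a
  non-trivial degree. The restriction returns to \<open>a\<close>, the degree has moved by
  \<open>p l\<close>. Negative \<open>p\<close> is handled by \<open>- \<alpha>\<close>.\<close>

lemma wt_translate:
  assumes "\<alpha> \<in> roots0 T" "wt b a k \<noteq> {0}" "a \<in> dual (csa T)" "a (coroot \<alpha>) = of_int p"
    and "l \<in> Gamma T"
  shows "wt b a (k + p *s l) \<noteq> {0}"
proof -
  have nonneg: "wt b a (k + p *s l) \<noteq> {0}"
    if \<alpha>: "\<alpha> \<in> roots0 T" and p: "a (coroot \<alpha>) = of_int p" "p \<ge> 0" and l: "l \<in> Gamma T" for \<alpha> p l
  proof -
    define a' where "a' = a - of_nat (nat p) *\<^sub>C \<alpha>"
    obtain q where "a (coroot \<alpha>) = of_int q"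
      "\<And>i l. \<lbrakk>int i \<le> q; l \<in> Gamma T\<rbrakk> \<Longrightarrow> wt b (a - of_nat i *\<^sub>C \<alpha>) (k - int i *s l) \<noteq> {0}"
      using wt_string[OF \<alpha> assms(2)] by metis
    moreover from this have "int (nat p) \<le> q" using p by simp
    ultimately have "wt b a' (k - int (nat p) *s 0) \<noteq> {0}"
      using zero_Gamma unfolding a'_def by blast
    moreover have "k - int (nat p) *s 0 = k" by (simp add: vec_eq_iff)
    ultimately have a': "wt b a' k \<noteq> {0}" by simp
    obtain q where q: "a' (coroot (- \<alpha>)) = of_int q"
      "\<And>i l. \<lbrakk>int i \<le> q; l \<in> Gamma T\<rbrakk> \<Longrightarrow> wt b (a' - of_nat i *\<^sub>C (- \<alpha>)) (k - int i *s l) \<noteq> {0}"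
      using wt_string[OF root_minus(1)[OF \<alpha>] a'] by metis
    have "a' (coroot (- \<alpha>)) = - a' (coroot \<alpha>)"
    proof -
      have "a' \<in> dual (csa T)"
        unfolding a'_def using assms(3) root_dual[OF \<alpha>]
        by (intro cv.subspace_diff[OF subspace_dual] cv.subspace_scale[OF subspace_dual])
      then show ?thesis using root_minus(2)[OF \<alpha>] dual_scale(2) coroot_csa[OF \<alpha>] by simp
    qed
    also have "\<dots> = of_int p"
      using p coroot_self[OF \<alpha>] by (simp add: a'_def scaleC_fun_def scaleC_complex_def)
    finally have "q = p" using q(1) by simp
    then have "wt b (a' - of_nat (nat p) *\<^sub>C (- \<alpha>)) (k - int (nat p) *s (- l)) \<noteq> {0}"
      using p Gamma_minus[OF l] by (intro q(2)) auto
    moreover have "a' - of_nat (nat p) *\<^sub>C (- \<alpha>) = a" by (simp add: a'_def)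
    moreover have "k - int (nat p) *s (- l) = k + p *s l" using p by (simp add: vec_eq_iff)
    ultimately show ?thesis by (simp only: not_False_eq_True)
  qed
  show ?thesis
  proof (cases "p \<ge> 0")
    case True
    then show ?thesis using nonneg assms by blast
  next
    case False
    have "a (coroot (- \<alpha>)) = of_int (- p)"
      using root_minus(2)[OF assms(1)] dual_scale(2)[OF assms(3)] coroot_csa[OF assms(1)] assms(4)
      by simp
    then have "wt b a (k + (- p) *s (- l)) \<noteq> {0}"
      using False nonneg[OF root_minus(1)[OF assms(1)]] Gamma_minus[OF assms(5)] by simp
    moreover have "k + (- p) *s (- l) = k + p *s l" by (simp add: vec_eq_iff)
    ultimately show ?thesis by simp
  qed
qed

text \<open>Translating by \<open>p l\<close> at \<open>a\<close> and by \<open>(2 - p) l\<close> at \<open>a - \<alpha>\<close> shows that, one root below a weight,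
  the degrees are periodic with a period that does not depend on \<open>p\<close>.\<close>

lemma wt_periodic:
  assumes "\<alpha> \<in> roots0 T" "wt b a k \<noteq> {0}" "a \<in> dual (csa T)" "a (coroot \<alpha>) = of_int p" "p > 0"
    and "l \<in> Gamma T"
  shows "wt b (a - \<alpha>) (k + 2 *s l) \<noteq> {0}"
proof -
  have "wt b a (k + p *s l) \<noteq> {0}" by (rule wt_translate[OF assms(1-4,6)])
  then obtain q where q: "a (coroot \<alpha>) = of_int q"
    "\<And>i l'. \<lbrakk>int i \<le> q; l' \<in> Gamma T\<rbrakk> \<Longrightarrow>
      wt b (a - of_nat i *\<^sub>C \<alpha>) (k + p *s l - int i *s l') \<noteq> {0}"
    by (rule wt_string[OF assms(1)]) (rule that)
  have "q = p" using q(1) assms(4) by simp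
  \<comment> \<open>A single step down with the copy for degree 0, possible because
    \<open>p \<ge> 1\<close>; it leaves the degree alone.\<close>
  then have "wt b (a - of_nat 1 *\<^sub>C \<alpha>) (k + p *s l - int 1 *s 0) \<noteq> {0}"
    using assms(5) zero_Gamma by (intro q(2)) auto
  moreover have "k + p *s l - int 1 *s 0 = k + p *s l" by (simp add: vec_eq_iff)
  ultimately have "wt b (a - \<alpha>) (k + p *s l) \<noteq> {0}" by simp
  moreover have "a - \<alpha> \<in> dual (csa T)"
    using assms(3) root_dual[OF assms(1)] by (rule cv.subspace_diff[OF subspace_dual])
  moreover have "(a - \<alpha>) (coroot \<alpha>) = of_int (p - 2)" using assms coroot_self by simp
  ultimately have "wt b (a - \<alpha>) (k + p *s l + (p - 2) *s (- l)) \<noteq> {0}"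
    using wt_translate[OF assms(1)] Gamma_minus[OF assms(6)] by blast
  moreover have "k + p *s l + (p - 2) *s (- l) = k + 2 *s l"
    by (simp add: vec_eq_iff algebra_simps)
  ultimately show ?thesis by simp
qed

text \<open>The space is a weight space in the sense of \<open>integrable\<close>: \<mu> below sums
  \<open>a\<close> on \<open>csa T\<close> and the shifted \<open>b\<close> on derivations and
  ignores the central coordinates.\<close>

lemma wt_finite_dimensional:
  assumes "a \<in> dual (csa T)" and b: "\<And>d e. b (d + e) = b d + b e" "\<And>c d. b (c *\<^sub>C d) = c * b d"
  obtains G where "finite G" "cv.span G = wt b a k"
proof -
  have carrier: "x \<in> glt_cartan T \<longleftrightarrow> (\<exists>h c d. h \<in> csa T \<and>
      x = (Poly_Mapping.single 0 h, \<Sum>i\<in>UNIV. c i *\<^sub>C K i, d))" for x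
    by (auto simp: glt_cartan_def monomial_def central_def derivation_def)
  define \<mu> :: "('g, 'n) glt \<Rightarrow> complex" where "\<mu> x = (if x \<in> glt_cartan T
    then a (Poly_Mapping.lookup (fst x) 0) + (b (snd (snd x)) + pairing (snd (snd x)) k) else 0)" for x
  have \<mu>: "\<mu> (Poly_Mapping.single 0 h, \<Sum>i\<in>UNIV. c i *\<^sub>C K i, d) = a h + (b d + pairing d k)"
    if "h \<in> csa T" for h c d
    using that by (auto simp: \<mu>_def carrier)
  have add: "(Poly_Mapping.single 0 h, \<Sum>i\<in>UNIV. c i *\<^sub>C K i, d) +
      (Poly_Mapping.single 0 h', \<Sum>i\<in>UNIV. c' i *\<^sub>C K i, d') =
      (Poly_Mapping.single 0 (h + h'), \<Sum>i\<in>UNIV. (c i + c' i) *\<^sub>C K i, d + d')"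
    for h h' :: 'g and c c' :: "'n \<Rightarrow> complex" and d d'
    by (simp add: single_add cv.scale_left_distrib sum.distrib)
  have scale: "e *\<^sub>C (Poly_Mapping.single 0 h, \<Sum>i\<in>UNIV. c i *\<^sub>C K i, d) =
      (Poly_Mapping.single 0 (e *\<^sub>C h), \<Sum>i\<in>UNIV. (e * c i) *\<^sub>C K i, e *\<^sub>C d)"
    for h :: 'g and c :: "'n \<Rightarrow> complex" and d e
    by (auto simp: scaleC_prod_def cv.scale_sum_right lookup_scaleC lookup_single when_def
      intro!: poly_mapping_eqI)
  have "\<mu> \<in> dual (glt_cartan T)"
    unfolding dual_def
  proof (intro CollectI conjI ballI allI impI)
    fix x y assume "x \<in> glt_cartan T" "y \<in> glt_cartan T"
    then obtain h c d h' c' d' where *: "h \<in> csa T" "h' \<in> csa T"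
      "x = (Poly_Mapping.single 0 h, \<Sum>i\<in>UNIV. c i *\<^sub>C K i, d)"
      "y = (Poly_Mapping.single 0 h', \<Sum>i\<in>UNIV. c' i *\<^sub>C K i, d')"
      unfolding carrier by blast
    then show "\<mu> (x + y) = \<mu> x + \<mu> y"
      using dual_csa(1)[OF assms(1)] cv.subspace_add[OF csa_subspace]
      by (simp only: \<mu> add) (simp add: b pairing_add)
  next
    fix e x assume "x \<in> glt_cartan T"
    then obtain h c d where *: "h \<in> csa T"
      "x = (Poly_Mapping.single 0 h, \<Sum>i\<in>UNIV. c i *\<^sub>C K i, d)"
      unfolding carrier by blast
    then show "\<mu> (e *\<^sub>C x) = e * \<mu> x"
      using dual_scale(1)[OF assms(1)] cv.subspace_scale[OF csa_subspace]
      by (simp only: \<mu> scale) (simp add: b pairing_scale distrib_left)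
  qed (simp add: \<mu>_def)
  then have "fin_dim (weight_space T \<rho> \<mu>)" using integrable by (simp add: integrable_def)
  moreover have "weight_space T \<rho> \<mu> = wt b a k"
  proof (intro equalityI subsetI)
    fix v assume v: "v \<in> weight_space T \<rho> \<mu>"
    have zero: "0 \<in> csa T" "a 0 = 0"
      using cv.subspace_0[OF csa_subspace] dual_csa(3)[OF assms(1)] by auto
    have "b 0 = 0" using b(2)[of 0 0] by simp
    have "act h 0 v = a h *\<^sub>C v" if "h \<in> csa T" for h
    proof -
      have "(monomial h 0 :: ('g, 'n) glt) = (Poly_Mapping.single 0 h, \<Sum>i\<in>UNIV. (0 :: complex) *\<^sub>C K i, 0)"
        by (simp add: monomial_def)
      then have "\<mu> (monomial h 0) = a h"
        using \<mu>[OF that, of "\<lambda>_. 0" 0] \<open>b 0 = 0\<close> pairing_scale[of 0 0 k] by auto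
      then show ?thesis using v monomial_cartan[OF that] by (simp add: weight_space_def act_def)
    qed
    moreover have "\<rho> (derivation d) v = (b d + pairing d k) *\<^sub>C v" for d
    proof -
      have "(derivation d :: ('g, 'n) glt) = (Poly_Mapping.single 0 0, \<Sum>i\<in>UNIV. (0 :: complex) *\<^sub>C K i, d)"
        by (simp add: derivation_def)
      then have "\<mu> (derivation d) = b d + pairing d k"
        using zero \<mu>[OF zero(1), of "\<lambda>_. 0" d] by auto
      then show ?thesis using v derivation_cartan[of d] by (simp add: weight_space_def)
    qed
    ultimately show "v \<in> wt b a k" by (simp add: wt_def)
  next
    fix v assume v: "v \<in> wt b a k"
    have "\<rho> x v = \<mu> x *\<^sub>C v" if x: "x \<in> glt_cartan T" for x
    proof -
      obtain h c d where h: "h \<in> csa T"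
        and x: "x = (Poly_Mapping.single 0 h, \<Sum>i\<in>UNIV. c i *\<^sub>C K i, d)"
        using \<open>x \<in> glt_cartan T\<close> unfolding carrier by blast
      have x': "x = monomial h 0 + (central (\<Sum>i\<in>UNIV. c i *\<^sub>C K i) + derivation d)"
        by (simp add: x monomial_def central_def derivation_def)
      have carr: "monomial h 0 \<in> glt_carrier T" "central (\<Sum>i\<in>UNIV. c i *\<^sub>C K i) \<in> glt_carrier T"
        using h csa_grade monomial_carrier central_carrier K_symbols by auto
      have "central (\<Sum>i\<in>UNIV. c i *\<^sub>C K i) + derivation d \<in> glt_carrier T"
        using cv.subspace_0[OF subspace_grade] K_symbols
        by (auto simp: central_def derivation_def glt_carrier_def LT_def)
      then have "\<rho> x v = act h 0 v + \<rho> (derivation d) v"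
        using carr derivation_carrier by (simp add: x' M.add_left act_def rho_central)
      then show ?thesis
        using v h \<mu>[OF h, of c d] by (simp add: wt_def x cv.scale_left_distrib)
    qed
    then show "v \<in> weight_space T \<rho> \<mu>" by (simp add: weight_space_def)
  qed
  ultimately show thesis using that by (auto simp: fin_dim_def)
qed

section \<open>Local finiteness over the degree zero part\<close>

lemma weight_decomposition:
  "\<exists>f. (\<forall>\<mu>\<in>dual (glt_cartan T). f \<mu> \<in> weight_space T \<rho> \<mu>) \<and>
    (\<forall>\<mu>. \<mu> \<notin> dual (glt_cartan T) \<longrightarrow> f \<mu> = 0) \<and> finite {\<mu>. f \<mu> \<noteq> 0} \<and>
    v = (\<Sum>\<mu> | f \<mu> \<noteq> 0. f \<mu>)"
  using integrable unfolding integrable_def is_direct_sum_def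
  by (intro ex1_implies_ex) (elim conjE allE, assumption)

text \<open>A vector is a finite sum of weight vectors, and their span is stable under
  \<open>csa T\<close>.\<close>

lemma csa_locally_finite:
  assumes "h \<in> csa T"
  shows "\<exists>G. finite G \<and> (\<forall>j. (act h 0 ^^ j) v \<in> cv.span G)"
proof -
  interpret L: Vector_Spaces.linear scaleC scaleC "act h 0"
    by (rule linear_act) (use assms csa_grade in auto)
  obtain f where f: "\<forall>\<mu>\<in>dual (glt_cartan T). f \<mu> \<in> weight_space T \<rho> \<mu>"
    "\<forall>\<mu>. \<mu> \<notin> dual (glt_cartan T) \<longrightarrow> f \<mu> = 0" "finite {\<mu>. f \<mu> \<noteq> 0}"
    "v = (\<Sum>\<mu> | f \<mu> \<noteq> 0. f \<mu>)"
    using weight_decomposition[of v] by (elim exE conjE) (rule that)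
  define G where "G = f ` {\<mu>. f \<mu> \<noteq> 0}"
  have eigen: "act h 0 (f \<mu>) = \<mu> (monomial h 0) *\<^sub>C f \<mu>" if "f \<mu> \<noteq> 0" for \<mu>
    using f(1,2) that monomial_cartan[OF assms] by (auto simp: weight_space_def act_def)
  have step: "act h 0 u \<in> cv.span G" if "u \<in> cv.span G" for u
    using that
  proof (induction rule: cv.span_induct_alt)
    case base
    then show ?case by (simp add: L.zero cv.span_zero)
  next
    case (step c x y)
    then obtain \<mu> where "x = f \<mu>" "f \<mu> \<noteq> 0" by (auto simp: G_def)
    then have "act h 0 (c *\<^sub>C x + y) = (c * \<mu> (monomial h 0)) *\<^sub>C x + act h 0 y"
      by (simp add: L.add L.scale eigen)
    then show ?case
      using step by (simp add: cv.span_add cv.span_scale cv.span_base)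
  qed
  have "(act h 0 ^^ j) v \<in> cv.span G" for j
  proof (induction j)
    case 0
    show ?case unfolding G_def f(4) by (auto intro!: cv.span_sum intro: cv.span_base)
  qed (simp add: step)
  then show ?thesis using f(3) G_def by blast
qed

lemma root_vector_locally_finite:
  assumes "x \<in> root_space T 0 \<alpha>" "\<alpha> \<in> dual (csa T)"
  shows "\<exists>G. finite G \<and> (\<forall>j. (act x 0 ^^ j) v \<in> cv.span G)"
proof (cases "\<alpha> = 0")
  case True
  then show ?thesis using csa_locally_finite assms root_space_zero by simp
next
  case False
  interpret L: Vector_Spaces.linear scaleC scaleC "act x 0"
    by (rule linear_act) (use assms in \<open>simp add: root_space_def\<close>)
  obtain N where N: "(act x 0 ^^ N) v = 0" using act_nilpotent False assms by blast
  have "(act x 0 ^^ j) v \<in> cv.span ((\<lambda>j. (act x 0 ^^ j) v) ` {..<N})" for j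
  proof (cases "j < N")
    case True
    then show ?thesis by (intro cv.span_base) auto
  next
    case False
    then have "(act x 0 ^^ j) v = (act x 0 ^^ (j - N)) ((act x 0 ^^ N) v)"
      by (metis comp_apply funpow_add le_add_diff_inverse2 not_less)
    also have "\<dots> = 0"
    proof -
      have "(act x 0 ^^ i) 0 = 0" for i by (induction i) (auto simp: L.zero)
      then show ?thesis using N by simp
    qed
    finally show ?thesis by (simp add: cv.span_zero)
  qed
  then show ?thesis by (meson finite_imageI finite_lessThan)
qed

lemma finite_dimensional_submodule:
  assumes "finite F"
  obtains M G where "cv.subspace M" "F \<subseteq> M" "\<And>x v. \<lbrakk>x \<in> grade T 0; v \<in> M\<rbrakk> \<Longrightarrow> act x 0 v \<in> M"
    "finite G" "M \<subseteq> cv.span G"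
proof -
  obtain G0 :: "'g set" where G0: "finite G0" "cv.span G0 = UNIV" by (rule finite_spanning)
  \<comment> \<open>Choosing the basis inside the union of the root spaces makes every basis element
    act locally finitely, as \<open>operator_family\<close> requires.\<close>
  define V where "V = (\<Union>\<alpha>\<in>dual (csa T). root_space T 0 \<alpha>)"
  obtain X where X: "X \<subseteq> V" "cv.independent X" "V \<subseteq> cv.span X"
    by (rule cv.maximal_independent_subset[of V])
  have "finite X" using finite_independent_span[OF G0(1), of id X] X G0 by auto
  then obtain xs where xs: "set xs = X" "distinct xs" using finite_distinct_list by blast
  define m where "m = length xs"
  have X_grade: "X \<subseteq> grade T 0" using X(1) by (auto simp: V_def root_space_def)
  have grade_span: "\<exists>c. x = (\<Sum>l<m. c l *\<^sub>C xs ! l)" if x: "x \<in> grade T 0" for x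
  proof -
    obtain C f where C: "C \<subseteq> dual (csa T)" "\<And>\<alpha>. f \<alpha> \<in> root_space T 0 \<alpha>" "x = (\<Sum>\<alpha>\<in>C. f \<alpha>)"
      by (rule root_space_decomposition[OF x]) (rule that)
    have "f \<alpha> \<in> cv.span X" if "\<alpha> \<in> C" for \<alpha>
      using C(1) C(2)[of \<alpha>] X(3) that by (auto simp: V_def)
    then have "x \<in> cv.span X" unfolding C(3) by (rule cv.span_sum)
    then obtain u where u: "x = (\<Sum>y\<in>X. u y *\<^sub>C y)"
      unfolding cv.span_finite[OF \<open>finite X\<close>] by auto
    have "(\<Sum>y\<in>X. u y *\<^sub>C y) = (\<Sum>l<m. u (xs ! l) *\<^sub>C xs ! l)"
      using bij_betw_nth[OF xs(2), of "{..<m}" X] xs(1)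
      by (intro sum.reindex_bij_betw[symmetric]) (simp add: m_def)
    then show ?thesis using u by (intro exI[of _ "\<lambda>l. u (xs ! l)"]) simp
  qed
  have nth: "xs ! i \<in> grade T 0" "xs ! i \<in> V" if "i < m" for i
    using that X_grade X(1) xs(1) by (auto simp: m_def)
  have act_span: "act (\<Sum>l<m. c l *\<^sub>C xs ! l) 0 v = (\<Sum>l<m. c l *\<^sub>C act (xs ! l) 0 v)" for c v
    using nth(1) cv.subspace_scale[OF subspace_grade]
    by (subst act_sum) (auto simp: act_scale intro!: sum.cong)
  interpret P: operator_family "\<lambda>i. act (xs ! i) 0" m
  proof (rule operator_family.intro)
    show "Vector_Spaces.linear scaleC scaleC (act (xs ! i) 0)" if "i < m" for i
      using linear_act nth that by blast
    show "\<exists>G. finite G \<and> (\<forall>a. (act (xs ! i) 0 ^^ a) v \<in> cv.span G)" if "i < m" for i v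
      using nth(2)[OF that] root_vector_locally_finite by (auto simp: V_def)
    fix i j assume i: "i < m" and j: "j < m"
    have "br T (xs ! i) (xs ! j) \<in> grade T 0" using G.closed nth i j by blast
    then obtain c where c: "br T (xs ! i) (xs ! j) = (\<Sum>l<m. c l *\<^sub>C xs ! l)"
      using grade_span by blast
    show "\<exists>c. \<forall>v. act (xs ! i) 0 (act (xs ! j) 0 v) =
        act (xs ! j) 0 (act (xs ! i) 0 v) + (\<Sum>l<m. c l *\<^sub>C act (xs ! l) 0 v)"
    proof (intro exI allI)
      fix v
      show "act (xs ! i) 0 (act (xs ! j) 0 v) =
          act (xs ! j) 0 (act (xs ! i) 0 v) + (\<Sum>l<m. c l *\<^sub>C act (xs ! l) 0 v)"
        using act_commutator[OF nth(1)[OF i] nth(1)[OF j], of v]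
        by (simp add: c act_span add.commute)
    qed
  qed
  obtain M G where M: "cv.subspace M" "F \<subseteq> M" "\<And>i v. \<lbrakk>i < m; v \<in> M\<rbrakk> \<Longrightarrow> act (xs ! i) 0 v \<in> M"
    "finite G" "M \<subseteq> cv.span G"
    by (rule P.finite_dimensional_closure[OF assms]) (rule that)
  have "act x 0 v \<in> M" if "x \<in> grade T 0" "v \<in> M" for x v
  proof -
    obtain c where "x = (\<Sum>l<m. c l *\<^sub>C xs ! l)" using grade_span[OF \<open>x \<in> grade T 0\<close>] by blast
    then show ?thesis
      using M(3) \<open>v \<in> M\<close> by (auto simp: act_span intro!: cv.subspace_sum[OF M(1)] cv.subspace_scale[OF M(1)])
  qed
  then show thesis using that M by blast
qed

section \<open>Finiteness of the restricted weights\<close>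

lemma wt_raising:
  assumes "\<alpha> \<in> roots0 T" "a (coroot \<alpha>) = of_nat p" "p > 0" "v \<in> wt b a k"
  obtains e where "e \<in> root_space T 0 \<alpha>" "v \<in> act e 0 ` wt b (a - \<alpha>) k"
proof -
  obtain e f where ef: "e \<in> root_space T 0 \<alpha>" "f \<in> root_space T 0 (- \<alpha>)" "br T e f = coroot \<alpha>"
    by (rule sl2_triple[OF assms(1)])
  interpret S: sl2_action "act e 0" "act f (- 0)" "act (coroot \<alpha>) 0"
    by (rule sl2_action_act) (fact assms ef zero_Gamma)+
  have h: "act (coroot \<alpha>) 0 v = of_nat p *\<^sub>C v"
    using assms coroot_csa by (auto simp: wt_def)
  obtain N where N: "(act e 0 ^^ N) v = 0"
    using act_nilpotent[of \<alpha> e 0 v] assms(1) ef(1) by (auto simp: roots0_def)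
  have "v \<in> act e 0 ` wt b (a - \<alpha>) k"
  proof (rule S.raising_surjective[OF h assms(3) N assms(4) subspace_wt subspace_wt])
    show "act f (- 0) x \<in> wt b (a - \<alpha>) k" if "x \<in> wt b a k" for x
      using act_wt[OF ef(2) that] by simp
    show "act e 0 x \<in> wt b a k" if "x \<in> wt b (a - \<alpha>) k" for x
      using act_wt[OF ef(1) that] by simp
  qed
  then show thesis using that ef by blast
qed

lemma weight_norm_integral:
  assumes "wt b a k \<noteq> {0}"
  shows "weight_norm a \<in> \<int>"
proof -
  have "(Re (a (coroot \<beta>)))\<^sup>2 \<in> \<int>" if "\<beta> \<in> roots0 T" for \<beta>
    using wt_integral[OF that assms] by (auto elim!: Ints_cases intro: Ints_power)
  then show ?thesis unfolding weight_norm_def by (rule Ints_sum)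
qed

lemma finite_weights_in_degree:
  assumes a\<^sub>0: "a\<^sub>0 \<in> dual (csa T)"
    and b: "\<And>d e. b (d + e) = b d + b e" "\<And>c d. b (c *\<^sub>C d) = c * b d"
  shows "finite {a. a - a\<^sub>0 \<in> representable \<and> wt b a k \<noteq> {0}}"
proof -
  have dual: "a \<in> dual (csa T)" if "a - a\<^sub>0 \<in> representable" for a
    using cv.subspace_add[OF subspace_dual representable_dual[OF that] a\<^sub>0] by simp
  \<comment> \<open>The weights of the coset that no root can shorten. Their weight spaces in degree
    \<open>k\<close> generate the finite-dimensional submodule \<open>M\<close>.\<close>
  define S where "S = {a. a - a\<^sub>0 \<in> representable \<and> (\<forall>\<alpha>\<in>roots0 T. a (coroot \<alpha>) \<in> {-1, 0, 1})}"
  have "finite S" unfolding S_def by (rule finite_bounded_weights) simp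
  have "\<exists>B. finite B \<and> cv.span B = wt b a k" if "a \<in> S" for a
    using wt_finite_dimensional[of a b k] that dual b by (metis (mono_tags, lifting) S_def mem_Collect_eq)
  then obtain B where B: "\<And>a. a \<in> S \<Longrightarrow> finite (B a)" "\<And>a. a \<in> S \<Longrightarrow> cv.span (B a) = wt b a k"
    by metis
  define F where "F = (\<Union>a\<in>S. B a)"
  have "finite F" using B \<open>finite S\<close> by (simp add: F_def)
  then obtain M G where M: "cv.subspace M" "F \<subseteq> M"
    "\<And>x v. \<lbrakk>x \<in> grade T 0; v \<in> M\<rbrakk> \<Longrightarrow> act x 0 v \<in> M" "finite G" "M \<subseteq> cv.span G"
    by (rule finite_dimensional_submodule) (rule that)
  have wt_M: "wt b a k \<subseteq> M" if "a - a\<^sub>0 \<in> representable" for a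
    using that
  \<comment> \<open>The norm is a nonnegative integer whenever the weight space is non-zero, so a
    strict decrease of the norm is a strict decrease of this natural number.\<close>
  proof (induction "nat \<lfloor>weight_norm a\<rfloor>" arbitrary: a rule: less_induct)
    case less
    show ?case
    proof (cases "wt b a k = {0}")
      case True
      then show ?thesis using cv.subspace_0[OF M(1)] by simp
    next
      case nonzero: False
      show ?thesis
      proof (cases "\<exists>\<alpha>\<in>roots0 T. \<exists>p::nat. a (coroot \<alpha>) = of_nat p \<and> p \<ge> 2")
        case True
        then obtain \<alpha> p where \<alpha>: "\<alpha> \<in> roots0 T" "a (coroot \<alpha>) = of_nat p" "p \<ge> 2" by blast
        have lower: "wt b (a - \<alpha>) k \<subseteq> M"
        proof (cases "wt b (a - \<alpha>) k = {0}")
          case True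
          then show ?thesis using cv.subspace_0[OF M(1)] by simp
        next
          case False
          obtain i j where ij: "weight_norm a = of_int i" "weight_norm (a - \<alpha>) = of_int j"
            using weight_norm_integral[OF nonzero] weight_norm_integral[OF False] by (auto elim!: Ints_cases)
          have "j < i"
            using weight_norm_decreases[OF \<alpha>(1) dual[OF less.prems] \<alpha>(2,3)] ij by simp
          moreover have "weight_norm (a - \<alpha>) \<ge> 0" by (simp add: weight_norm_def sum_nonneg)
          ultimately have "nat \<lfloor>weight_norm (a - \<alpha>)\<rfloor> < nat \<lfloor>weight_norm a\<rfloor>"
            using ij by simp
          moreover have "a - \<alpha> - a\<^sub>0 \<in> representable"
            using cv.subspace_diff[OF subspace_representable less.prems roots_representable[OF \<alpha>(1)]]
            by (simp add: algebra_simps)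
          ultimately show ?thesis by (rule less.hyps)
        qed
        show ?thesis
        proof
          fix v assume "v \<in> wt b a k"
          then obtain e where "e \<in> root_space T 0 \<alpha>" "v \<in> act e 0 ` wt b (a - \<alpha>) k"
            using wt_raising[of \<alpha> a p v b k] \<alpha> by (metis less_le_trans zero_less_numeral)
          then show "v \<in> M" using M(3) lower by (auto simp: root_space_def)
        qed
      next
        case False
        \<comment> \<open>The failed case excludes values of at least 2 at every root; applied to
          \<open>- \<alpha>\<close> it excludes values of at most -2 as well.\<close>
        have "a (coroot \<alpha>) \<in> {-1, 0, 1}" if \<alpha>: "\<alpha> \<in> roots0 T" for \<alpha>
        proof -
          obtain p :: int where p: "a (coroot \<alpha>) = of_int p"
            using wt_integral[OF \<alpha> nonzero] by (auto elim: Ints_cases)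
          have "a (coroot (- \<alpha>)) = of_int (- p)"
            using root_minus(2)[OF \<alpha>] dual_scale(2)[OF dual[OF less.prems] coroot_csa[OF \<alpha>]] p by simp
          then have "\<not> - p \<ge> 2"
            using False root_minus(1)[OF \<alpha>]
            by (metis nat_0_le nat_le_iff of_int_of_nat_eq order_trans zero_le_numeral nat_numeral
              nat_mono)
          moreover have "\<not> p \<ge> 2"
            using False \<alpha> p
            by (metis nat_0_le nat_le_iff of_int_of_nat_eq order_trans zero_le_numeral nat_numeral
              nat_mono)
          ultimately have "p \<in> {-1, 0, 1}" by auto
          then show ?thesis using p by auto
        qed
        then have "a \<in> S" using less.prems by (simp add: S_def)
        then have "B a \<subseteq> M" using M(2) by (auto simp: F_def)
        then show ?thesis using cv.span_minimal[OF _ M(1)] B(2) \<open>a \<in> S\<close> by metis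
      qed
    qed
  qed
  show ?thesis
  proof (rule finite_eigenvalues[where I = "csa T" and op = "\<lambda>h. act h 0" and ev = "\<lambda>a. a",
        OF \<open>finite G\<close>])
    show "Vector_Spaces.linear scaleC scaleC (act h 0)" if "h \<in> csa T" for h
      using that csa_grade linear_act by blast
    show "\<exists>h\<in>csa T. p h \<noteq> q h" if "p \<in> {a. a - a\<^sub>0 \<in> representable \<and> wt b a k \<noteq> {0}}"
      "q \<in> {a. a - a\<^sub>0 \<in> representable \<and> wt b a k \<noteq> {0}}" "p \<noteq> q" for p q
      using that dual dual_eqI by blast
    fix a assume a: "a \<in> {a. a - a\<^sub>0 \<in> representable \<and> wt b a k \<noteq> {0}}"
    then obtain v where v: "v \<in> wt b a k" "v \<noteq> 0"
      using cv.subspace_0[OF subspace_wt, of b a k] by auto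
    then have "v \<in> cv.span G" using wt_M M(5) a by blast
    then show "\<exists>v\<in>cv.span G. v \<noteq> 0 \<and> (\<forall>h\<in>csa T. act h 0 v = a h *\<^sub>C v)"
      using v by (auto simp: wt_def)
  qed
qed

lemma finite_weights:
  assumes a\<^sub>0: "a\<^sub>0 \<in> dual (csa T)"
    and b: "\<And>d e. b (d + e) = b d + b e" "\<And>c d. b (c *\<^sub>C d) = c * b d"
  shows "finite {a. a - a\<^sub>0 \<in> representable \<and> (\<exists>k. wt b a k \<noteq> {0})}"
proof -
  have dual: "a \<in> dual (csa T)" if "a - a\<^sub>0 \<in> representable" for a
    using cv.subspace_add[OF subspace_dual representable_dual[OF that] a\<^sub>0] by simp
  \<comment> \<open>Representatives of all degrees modulo twice \<open>Gamma T\<close>, the period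
    provided by \<open>wt_periodic\<close>.\<close>
  define Box :: "(int ^ 'n) set" where "Box = {k. \<forall>i. k $ i \<in> {0..<2 * int (sig_ord T i)}}"
  have "Box \<subseteq> vec_lambda ` (\<Pi>\<^sub>E i\<in>UNIV. {0..<2 * int (sig_ord T i)})"
  proof
    fix k assume "k \<in> Box"
    then have "k = vec_lambda (($) k)" "($) k \<in> (\<Pi>\<^sub>E i\<in>UNIV. {0..<2 * int (sig_ord T i)})"
      by (auto simp: Box_def)
    then show "k \<in> vec_lambda ` (\<Pi>\<^sub>E i\<in>UNIV. {0..<2 * int (sig_ord T i)})" by blast
  qed
  then have "finite Box" by (rule finite_subset) (intro finite_imageI finite_PiE, auto)
  have Box: "\<exists>l\<in>Gamma T. k + 2 *s l \<in> Box" for k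
  proof
    \<comment> \<open>Minus \<open>sig_ord T i\<close> times the quotient by twice the order, so
      that adding \<open>2 l\<close> leaves exactly the remainder.\<close>
    define l :: "int ^ 'n" where
      "l = (\<chi> i. - (int (sig_ord T i) * (k $ i div (2 * int (sig_ord T i)))))"
    show "l \<in> Gamma T" by (simp add: l_def Gamma_def)
    have "(k + 2 *s l) $ i = k $ i mod (2 * int (sig_ord T i))" for i
      by (simp add: l_def minus_mult_div_eq_mod[symmetric])
    then show "k + 2 *s l \<in> Box" using sig_order(1) by (simp add: Box_def)
  qed
  define D where "D k = {a. a - a\<^sub>0 \<in> representable \<and> wt b a k \<noteq> {0}}" for k
  define Z where "Z = {a. a - a\<^sub>0 \<in> representable \<and> (\<forall>\<alpha>\<in>roots0 T. a (coroot \<alpha>) \<in> {0})}"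
  have "{a. a - a\<^sub>0 \<in> representable \<and> (\<exists>k. wt b a k \<noteq> {0})} \<subseteq>
      Z \<union> (\<lambda>(a, \<alpha>). a + \<alpha>) ` ((\<Union>k\<in>Box. D k) \<times> roots0 T)"
  proof
    fix a assume "a \<in> {a. a - a\<^sub>0 \<in> representable \<and> (\<exists>k. wt b a k \<noteq> {0})}"
    then obtain k where a: "a - a\<^sub>0 \<in> representable" "wt b a k \<noteq> {0}" by blast
    show "a \<in> Z \<union> (\<lambda>(a, \<alpha>). a + \<alpha>) ` ((\<Union>k\<in>Box. D k) \<times> roots0 T)"
    proof (cases "\<forall>\<alpha>\<in>roots0 T. a (coroot \<alpha>) = 0")
      case True
      then show ?thesis using a by (simp add: Z_def)
    next
      case False
      \<comment> \<open>A root with non-zero value exists; passing to its negative if necessary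
        makes the value positive.\<close>
      have "\<exists>\<alpha>\<in>roots0 T. \<exists>p::int. a (coroot \<alpha>) = of_int p \<and> p > 0"
      proof -
        obtain \<alpha> where \<alpha>: "\<alpha> \<in> roots0 T" "a (coroot \<alpha>) \<noteq> 0" using False by blast
        obtain p :: int where p: "a (coroot \<alpha>) = of_int p"
          using wt_integral[OF \<alpha>(1) a(2)] by (auto elim: Ints_cases)
        have "a (coroot (- \<alpha>)) = of_int (- p)"
          using root_minus(2)[OF \<alpha>(1)] dual_scale(2)[OF dual[OF a(1)] coroot_csa[OF \<alpha>(1)]] p by simp
        moreover have "p \<noteq> 0" using p \<alpha>(2) by auto
        ultimately show ?thesis
          using p \<alpha>(1) root_minus(1)[OF \<alpha>(1)] by (metis linorder_neqE neg_0_less_iff_less)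
      qed
      then obtain \<alpha> p where \<alpha>: "\<alpha> \<in> roots0 T" "a (coroot \<alpha>) = of_int p" "p > 0" by blast
      obtain l where l: "l \<in> Gamma T" "k + 2 *s l \<in> Box" using Box by blast
      have "wt b (a - \<alpha>) (k + 2 *s l) \<noteq> {0}"
        by (rule wt_periodic[OF \<alpha>(1) a(2) dual[OF a(1)] \<alpha>(2,3) l(1)])
      moreover have "a - \<alpha> - a\<^sub>0 \<in> representable"
        using cv.subspace_diff[OF subspace_representable a(1) roots_representable[OF \<alpha>(1)]]
        by (simp add: algebra_simps)
      ultimately have "(a - \<alpha>, \<alpha>) \<in> (\<Union>k\<in>Box. D k) \<times> roots0 T"
        using l(2) \<alpha>(1) by (auto simp: D_def)
      moreover have "a = (\<lambda>(a, \<alpha>). a + \<alpha>) (a - \<alpha>, \<alpha>)" by simp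
      ultimately show ?thesis by blast
    qed
  qed
  moreover have "finite Z" unfolding Z_def by (rule finite_bounded_weights) simp
  moreover have "finite (D k)" for k unfolding D_def by (rule finite_weights_in_degree) fact+
  ultimately show ?thesis using \<open>finite Box\<close> roots_finite by (auto elim!: finite_subset)
qed

section \<open>The vector killed by the positive part\<close>

lemma roots_en_representable:
  assumes "\<alpha> \<in> roots_en T"
  shows "\<alpha> \<in> representable" "\<alpha> \<noteq> 0"
proof -
  obtain \<beta> where "\<beta> \<in> roots0 T" "\<alpha> = \<beta> \<or> \<alpha> = 2 *\<^sub>C \<beta>"
    using assms by (auto simp: roots_en_def short_roots0_def split: if_splits)
  then show "\<alpha> \<in> representable" "\<alpha> \<noteq> 0"
    using roots_representable cv.subspace_scale[OF subspace_representable] by (auto simp: roots0_def)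
qed

text \<open>Any non-zero component of a non-zero vector has a weight. Its values on derivations
  become the base \<open>b\<close>, so that this weight sits in degree 0.\<close>

lemma exists_weight:
  assumes "\<exists>v::'v. v \<noteq> 0"
  obtains a b where "a \<in> dual (csa T)" "\<And>d e. b (d + e) = b d + b e" "\<And>c d. b (c *\<^sub>C d) = c * b d"
    "wt b a 0 \<noteq> {0}"
proof -
  obtain v :: 'v where "v \<noteq> 0" using assms by blast
  obtain f where f: "\<forall>\<mu>\<in>dual (glt_cartan T). f \<mu> \<in> weight_space T \<rho> \<mu>"
    "\<forall>\<mu>. \<mu> \<notin> dual (glt_cartan T) \<longrightarrow> f \<mu> = 0" "v = (\<Sum>\<mu> | f \<mu> \<noteq> 0. f \<mu>)"
    using weight_decomposition[of v] by (elim exE conjE) (rule that)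
  then obtain \<mu> where "f \<mu> \<noteq> 0" using \<open>v \<noteq> 0\<close> by (metis (mono_tags, lifting) empty_iff mem_Collect_eq sum.neutral)
  then have \<mu>: "\<mu> \<in> dual (glt_cartan T)" and w: "f \<mu> \<in> weight_space T \<rho> \<mu>" using f by auto
  note h = monomial_cartan and d = derivation_cartan
  define a where "a h = (if h \<in> csa T then \<mu> (monomial h 0) else 0)" for h
  have "a \<in> dual (csa T)"
    using \<mu> h cv.subspace_add[OF csa_subspace] cv.subspace_scale[OF csa_subspace]
    by (auto simp: a_def dual_def monomial_add monomial_scale)
  moreover have "\<mu> (derivation (d + e)) = \<mu> (derivation d) + \<mu> (derivation e)"
    "\<mu> (derivation (c *\<^sub>C d)) = c * \<mu> (derivation d)" for c d e
    using \<mu> d by (auto simp: dual_def derivation_add derivation_scale)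
  moreover have "f \<mu> \<in> wt (\<lambda>d. \<mu> (derivation d)) a 0"
    using w h d by (auto simp: weight_space_def wt_def a_def act_def pairing_zero)
  ultimately show thesis using that[of a "\<lambda>d. \<mu> (derivation d)"] \<open>f \<mu> \<noteq> 0\<close> by blast
qed

theorem exists_highest_weight_vector:
  assumes "\<exists>v::'v. v \<noteq> 0" and S: "cv.independent S" "finite S"
  shows "\<exists>v. v \<noteq> 0 \<and> (\<forall>x\<in>glt_plus T S. \<rho> x v = 0)"
proof -
  obtain a\<^sub>0 b where a\<^sub>0: "a\<^sub>0 \<in> dual (csa T)"
    and b: "\<And>d e. b (d + e) = b d + b e" "\<And>c d. b (c *\<^sub>C d) = c * b d"
    and wt0: "wt b a\<^sub>0 0 \<noteq> {0}"
    by (rule exists_weight[OF assms(1)]) (rule that)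
  define P where "P = {a. a - a\<^sub>0 \<in> representable \<and> (\<exists>k. wt b a k \<noteq> {0})}"
  have "finite P" unfolding P_def by (rule finite_weights) fact+
  have "a\<^sub>0 \<in> P" using wt0 cv.subspace_0[OF subspace_representable] by (auto simp: P_def)
  interpret VP: vector_space_pair "scaleC :: complex \<Rightarrow> ('g \<Rightarrow> complex) \<Rightarrow> _"
    "scaleC :: complex \<Rightarrow> complex \<Rightarrow> complex"
    by unfold_locales
  \<comment> \<open>A height function: it is 1 on each simple root, hence positive on positive
    elements. Weights may have complex height, so the real part is used for comparison.\<close>
  obtain \<phi> :: "('g \<Rightarrow> complex) \<Rightarrow> complex" where \<phi>: "Vector_Spaces.linear scaleC scaleC \<phi>"
    "\<And>s. s \<in> S \<Longrightarrow> \<phi> s = 1"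
    using VP.linear_independent_extend[OF S(1), of "\<lambda>_. 1"] by auto
  interpret \<phi>: Vector_Spaces.linear scaleC scaleC \<phi> by (rule \<phi>)
  have pos: "Re (\<phi> \<alpha>) > 0" if \<alpha>: "\<alpha> \<in> roots_en_pos T S" for \<alpha>
  proof -
    obtain c :: "_ \<Rightarrow> nat" where c: "\<alpha> = (\<Sum>s\<in>S. of_nat (c s) *\<^sub>C s)"
      using \<alpha> by (auto simp: roots_en_pos_def nonneg_combinations_def)
    have "\<phi> \<alpha> = of_nat (\<Sum>s\<in>S. c s)"
      by (simp add: c \<phi>.sum \<phi>.scale \<phi>(2) scaleC_complex_def)
    moreover have "(\<Sum>s\<in>S. c s) \<noteq> 0"
    proof
      assume "(\<Sum>s\<in>S. c s) = 0"
      then have "\<alpha> = 0" unfolding c using S(2) by (intro sum.neutral) simp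
      then show False using \<alpha> roots_en_representable(2) by (auto simp: roots_en_pos_def)
    qed
    ultimately show ?thesis by (metis neq0_conv of_nat_0_less_iff complex_Re_of_nat)
  qed
  have "Max ((\<lambda>a. Re (\<phi> a)) ` P) \<in> (\<lambda>a. Re (\<phi> a)) ` P"
    using \<open>finite P\<close> \<open>a\<^sub>0 \<in> P\<close> by (intro Max_in) auto
  then obtain a where "a \<in> P" "Re (\<phi> a) = Max ((\<lambda>a. Re (\<phi> a)) ` P)" by auto
  then have a: "a \<in> P" "\<And>a'. a' \<in> P \<Longrightarrow> Re (\<phi> a') \<le> Re (\<phi> a)"
    using \<open>finite P\<close> by auto
  then obtain k v where v: "v \<in> wt b a k" "v \<noteq> 0"
    using cv.subspace_0[OF subspace_wt, of b a] by (auto simp: P_def)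
  \<comment> \<open>Membership in the carrier is carried along because \<rho> is additive in its
    first argument only there.\<close>
  have kill: "x \<in> glt_carrier T \<and> \<rho> x v = 0" if "x \<in> glt_plus T S" for x
    using that unfolding glt_plus_def
  proof (induction rule: cv.span_induct_alt)
    case base
    show ?case using derivation_carrier[of 0] rho_zero by (simp add: derivation_def zero_prod_def)
  next
    case (step c x y)
    then obtain z l \<alpha> where x: "x = monomial z l" and \<alpha>: "\<alpha> \<in> roots_en_pos T S"
      and z: "z \<in> root_space T l \<alpha>"
      by blast
    have "act z l v = 0"
    proof (rule ccontr)
      assume "act z l v \<noteq> 0"
      \<comment> \<open>A non-zero image would put \<open>a + \<alpha>\<close> into the same coset
        \<open>P\<close> at greater height, whatever the degree \<open>l\<close>.\<close>
      then have "wt b (a + \<alpha>) (k + l) \<noteq> {0}" using act_wt[OF z v(1)] by auto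
      moreover have "a + \<alpha> - a\<^sub>0 \<in> representable"
        using cv.subspace_add[OF subspace_representable, of "a - a\<^sub>0" \<alpha>] a(1) \<alpha>
          roots_en_representable(1)
        by (simp add: P_def roots_en_pos_def algebra_simps)
      ultimately have "a + \<alpha> \<in> P" by (auto simp: P_def)
      then show False using a(2)[of "a + \<alpha>"] pos[OF \<alpha>] by (simp add: \<phi>.add)
    qed
    moreover have gr: "z \<in> grade T l" using z by (simp add: root_space_def)
    have carr: "c *\<^sub>C x \<in> glt_carrier T"
      unfolding x monomial_scale[symmetric]
      using gr by (intro monomial_carrier cv.subspace_scale[OF subspace_grade])
    moreover have "c *\<^sub>C x + y \<in> glt_carrier T"
      using carr step.IH carrier_add by blast
    ultimately show ?case
      using step monomial_carrier[OF gr] by (simp add: M.add_left M.scale_left x act_def)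
  qed
  then show ?thesis using v(2) by blast
qed

end

theorem proposition3p7:
  fixes T :: "('g::complex_vector, 'n::finite) torus_data"
    and S :: "('g \<Rightarrow> complex) set"
    and \<rho> :: "('g, 'n) glt \<Rightarrow> 'v::complex_vector \<Rightarrow> 'v"
  assumes "lie_torus T"
    and "simple_roots (roots0 T) S"
    and "lie_module (glt_bracket T) (glt_carrier T) \<rho> UNIV"
    and "lie_irreducible (glt_carrier T) \<rho> UNIV"
    and "integrable T \<rho>"
    and "\<And>i v. \<rho> (central (K i)) v = 0"
  shows "\<exists>v. v \<noteq> 0 \<and> (\<forall>x\<in>glt_plus T S. \<rho> x v = 0)"
proof -
  interpret lie_torus T by fact
  interpret M: lie_module "glt_bracket T" "glt_carrier T" \<rho> UNIV by fact
  interpret level_zero_module T \<rho> by unfold_locales fact+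
  \<comment> \<open>Irreducibility includes that the module is non-zero.\<close>
  have "\<exists>v::'v. v \<noteq> 0" using assms(4) by (auto simp: lie_irreducible_def)
  then show ?thesis
    using assms(2) by (intro exists_highest_weight_vector) (auto simp: simple_roots_def)
qed

end
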